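(* Let $\Lambda$ be a finite measure on $[0,1]$ with $\Lambda(\{1\})=0$ and let $\nu(dx)=x^{-2}\Lambda(dx)$. Suppose that either - $\Lambda$ is in regime Discrete: $\nu([0,1))<\infty$; or - $\Lambda$ is in regime Infinite with dust, i.e. $\nu([0,1))=\infty$ and $\int_{[0,1)}x\,\nu(dx)<\infty$, and moreover $\int_{[0,1)}x\log\frac1x\,\nu(dx)<\infty$. Then almost surely the (càdlàg) $\Lambda$-Fleming-Viot process $(\rho_t,t\ge0)$ does not admit an infinite sequence of Eves; that is, almost surely there is no collection $(\mathrm e^i)_{i\ge1}$ of points of $[0,1]$ such that for every $i\ge1$, $\rho_t(\{\mathrm e^i\})/\rho_t([0,1]\setminus\{\mathrm e^1,\ldots,\mathrm e^{i-1}\})\to1$ as $t\to\infty$.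
   Context: **Convention.** If $\Lambda(\{0\})>0$ then $\nu(\{0\})=\infty$ and $\int_{\{0\}}x\,\nu(dx)=\infty$; hence in both regimes above $\Lambda(\{0\})=0$. **$\Lambda$-Fleming-Viot process.** $\mathcal M_1$ is the set of probability measures on $[0,1]$ with the weak topology. For $2\le k\le m$, $\lambda_{m,k}=\int_{[0,1]}x^{k-2}(1-x)^{m-k}\Lambda(dx)$. The $\Lambda$-Fleming-Viot process is the $\mathcal M_1$-valued process $(\rho_t,t\ge0)$, unique in law, started from Lebesgue measure, such that for all $n\ge1$ and continuous $f$ on $[0,1]^n$, $G_f(\rho_t)-\int_0^tLG_f(\rho_s)ds$ is a martingale, where $G_f(\mu)=\int f\,d\mu^{\otimes n}$, $LG_f(\mu)=\sum_{K\subset[n],k=\#K\ge2}\lambda_{n,k}\int\mu^{\otimes n}(dx)\,(f(R_K(x_1,\ldots,x_{n-k+1}))-f(x_1,\ldots,x_n))$, and $R_K(x_1,\ldots,x_{n-k+1})=(y_1,\ldots,y_n)$ with $y_i=x_{\min K}$ for $i\in K$ and the $y_i,i\notin K$, in increasing order of indices, equal to $x_1,\ldots,x_{\min K-1},x_{\min K+1},\ldots,x_{n-k+1}$. It is taken càdlàg (its semigroup is Feller). *)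

theory Defs
  imports "HOL-Probability.Probability"
begin

subsection \<open>Probability measures on the unit interval\<close>

abbreviation borel01 :: "real measure" where
  "borel01 \<equiv> restrict_space borel {0..1}"

abbreviation lebesgue01 :: "real measure" where
  "lebesgue01 \<equiv> restrict_space lborel {0..1}"

text \<open>The \<open>\<sigma>\<close>-algebra of \<open>prob_algebra borel01\<close>, generated by the evaluations
  \<open>\<mu> \<mapsto> \<mu> A\<close>, is the Borel \<open>\<sigma>\<close>-algebra of the weak topology.\<close>

abbreviation M1 :: "real measure measure" where
  "M1 \<equiv> prob_algebra borel01"

definition weak_topology :: "real measure topology" where
  "weak_topology = topology_generated_by
     {{\<mu> \<in> space M1. (\<integral>x. f x \<partial>\<mu>) \<in> U} | f U. continuous_on {0..1} f \<and> open (U :: real set)}"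

lemma topspace_weak_topology: "topspace weak_topology = space M1"
proof -
  have "\<exists>f U. space M1 = {\<mu> \<in> space M1. (\<integral>x. f x \<partial>\<mu>) \<in> U} \<and> continuous_on {0..1::real} f \<and> open (U :: real set)"
    by (rule exI[of _ "\<lambda>_. 0"], rule exI[of _ UNIV]) auto
  then show ?thesis
    unfolding weak_topology_def topology_generated_by_topspace by blast
qed

lemma limitin_weak_topology:
  "limitin weak_topology r \<mu> F \<longleftrightarrow>
     \<mu> \<in> space M1 \<and> eventually (\<lambda>t. r t \<in> space M1) F \<and>
     (\<forall>f :: real \<Rightarrow> real. continuous_on {0..1} f \<longrightarrow> ((\<lambda>t. \<integral>x. f x \<partial>r t) \<longlongrightarrow> (\<integral>x. f x \<partial>\<mu>)) F)"
    (is "?L \<longleftrightarrow> ?R")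
proof
  assume L: ?L
  then have "\<mu> \<in> space M1" by (simp add: limitin_def topspace_weak_topology)
  moreover have "eventually (\<lambda>t. r t \<in> space M1) F"
    using L unfolding limitin_def topspace_weak_topology[symmetric] by blast
  moreover have "((\<lambda>t. \<integral>x. f x \<partial>r t) \<longlongrightarrow> (\<integral>x. f x \<partial>\<mu>)) F" if f: "continuous_on {0..1} f" for f :: "real \<Rightarrow> real"
  proof (rule topological_tendstoI)
    fix U :: "real set" assume U: "open U" "(\<integral>x. f x \<partial>\<mu>) \<in> U"
    have "openin weak_topology {\<mu> \<in> space M1. (\<integral>x. f x \<partial>\<mu>) \<in> U}"
      unfolding weak_topology_def using f U by (intro topology_generated_by_Basis) blast
    then have "eventually (\<lambda>t. r t \<in> {\<mu> \<in> space M1. (\<integral>x. f x \<partial>\<mu>) \<in> U}) F"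
      using L U \<open>\<mu> \<in> space M1\<close> unfolding limitin_def by blast
    then show "eventually (\<lambda>t. (\<integral>x. f x \<partial>r t) \<in> U) F" by eventually_elim simp
  qed
  ultimately show ?R by simp
next
  assume R: ?R
  then have R1: "\<mu> \<in> space M1" and R2: "eventually (\<lambda>t. r t \<in> space M1) F"
    and R3: "continuous_on {0..1} f \<Longrightarrow> ((\<lambda>t. \<integral>x. f x \<partial>r t) \<longlongrightarrow> (\<integral>x. f x \<partial>\<mu>)) F" for f :: "real \<Rightarrow> real"
    by simp_all
  have "eventually (\<lambda>t. r t \<in> V) F" if "openin weak_topology V" "\<mu> \<in> V" for V
  proof -
    have "generate_topology_on {{\<mu> \<in> space M1. (\<integral>x. f x \<partial>\<mu>) \<in> U} | f U.
        continuous_on {0..1} f \<and> open (U :: real set)} V"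
      using that(1) by (simp add: weak_topology_def openin_topology_generated_by_iff)
    then show ?thesis using that(2)
    proof induction
      case Empty
      then show ?case by simp
    next
      case (Int a b)
      then have "eventually (\<lambda>t. r t \<in> a) F" "eventually (\<lambda>t. r t \<in> b) F" by blast+
      then show ?case by eventually_elim blast
    next
      case (UN K)
      then obtain k where k: "k \<in> K" "\<mu> \<in> k" by blast
      then have "eventually (\<lambda>t. r t \<in> k) F" using UN.IH by blast
      then show ?case by (rule eventually_mono) (use k in blast)
    next
      case (Basis s)
      then obtain f U where f: "continuous_on {0..1} f" "open U"
        and s: "s = {\<mu> \<in> space M1. (\<integral>x. f x \<partial>\<mu>) \<in> (U :: real set)}" by blast
      have "eventually (\<lambda>t. (\<integral>x. f x \<partial>r t) \<in> U) F"
      proof (rule topological_tendstoD)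
        show "((\<lambda>t. \<integral>x. f x \<partial>r t) \<longlongrightarrow> (\<integral>x. f x \<partial>\<mu>)) F" by (rule R3, rule f)
        show "open U" by (rule f)
        show "(\<integral>x. f x \<partial>\<mu>) \<in> U" using Basis.prems unfolding s by blast
      qed
      moreover have "eventually (\<lambda>t. r t \<in> space M1) F" by (rule R2)
      ultimately show ?case unfolding s by eventually_elim simp
    qed
  qed
  then show ?L using R1 by (simp add: limitin_def topspace_weak_topology)
qed

definition cadlag :: "'b topology \<Rightarrow> (real \<Rightarrow> 'b) \<Rightarrow> bool" where
  "cadlag T x \<longleftrightarrow>
     (\<forall>t\<ge>0. limitin T x (x t) (at_right t)) \<and>
     (\<forall>t>0. \<exists>l. limitin T x l (at_left t))"

subsection \<open>Martingales indexed by the nonnegative reals\<close>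

definition natural_filtration ::
  "'w measure \<Rightarrow> 'b measure \<Rightarrow> (real \<Rightarrow> 'w \<Rightarrow> 'b) \<Rightarrow> real \<Rightarrow> 'w measure" where
  "natural_filtration P N X t =
     sigma (space P) {X s -` A \<inter> space P | s A. 0 \<le> s \<and> s \<le> t \<and> A \<in> sets N}"

definition martingale ::
  "'w measure \<Rightarrow> (real \<Rightarrow> 'w measure) \<Rightarrow> (real \<Rightarrow> 'w \<Rightarrow> real) \<Rightarrow> bool" where
  "martingale P F X \<longleftrightarrow>
     (\<forall>t\<ge>0. subalgebra P (F t)) \<and>
     (\<forall>s t. 0 \<le> s \<and> s \<le> t \<longrightarrow> sets (F s) \<subseteq> sets (F t)) \<and>
     (\<forall>t\<ge>0. X t \<in> borel_measurable (F t) \<and> integrable P (X t)) \<and>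
     (\<forall>s t. 0 \<le> s \<and> s \<le> t \<longrightarrow> (AE \<omega> in P. real_cond_exp P (F s) (X t) \<omega> = X s \<omega>))"

subsection \<open>The \<open>\<Lambda>\<close>-Fleming-Viot process\<close>

definition coal_rate :: "real measure \<Rightarrow> nat \<Rightarrow> nat \<Rightarrow> real" where
  "coal_rate \<Lambda> m k = (\<integral>x. x ^ (k - 2) * (1 - x) ^ (m - k) \<partial>\<Lambda>)"

text \<open>Points of \<open>[0,1]\<^sup>n\<close> are the elements of \<open>{1..n} \<rightarrow>\<^sub>E {0..1}\<close>.\<close>

text \<open>The functionals \<open>G\<^sub>f\<close>; the operator \<open>L\<close> acts on them through \<open>FV_gen\<close> below.\<close>

definition FV_poly :: "nat \<Rightarrow> ((nat \<Rightarrow> real) \<Rightarrow> real) \<Rightarrow> real measure \<Rightarrow> real" where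
  "FV_poly n f \<mu> = (\<integral>x. f x \<partial>(\<Pi>\<^sub>M i\<in>{1..n}. \<mu>))"

text \<open>The coordinate \<open>y\<^sub>i\<close> of \<open>R\<^sub>K x\<close> is \<open>x\<^sub>j\<close> with \<open>j = R_index K i\<close>. An index \<open>i \<notin> K\<close> above
  \<open>Min K\<close> has rank \<open>i - #(K \<inter> {..<i})\<close> in the complement of \<open>K\<close>, and the list
  \<open>x\<^sub>1, x\<^sub>2, \<dots>\<close> to be filled in skips \<open>x\<^bsub>Min K\<^esub>\<close>, whence the shift by one.\<close>

definition R_index :: "nat set \<Rightarrow> nat \<Rightarrow> nat" where
  "R_index K i =
     (if i \<in> K then Min K
      else if i < Min K then i
      else i - card {j \<in> K. j < i} + 1)"

lemma R_index_order_iso: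
  assumes K: "K \<subseteq> {1..n}" "K \<noteq> {}"
  shows "strict_mono_on ({1..n} - K) (R_index K)"
    and "R_index K ` ({1..n} - K) = {1..n - card K + 1} - {Min K}"
proof -
  have fin: "finite K" using K(1) finite_subset by blast
  let ?m = "Min K" and ?c = "\<lambda>i. card {j \<in> K. j < i}"
  have m: "?m \<in> K" using fin K(2) by simp
  have m_le: "?m \<le> j" if "j \<in> K" for j using fin that by simp
  have c_up: "?c i \<le> i - ?m" for i
  proof -
    have "{j \<in> K. j < i} \<subseteq> {?m..<i}" using m_le by auto
    then have "?c i \<le> card {?m..<i}" by (intro card_mono) auto
    then show ?thesis by simp
  qed
  have c_pos: "1 \<le> ?c i" if "?m < i" for i
  proof -
    have "card {?m} \<le> ?c i" using m that fin by (intro card_mono) auto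
    then show ?thesis by simp
  qed
  have c_step: "?c i' \<le> ?c i + (i' - Suc i)" if "i < i'" "i \<notin> K" for i i'
  proof -
    have "{j \<in> K. j < i'} \<subseteq> {j \<in> K. j < i} \<union> {Suc i..<i'}"
    proof
      fix j assume j: "j \<in> {j \<in> K. j < i'}"
      then have "j \<noteq> i" using that by blast
      then have "j < i \<or> Suc i \<le> j" by linarith
      then show "j \<in> {j \<in> K. j < i} \<union> {Suc i..<i'}" using j by auto
    qed
    then have "?c i' \<le> card ({j \<in> K. j < i} \<union> {Suc i..<i'})"
      using fin by (intro card_mono) auto
    also have "\<dots> \<le> ?c i + card {Suc i..<i'}" by (rule card_Un_le)
    finally show ?thesis by simp
  qed
  have c_all: "card K \<le> ?c i + (n - i)" if "i \<notin> K" "i \<le> n" for i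
  proof -
    have "{j \<in> K. j < Suc n} = K" using K(1) by auto
    then show ?thesis using c_step[of i "Suc n"] that by simp
  qed
  have k_le: "card K + ?m \<le> n + 1"
  proof -
    have "K \<subseteq> {?m..n}" using m_le K(1) by auto
    then have "card K \<le> card {?m..n}" by (intro card_mono) auto
    moreover have "?m \<le> n" using m K(1) by auto
    ultimately show ?thesis by simp
  qed
  show sm: "strict_mono_on ({1..n} - K) (R_index K)"
  proof (rule strict_mono_onI)
    fix i i' assume i: "i \<in> {1..n} - K" "i' \<in> {1..n} - K" "i < i'"
    then have "i \<noteq> ?m" "i' \<noteq> ?m" using m by auto
    then show "R_index K i < R_index K i'"
      using i c_step[of i i'] c_up[of i] c_up[of i'] by (auto simp: R_index_def)
  qed
  have "R_index K ` ({1..n} - K) \<subseteq> {1..n - card K + 1} - {?m}"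
  proof
    fix y assume "y \<in> R_index K ` ({1..n} - K)"
    then obtain i where i: "i \<in> {1..n}" "i \<notin> K" and y: "y = R_index K i" by auto
    have "i \<noteq> ?m" using i m by auto
    then consider "i < ?m" | "?m < i" by linarith
    then show "y \<in> {1..n - card K + 1} - {?m}"
    proof cases
      case 1
      then show ?thesis using i y k_le by (auto simp: R_index_def)
    next
      case 2
      then show ?thesis using i y c_up[of i] c_pos[of i] c_all[of i]
        by (auto simp: R_index_def)
    qed
  qed
  moreover have "card (R_index K ` ({1..n} - K)) = card ({1..n - card K + 1} - {?m})"
  proof -
    have "1 \<le> ?m" using m K(1) by auto
    then have "?m \<in> {1..n - card K + 1}" using k_le by auto
    then have "card ({1..n - card K + 1} - {?m}) = n - card K" by simp
    moreover have "card (R_index K ` ({1..n} - K)) = card ({1..n} - K)"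
      by (intro card_image strict_mono_on_imp_inj_on sm)
    moreover have "card ({1..n} - K) = n - card K"
      using K(1) fin by (simp add: card_Diff_subset)
    ultimately show ?thesis by simp
  qed
  ultimately show "R_index K ` ({1..n} - K) = {1..n - card K + 1} - {?m}"
    by (intro card_subset_eq) auto
qed

text \<open>Only the first \<open>n - card K + 1\<close> coordinates of \<open>x\<close> are used.\<close>

definition FV_R :: "nat \<Rightarrow> nat set \<Rightarrow> (nat \<Rightarrow> real) \<Rightarrow> nat \<Rightarrow> real" where
  "FV_R n K x = (\<lambda>i\<in>{1..n}. x (R_index K i))"

definition FV_gen :: "real measure \<Rightarrow> nat \<Rightarrow> ((nat \<Rightarrow> real) \<Rightarrow> real) \<Rightarrow> real measure \<Rightarrow> real" where
  "FV_gen \<Lambda> n f \<mu> =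
     (\<Sum>K | K \<subseteq> {1..n} \<and> 2 \<le> card K.
        coal_rate \<Lambda> n (card K) * (\<integral>x. (f (FV_R n K x) - f x) \<partial>(\<Pi>\<^sub>M i\<in>{1..n}. \<mu>)))"

definition Fleming_Viot ::
  "real measure \<Rightarrow> 'w measure \<Rightarrow> (real \<Rightarrow> 'w \<Rightarrow> real measure) \<Rightarrow> bool" where
  "Fleming_Viot \<Lambda> P \<rho> \<longleftrightarrow>
     prob_space P \<and>
     (\<forall>t\<ge>0. \<rho> t \<in> measurable P M1) \<and>
     (\<forall>\<omega>\<in>space P. cadlag weak_topology (\<lambda>t. \<rho> t \<omega>)) \<and>
     (AE \<omega> in P. \<rho> 0 \<omega> = lebesgue01) \<and>
     (\<forall>n\<ge>1. \<forall>f. continuous_on ({1..n} \<rightarrow>\<^sub>E {0..1}) f \<longrightarrow>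
        martingale P (natural_filtration P M1 \<rho>)
          (\<lambda>t \<omega>. FV_poly n f (\<rho> t \<omega>) - (LBINT s:{0..t}. FV_gen \<Lambda> n f (\<rho> s \<omega>))))"

subsection \<open>Regimes and Eves\<close>

text \<open>Division is in \<open>ennreal\<close>, so an atom of \<open>\<Lambda>\<close> at \<open>0\<close> gives \<open>\<nu> {0} = \<infinity>\<close>.\<close>

definition nu :: "real measure \<Rightarrow> real measure" where
  "nu \<Lambda> = density \<Lambda> (\<lambda>x. 1 / ennreal (x\<^sup>2))"

definition regime_discrete :: "real measure \<Rightarrow> bool" where
  "regime_discrete \<Lambda> \<longleftrightarrow> emeasure (nu \<Lambda>) {0..<1} < \<infinity>"

text \<open>By convention the integral of \<open>x\<close> over \<open>{0}\<close> against \<open>\<nu>\<close> is infinite when \<open>\<Lambda>\<close> has an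
  atom at \<open>0\<close>. Since \<open>0 * \<infinity> = 0\<close> in \<open>ennreal\<close>, the absence of an atom is a separate conjunct.\<close>

definition regime_infinite_dust :: "real measure \<Rightarrow> bool" where
  "regime_infinite_dust \<Lambda> \<longleftrightarrow>
     emeasure (nu \<Lambda>) {0..<1} = \<infinity> \<and>
     emeasure \<Lambda> {0} = 0 \<and>
     (\<integral>\<^sup>+x\<in>{0..<1}. ennreal x \<partial>nu \<Lambda>) < \<infinity>"

text \<open>A quotient with vanishing denominator is \<open>0\<close>, so the limit \<open>1\<close> forces the denominator to be
  eventually positive.\<close>

definition Eves :: "(real \<Rightarrow> real measure) \<Rightarrow> (nat \<Rightarrow> real) \<Rightarrow> bool" where
  "Eves r e \<longleftrightarrow>
     (\<forall>i\<ge>1. e i \<in> {0..1}) \<and>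
     (\<forall>i\<ge>1. ((\<lambda>t. measure (r t) {e i} / measure (r t) ({0..1} - e ` {1..<i})) \<longlongrightarrow> 1) at_top)"

end

(*
  If the first two Eves e1, e2 exist, then there are rational intervals J <= U with e1 outside U
  and e2 in U - J, so that u = rho(U) -> 0 while b = rho(J) = o(u). This has probability 0 for
  fixed J <= U. An event of size x with parent outside U multiplies b and u by 1 - x and keeps
  u / b; the other events occur at rate u nu(dx) and increase ln (u / b) by at most
  ln (1 / (1 - x)) + ln (1 + x / u). The resulting drift u * int ln (1 + x / u) nu(dx) is
  compensated by the drift of a concave function G(u) with G'(u) a multiple of
  1 + int ln (1 + x / u) nu(dx), and G is finite exactly because int x ln (1 / x) nu(dx) is. Hence
  ln (u / b) / m + c_m G(u) + u / u0, cut off at 1, is a supermartingale; letting m -> oo, where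
  c_m -> 0, bounds the probability of the above event after u has dropped below delta by
  delta / u0. The division by m, followed by the cutoff at 1, deals with sizes x close to 1, for
  which ln (1 / (1 - x)) need not be nu-integrable.

  The martingale problem reaches Lipschitz functions F(b, u) by sampling: F of the empirical
  frequencies of n samples from rho is an admissible test function, and its generator converges
  boundedly to that of F(b, u) by the law of large numbers.
*)
theory Submission imports Defs begin

text \<open>The ratio of \<open>u\<close> and \<open>b\<close> changes only at events with parent in
  \<open>U\<close>, so it should freeze while \<open>u\<close> dies out; the difficulty is to show
  that the total change stays finite. The mass \<open>u\<close> is a martingale, so a concave
  \<open>G (u)\<close> drifts downwards, but a drift of order \<open>- u * G' (u)\<close> is needed.
  It comes from sizes bounded away from 0: such an event usually lowers \<open>u\<close> by
  \<open>x * u\<close>, where the slope of \<open>G\<close> is huge, and the upward jumps, which are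
  rare, cost little because \<open>G\<close> is bounded. The entropy expression in
  \<open>psi\<close> is the primitive of \<open>ln (1 + x / s)\<close> in \<open>s\<close>, and its
  concavity is the nonnegativity of a relative entropy. Test functions have to be Lipschitz, whereas
  \<open>ln (u / b)\<close> and the slope of \<open>G\<close> blow up at 0. All masses are therefore
  shifted by \<epsilon>. On the target event \<open>u\<close> is kept above some \<eta>, and
  \<epsilon> is tied to \<eta> and \<open>m\<close>. At the starting time the shift only helps, as
  \<open>(u + \<epsilon>) / (b + \<epsilon>) \<le> u / b\<close>, so \<eta> can be sent to 0 before
  any other limit. This needs \<open>b > 0\<close> at fixed times, which is why \<open>J\<close> has
  positive Lebesgue measure.\<close>

subsection \<open>Lipschitz functions of two masses\<close>

text \<open>An event of size \<open>x\<close> maps a mass \<open>p\<close> to \<open>(1 - x) * p + x\<close> if its parent is of the type in question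
  and to \<open>(1 - x) * p\<close> otherwise. For \<open>J \<subseteq> U\<close> of masses \<open>b \<le> u\<close>, the parent lies outside \<open>U\<close>, in \<open>J\<close>,
  or in \<open>U - J\<close>.\<close>

definition two_type_mean :: "(real \<Rightarrow> real \<Rightarrow> real) \<Rightarrow> real \<Rightarrow> real \<Rightarrow> real \<Rightarrow> real" where
  "two_type_mean F b u x = (1 - u) * F ((1 - x) * b) ((1 - x) * u)
     + b * F ((1 - x) * b + x) ((1 - x) * u + x) + (u - b) * F ((1 - x) * b) ((1 - x) * u + x)"

definition two_type_gen :: "real measure \<Rightarrow> (real \<Rightarrow> real \<Rightarrow> real) \<Rightarrow> real \<Rightarrow> real \<Rightarrow> real" where
  "two_type_gen \<nu> F b u = (\<integral>x. two_type_mean F b u x - F b u \<partial>\<nu>)"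

text \<open>Masses never leave the unit square, and the logarithmic functions used below need not be
  Lipschitz outside it, so nothing is required there.\<close>

definition lip01 :: "real \<Rightarrow> (real \<Rightarrow> real \<Rightarrow> real) \<Rightarrow> bool" where
  "lip01 L F \<longleftrightarrow> 0 \<le> L \<and>
     (\<forall>b\<in>{0..1}. \<forall>u\<in>{0..1}. \<forall>b'\<in>{0..1}. \<forall>u'\<in>{0..1}.
        \<bar>F b u - F b' u'\<bar> \<le> L * (\<bar>b - b'\<bar> + \<bar>u - u'\<bar>))"

lemma lip01D:
  assumes "lip01 L F" "b \<in> {0..1}" "u \<in> {0..1}" "b' \<in> {0..1}" "u' \<in> {0..1}"
  shows "\<bar>F b u - F b' u'\<bar> \<le> L * (\<bar>b - b'\<bar> + \<bar>u - u'\<bar>)"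
  using assms unfolding lip01_def by blast

lemma lip01_continuous:
  assumes "lip01 L F" "continuous_on S f" "continuous_on S g" "f ` S \<subseteq> {0..1}" "g ` S \<subseteq> {0..1}"
  shows "continuous_on S (\<lambda>x. F (f x) (g x))"
  unfolding continuous_on_def
proof
  fix x assume x: "x \<in> S"
  have "((\<lambda>y. L * (\<bar>f y - f x\<bar> + \<bar>g y - g x\<bar>)) \<longlongrightarrow> L * (\<bar>f x - f x\<bar> + \<bar>g x - g x\<bar>)) (at x within S)"
    using assms(2,3) x unfolding continuous_on_def by (intro tendsto_intros) auto
  then have "((\<lambda>y. L * (\<bar>f y - f x\<bar> + \<bar>g y - g x\<bar>)) \<longlongrightarrow> 0) (at x within S)" by simp
  then have "((\<lambda>y. F (f y) (g y) - F (f x) (g x)) \<longlongrightarrow> 0) (at x within S)"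
  proof (rule Lim_null_comparison[rotated])
    show "\<forall>\<^sub>F y in at x within S. norm (F (f y) (g y) - F (f x) (g x)) \<le> L * (\<bar>f y - f x\<bar> + \<bar>g y - g x\<bar>)"
      unfolding eventually_at_filter
      by (intro always_eventually allI impI) (use assms(4,5) x in \<open>auto intro!: lip01D[OF assms(1)]\<close>)
  qed
  then show "((\<lambda>x. F (f x) (g x)) \<longlongrightarrow> F (f x) (g x)) (at x within S)"
    by (rule LIM_zero_cancel)
qed

lemma lip01_measurable:
  assumes "lip01 L F" and [measurable]: "f \<in> borel_measurable M" "g \<in> borel_measurable M"
    and "\<And>x. x \<in> space M \<Longrightarrow> f x \<in> {0..1}" "\<And>x. x \<in> space M \<Longrightarrow> g x \<in> {0..1}"
  shows "(\<lambda>x. F (f x) (g x)) \<in> borel_measurable M"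
proof -
  \<comment> \<open>Clamping both arguments to the unit interval turns \<open>F\<close> into a
    continuous function on the whole plane without changing it on the square.\<close>
  define h :: "real \<Rightarrow> real" where "h = (\<lambda>x. max 0 (min 1 x))"
  have h: "h x = x" if "x \<in> {0..1}" for x using that by (simp add: h_def)
  have "continuous_on UNIV (\<lambda>z. F (h (fst z)) (h (snd z)))"
    by (rule lip01_continuous[OF assms(1)]) (auto simp: h_def intro!: continuous_intros)
  then have [measurable]: "(\<lambda>z. F (h (fst z)) (h (snd z))) \<in> borel_measurable borel"
    by (rule borel_measurable_continuous_onI)
  have "(\<lambda>x. (\<lambda>z. F (h (fst z)) (h (snd z))) (f x, g x)) \<in> borel_measurable M"
    by (rule measurable_compose[where N=borel]) measurable
  then show ?thesis
    using h assms(4,5) by (simp cong: measurable_cong)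
qed

lemma lip01_bounded:
  assumes "lip01 L F"
  shows "\<exists>B\<ge>0. \<forall>b\<in>{0..1}. \<forall>u\<in>{0..1}. \<bar>F b u\<bar> \<le> B"
proof (intro exI[of _ "\<bar>F 0 0\<bar> + 2 * L"] conjI ballI)
  show "0 \<le> \<bar>F 0 0\<bar> + 2 * L" using assms by (simp add: lip01_def)
  fix b u :: real assume bu: "b \<in> {0..1}" "u \<in> {0..1}"
  have "\<bar>F b u - F 0 0\<bar> \<le> L * (\<bar>b - 0\<bar> + \<bar>u - 0\<bar>)" using bu by (intro lip01D[OF assms]) auto
  also have "\<dots> \<le> L * 2" using bu assms by (intro mult_left_mono) (auto simp: lip01_def)
  finally show "\<bar>F b u\<bar> \<le> \<bar>F 0 0\<bar> + 2 * L" by linarith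
qed

lemma convex_01: "0 \<le> x \<Longrightarrow> x \<le> 1 \<Longrightarrow> p \<in> {0..1} \<Longrightarrow> (1 - x) * p \<in> {0..1} \<and> (1 - x) * p + x \<in> {0..1::real}"
proof -
  assume x: "0 \<le> x" "x \<le> 1" and p: "p \<in> {0..1::real}"
  have "0 \<le> (1 - x) * p" "(1 - x) * p \<le> (1 - x) * 1"
    using x p mult_left_mono[of p 1 "1 - x"] by auto
  then show ?thesis using x by auto
qed

section \<open>Entropy inequalities and logarithmic bounds for a single event size\<close>

text \<open>The derivative of \<psi> is \<open>ln (1 + x / s)\<close>, which decreases in
  \<open>s\<close>, so this is the tangent inequality of a concave function. The gap between the two
  sides is \<open>t + x\<close> times the relative entropy of the weights proportional to
  \<open>(t, x)\<close> with respect to those proportional to \<open>(s, x)\<close>.\<close>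

lemma entropy_increment:
  fixes x s t :: real
  assumes "0 < x" "0 < s" "0 < t"
  defines "\<psi> \<equiv> \<lambda>s. (s + x) * ln (s + x) - s * ln s - x * ln x"
  shows "\<psi> t - \<psi> s \<le> (t - s) * ln (1 + x / s)"
proof -
  have key: "\<psi> t - \<psi> s - (t - s) * ln (1 + x / s) = (t + x) * ln ((t + x) / (s + x)) - t * ln (t / s)"
    using assms by (simp add: \<psi>_def ln_div add_pos_pos field_simps add_divide_distrib[symmetric])
  have "t * ln ((t/s) / ((t + x) / (s + x))) + x * ln (1 / ((t + x) / (s + x))) \<ge> 0"
  proof -
    have l: "ln y \<ge> 1 - 1 / y" if "0 < y" for y :: real
      using ln_le_minus_one[of "1/y"] that by (simp add: ln_div)
    \<comment> \<open>The bounds obtained from \<open>ln y \<ge> 1 - 1 / y\<close> add up to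
      \<open>(t + x) - q * (s + x)\<close>, which vanishes when \<open>q\<close> is the ratio of the
      totals.\<close>
    have "t * (1 - q / (t/s)) + x * (1 - q) = (t + x) - q * (s + x)" for q
      using assms(1-3) by (simp add: field_simps)
    from this[of "(t + x) / (s + x)"]
    have "t * (1 - ((t + x) / (s + x)) / (t/s)) + x * (1 - (t + x) / (s + x)) = 0"
      using assms(1-3) by simp
    moreover have "t * ln ((t/s) / ((t + x) / (s + x))) \<ge> t * (1 - ((t + x) / (s + x)) / (t/s))"
      using l[of "(t/s) / ((t + x) / (s + x))"] assms by (intro mult_left_mono) (auto simp: add_pos_pos mult_ac)
    moreover have "x * ln (1 / ((t + x) / (s + x))) \<ge> x * (1 - (t + x) / (s + x))"
      using l[of "1 / ((t + x) / (s + x))"] assms by (intro mult_left_mono) (auto simp: add_pos_pos)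
    ultimately show ?thesis by linarith
  qed
  also have "t * ln ((t/s) / ((t + x) / (s + x))) + x * ln (1 / ((t + x) / (s + x)))
     = - ((t + x) * ln ((t + x) / (s + x)) - t * ln (t / s))"
  proof -
    have "t * ln (p / q) + x * ln (1 / q) = - ((t + x) * ln q - t * ln p)" if "0 < p" "0 < q" for p q
      using that by (simp add: ln_div algebra_simps)
    from this[of "t / s" "(t + x) / (s + x)"] show ?thesis using assms(1-3) by (simp add: add_pos_pos)
  qed
  finally show ?thesis using key by linarith
qed

text \<open>Everything follows from the splitting into \<open>s * ln (1 + x / s)\<close>, which is
  at most \<open>x\<close>, and \<open>x * ln (1 + s / x)\<close>, which is at most
  \<open>x * ln (3 / x)\<close>. The second summand is the origin of the moment condition with
  \<open>x * ln (1 / x)\<close>.\<close>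

lemma entropy_bounds:
  fixes x s :: real
  assumes "0 < x" "x \<le> 1" "0 < s" "s \<le> 2"
  shows "0 \<le> (s + x) * ln (s + x) - s * ln s - x * ln x"
    and "(s + x) * ln (s + x) - s * ln s - x * ln x \<le> 3 * x + x * ln (1 / x)"
proof -
  have eq: "(s + x) * ln (s + x) - s * ln s - x * ln x = s * ln (1 + x / s) + x * ln (1 + s / x)"
    using assms by (simp add: ln_div add_pos_pos field_simps add_divide_distrib[symmetric])
  show "0 \<le> (s + x) * ln (s + x) - s * ln s - x * ln x"
    unfolding eq using assms by (intro add_nonneg_nonneg mult_nonneg_nonneg) auto
  have "s * ln (1 + x / s) \<le> s * (x / s)"
    using assms by (intro mult_left_mono ln_add_one_self_le_self) auto
  then have 1: "s * ln (1 + x / s) \<le> x" using assms by simp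
  have "1 + s / x = (x + s) / x" using assms by (simp add: field_simps)
  also have "\<dots> \<le> 3 / x" using assms by (intro divide_right_mono) auto
  finally have "1 + s / x \<le> 3 / x" .
  then have "ln (1 + s / x) \<le> ln (3 / x)" using assms by (intro ln_mono) (auto simp: add_pos_pos)
  also have "\<dots> = ln 3 + ln (1 / x)" using assms by (simp add: ln_div)
  also have "ln (3::real) \<le> 2" using ln_le_minus_one[of "3::real"] by simp
  finally have "x * ln (1 + s / x) \<le> x * (2 + ln (1 / x))" using assms by (intro mult_left_mono) auto
  then show "(s + x) * ln (s + x) - s * ln s - x * ln x \<le> 3 * x + x * ln (1 / x)"
    unfolding eq using 1 by (simp add: algebra_simps)
qed

text \<open>For \<open>x \<le> 1/2\<close> the logarithm is at most \<open>2 * x\<close>; for larger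
  \<open>x\<close>, where it is unbounded, the cutoff at 1 takes over. The bound is uniform in
  \<open>m\<close> and serves as a dominating function when \<open>m\<close> tends to
  infinity.\<close>

lemma min_ln_le:
  fixes x m :: real
  assumes "0 < x" "x < 1" "1 \<le> m"
  shows "min 1 (ln (1 / (1 - x)) / m) \<le> 2 * x" "0 \<le> min 1 (ln (1 / (1 - x)) / m)"
proof -
  show "0 \<le> min 1 (ln (1 / (1 - x)) / m)" using assms by (auto simp: ln_div intro!: divide_nonpos_pos)
  show "min 1 (ln (1 / (1 - x)) / m) \<le> 2 * x"
  proof (cases "x \<le> 1/2")
    case True
    have "ln (1 / (1 - x)) \<le> 1 / (1 - x) - 1" using assms by (intro ln_le_minus_one) auto
    also have "\<dots> = x / (1 - x)" using assms by (simp add: field_simps)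
    also have "\<dots> \<le> 2 * x" using True assms by (simp add: field_simps)
    finally have "ln (1 / (1 - x)) \<le> 2 * x" .
    moreover have "ln (1 / (1 - x)) / m \<le> ln (1 / (1 - x)) / 1"
      using assms by (intro divide_left_mono) (auto simp: ln_div)
    ultimately show ?thesis by linarith
  qed (use assms in auto)
qed

subsection \<open>A Lyapunov function for two masses\<close>

locale jump_measure =
  fixes \<nu> :: "real measure"
  assumes sets_nu: "sets \<nu> = sets borel01"
    and AE_nu: "AE x in \<nu>. 0 < x \<and> x < 1"
    and integrable_id: "integrable \<nu> (\<lambda>x. x)"
    and integrable_xln: "integrable \<nu> (\<lambda>x. x * ln (1 / x))"
begin

lemma borel_measurable_nu: "f \<in> borel_measurable borel \<Longrightarrow> f \<in> borel_measurable \<nu>"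
  using measurable_restrict_space1 sets_nu measurable_cong_sets by blast

text \<open>The total mass of \<nu> may be infinite because of small sizes, so integrability is
  obtained from a bound of order \<open>x\<close>.\<close>

lemma integrable_bound_id:
  assumes "f \<in> borel_measurable borel" "\<And>x. 0 < x \<Longrightarrow> x < 1 \<Longrightarrow> \<bar>f x\<bar> \<le> C * x"
  shows "integrable \<nu> f"
proof (rule Bochner_Integration.integrable_bound)
  show "integrable \<nu> (\<lambda>x. C * x)" using integrable_id by simp
  show "f \<in> borel_measurable \<nu>" using assms borel_measurable_nu by blast
  show "AE x in \<nu>. norm (f x) \<le> norm (C * x)"
    using AE_nu by eventually_elim (use assms in force)
qed

text \<open>The total cost, over all sizes, of a mass being multiplied by \<open>1 - x\<close>,
  measured by the logarithm divided by \<open>m\<close> and cut off at 1.\<close>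

definition beta :: "real \<Rightarrow> real" where
  "beta m = (\<integral>x. min 1 (ln (1 / (1 - x)) / m) \<partial>\<nu>)"

text \<open>The derivative of \<open>psi\<close>, and at the same time the contribution of the terms
  \<open>ln (1 + x / u)\<close> to the logarithmic drift per unit of mass in
  \<open>U\<close>.\<close>

definition kappa :: "real \<Rightarrow> real" where
  "kappa s = (\<integral>x. ln (1 + x / s) \<partial>\<nu>)"

text \<open>The integrand is the primitive in \<open>s\<close> of \<open>ln (1 + x / s)\<close> that
  vanishes at \<open>s = 0\<close>.\<close>

definition psi :: "real \<Rightarrow> real" where
  "psi s = (\<integral>x. ((s + x) * ln (s + x) - s * ln s - x * ln x) \<partial>\<nu>)"

lemma integrable_beta: "1 \<le> m \<Longrightarrow> integrable \<nu> (\<lambda>x. min 1 (ln (1 / (1 - x)) / m))"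
  by (rule integrable_bound_id[where C=2]) (measurable, metis abs_of_nonneg min_ln_le)

lemma integrable_kappa: assumes "0 < s" shows "integrable \<nu> (\<lambda>x. ln (1 + x / s))"
proof (rule integrable_bound_id)
  show "\<bar>ln (1 + x / s)\<bar> \<le> (1/s) * x" if "0 < x" "x < 1" for x
    using ln_add_one_self_le_self[of "x/s"] that assms by auto
qed measurable

lemma integrable_psi: assumes "0 < s" "s \<le> 2"
  shows "integrable \<nu> (\<lambda>x. (s + x) * ln (s + x) - s * ln s - x * ln x)"
proof (rule Bochner_Integration.integrable_bound)
  show "integrable \<nu> (\<lambda>x. 3 * x + x * ln (1 / x))"
    using integrable_id integrable_xln by simp
  show "(\<lambda>x. (s + x) * ln (s + x) - s * ln s - x * ln x) \<in> borel_measurable \<nu>"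
    by (rule borel_measurable_nu) measurable
  show "AE x in \<nu>. norm ((s + x) * ln (s + x) - s * ln s - x * ln x) \<le> norm (3 * x + x * ln (1 / x))"
    using AE_nu
  proof eventually_elim
    fix x :: real assume "0 < x \<and> x < 1"
    then show "norm ((s + x) * ln (s + x) - s * ln s - x * ln x) \<le> norm (3 * x + x * ln (1 / x))"
      using entropy_bounds[of x s] assms by auto
  qed
qed

lemma beta_nonneg: "1 \<le> m \<Longrightarrow> 0 \<le> beta m"
  unfolding beta_def by (intro integral_nonneg_AE eventually_mono[OF AE_nu]) (simp add: min_ln_le)

lemma beta_tendsto: "(\<lambda>m. beta (real (Suc m))) \<longlonglongrightarrow> 0"
proof -
  have "(\<lambda>m. beta (real (Suc m))) \<longlonglongrightarrow> (\<integral>x. 0 \<partial>\<nu>)"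
    unfolding beta_def
  proof (rule integral_dominated_convergence[where w="\<lambda>x. 2 * x"])
    show "integrable \<nu> (\<lambda>x. 2 * x)" using integrable_id by simp
    show "(\<lambda>x. min 1 (ln (1 / (1 - x)) / real (Suc m))) \<in> borel_measurable \<nu>" for m
      by (rule borel_measurable_nu) measurable
    show "AE x in \<nu>. norm (min 1 (ln (1 / (1 - x)) / real (Suc m))) \<le> 2 * x" for m
      using AE_nu by eventually_elim (use min_ln_le[of _ "real (Suc m)"] in auto)
    show "AE x in \<nu>. (\<lambda>m. min 1 (ln (1 / (1 - x)) / real (Suc m))) \<longlonglongrightarrow> 0"
    proof (rule AE_I2)
      fix x :: real
      have "(\<lambda>m. ln (1 / (1 - x)) / real (Suc m)) \<longlonglongrightarrow> 0"
        by (rule LIMSEQ_Suc[OF lim_const_over_n])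
      then have "(\<lambda>m. min 1 (ln (1 / (1 - x)) / real (Suc m))) \<longlonglongrightarrow> min 1 0"
        by (intro tendsto_min tendsto_const)
      then show "(\<lambda>m. min 1 (ln (1 / (1 - x)) / real (Suc m))) \<longlonglongrightarrow> 0" by simp
    qed
  qed simp_all
  then show ?thesis by simp
qed

lemma kappa_nonneg: "0 < s \<Longrightarrow> 0 \<le> kappa s"
  unfolding kappa_def by (intro integral_nonneg_AE eventually_mono[OF AE_nu]) simp

lemma psi_nonneg: "0 < s \<Longrightarrow> s \<le> 2 \<Longrightarrow> 0 \<le> psi s"
  unfolding psi_def
  by (intro integral_nonneg_AE eventually_mono[OF AE_nu]) (use entropy_bounds(1) in simp)

text \<open>The tangent inequality for each size is integrated: \<open>psi\<close> is concave with
  supergradient \<open>kappa\<close>.\<close>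

lemma psi_increment:
  assumes "0 < s" "s \<le> 2" "0 < t" "t \<le> 2"
  shows "psi t - psi s \<le> (t - s) * kappa s"
proof -
  have "psi t - psi s = (\<integral>x. ((t + x) * ln (t + x) - t * ln t - x * ln x) - ((s + x) * ln (s + x) - s * ln s - x * ln x) \<partial>\<nu>)"
    unfolding psi_def using integrable_psi assms by (subst Bochner_Integration.integral_diff) auto
  also have "\<dots> \<le> (\<integral>x. (t - s) * ln (1 + x / s) \<partial>\<nu>)"
  proof (rule integral_mono_AE)
    show "AE x in \<nu>. ((t + x) * ln (t + x) - t * ln t - x * ln x) - ((s + x) * ln (s + x) - s * ln s - x * ln x)
        \<le> (t - s) * ln (1 + x / s)"
      using AE_nu by eventually_elim (use entropy_increment assms in blast)
  qed (use assms in \<open>intro Bochner_Integration.integrable_diff integrable_mult_right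
         integrable_psi integrable_kappa; simp\<close>)+
  finally show ?thesis by (simp add: kappa_def)
qed

lemma psi_bounded: "\<exists>C\<ge>0. \<forall>s. 0 < s \<longrightarrow> s \<le> 2 \<longrightarrow> psi s \<le> C"
proof (intro exI[of _ "\<integral>x. 3 * x + x * ln (1 / x) \<partial>\<nu>"] conjI allI impI)
  show "0 \<le> (\<integral>x. 3 * x + x * ln (1 / x) \<partial>\<nu>)"
    by (intro integral_nonneg_AE eventually_mono[OF AE_nu] add_nonneg_nonneg mult_nonneg_nonneg) auto
  fix s :: real assume s: "0 < s" "s \<le> 2"
  show "psi s \<le> (\<integral>x. 3 * x + x * ln (1 / x) \<partial>\<nu>)"
    unfolding psi_def
  proof (rule integral_mono_AE)
    show "AE x in \<nu>. (s + x) * ln (s + x) - s * ln s - x * ln x \<le> 3 * x + x * ln (1 / x)"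
      using AE_nu by eventually_elim (use entropy_bounds(2) s in simp)
    show "integrable \<nu> (\<lambda>x. 3 * x + x * ln (1 / x))"
      using integrable_id integrable_xln by simp
  qed (use integrable_psi s in simp)
qed

text \<open>When \<nu> charges \<open>{x0..1}\<close>, the lower bound tends to infinity as
  \<open>s\<close> tends to 0, so the slope of \<open>psi\<close> at 0 is infinite.\<close>

lemma kappa_lower:
  assumes "0 < x0" "0 < s"
  shows "measure \<nu> {x0..1} * ln (1 + x0 / s) \<le> kappa s"
proof -
  have m: "{x0..1} \<in> sets \<nu>" using assms by (auto simp: sets_nu sets_restrict_space intro!: image_eqI[of _ _ "{x0..1}"])
  have i: "integrable \<nu> (indicat_real {x0..1})"
    using assms by (intro integrable_bound_id[where C="1/x0"]) (auto simp: field_simps indicator_def)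
  have "measure \<nu> {x0..1} * ln (1 + x0 / s) = (\<integral>x. indicator {x0..1} x * ln (1 + x0 / s) \<partial>\<nu>)"
    using m by simp
  also have "\<dots> \<le> kappa s"
    unfolding kappa_def
  proof (rule integral_mono_AE)
    show "AE x in \<nu>. indicator {x0..1} x * ln (1 + x0 / s) \<le> ln (1 + x / s)"
      using AE_nu
      by eventually_elim (use assms in \<open>auto simp: indicator_def intro!: ln_mono divide_right_mono add_pos_pos\<close>)
  qed (use i integrable_kappa assms in auto)
  finally show ?thesis .
qed

lemma kappa_mono:
  assumes "0 < s" "s \<le> t"
  shows "kappa t \<le> kappa s"
  unfolding kappa_def
proof (rule integral_mono_AE)
  show "AE x in \<nu>. ln (1 + x / t) \<le> ln (1 + x / s)"
    using AE_nu
    by eventually_elim (use assms in \<open>auto intro!: ln_mono divide_left_mono add_pos_pos\<close>)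
qed (use integrable_kappa assms in auto)

lemma psi_mono:
  assumes "0 < s" "s \<le> t" "t \<le> 2"
  shows "psi s \<le> psi t"
  using psi_increment[of t s] kappa_nonneg[of t] assms mult_nonneg_nonneg[of "t - s" "kappa t"]
  by (simp add: algebra_simps)

text \<open>On the right of \<epsilon> a concave function is no steeper than at \<epsilon>. At 0 the
  slope is infinite as soon as \<nu> is not zero, hence the shift by \<epsilon> in the Lyapunov
  function.\<close>

lemma psi_lipschitz:
  assumes "0 < \<epsilon>" "\<epsilon> \<le> s" "s \<le> 2" "\<epsilon> \<le> t" "t \<le> 2"
  shows "\<bar>psi s - psi t\<bar> \<le> kappa \<epsilon> * \<bar>s - t\<bar>"
proof -
  have *: "\<bar>psi s - psi t\<bar> \<le> kappa \<epsilon> * \<bar>s - t\<bar>" if "\<epsilon> \<le> s" "s \<le> t" "t \<le> 2" for s t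
  proof -
    have "psi t - psi s \<le> (t - s) * kappa s" using that assms(1) by (intro psi_increment) auto
    also have "\<dots> \<le> (t - s) * kappa \<epsilon>" using that assms(1) by (intro mult_left_mono kappa_mono) auto
    finally show ?thesis using psi_mono[of s t] that assms(1) by (simp add: algebra_simps)
  qed
  show ?thesis using *[of s t] *[of t s] assms by (cases "s \<le> t") (auto simp: abs_minus_commute)
qed

lemma sets_tail: "0 \<le> a \<Longrightarrow> {a..1} \<in> sets \<nu>"
  unfolding sets_nu by (subst sets_restrict_space_iff) auto

lemma measure_tail_pos:
  assumes "emeasure \<nu> (space \<nu>) \<noteq> 0"
  obtains x0 where "0 < x0" "x0 \<le> 1" "0 < measure \<nu> {x0..1}"
proof -
  have m: "{1 / real (Suc n)..1} \<in> sets \<nu>" for n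
    by (rule sets_tail) simp
  \<comment> \<open>\<open>measure\<close> is 0 also on sets of infinite mass, so finiteness of the
    tails is needed before a vanishing \<open>measure\<close> means a null set.\<close>
  have fin: "emeasure \<nu> {1 / real (Suc n)..1} < \<infinity>" for n
  proof -
    have "integrable \<nu> (indicat_real {1 / real (Suc n)..1})"
      by (intro integrable_bound_id[where C="real (Suc n)"]) (auto simp: field_simps indicator_def)
    then show ?thesis using m[of n] by (simp add: integrable_indicator_iff)
  qed
  have "\<exists>n. measure \<nu> {1 / real (Suc n)..1} \<noteq> 0"
  proof (rule ccontr)
    assume "\<not> ?thesis"
    then have "emeasure \<nu> {1 / real (Suc n)..1} = 0" for n
      using fin[of n] by (metis emeasure_eq_ennreal_measure ennreal_0 infinity_ennreal_def less_irrefl)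
    then have "AE x in \<nu>. x \<notin> {1 / real (Suc n)..1}" for n
      using m[of n] by (intro AE_not_in) (auto simp: null_sets_def)
    then have "AE x in \<nu>. \<forall>n. x \<notin> {1 / real (Suc n)..1}"
      unfolding AE_all_countable by blast
    then have "AE x in \<nu>. False"
      using AE_nu
    proof eventually_elim
      fix x :: real assume x: "\<forall>n. x \<notin> {1 / real (Suc n)..1}" "0 < x \<and> x < 1"
      obtain n where "inverse (real (Suc n)) < x" using x reals_Archimedean by blast
      then show False using x(1)[rule_format, of n] x(2) by (auto simp: inverse_eq_divide)
    qed
    then show False using assms by (simp add: eventually_False ae_filter_eq_bot_iff)
  qed
  then obtain n where "measure \<nu> {1 / real (Suc n)..1} \<noteq> 0" by blast
  then show ?thesis
    by (intro that[of "1 / real (Suc n)"]) (simp_all add: zero_less_measure_iff)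
qed

text \<open>\<open>g\<close> is a supergradient of \<open>u \<mapsto> u + psi (u + \<epsilon>)\<close>; it blows up as \<open>u, \<epsilon> \<rightarrow> 0\<close>, so jumps out
  of \<open>u\<close> of size at least \<open>x0\<close> gain less than the linear part that the other jumps lose.\<close>

lemma concavity_gap:
  assumes nz: "emeasure \<nu> (space \<nu>) \<noteq> 0"
  obtains C u0 x0 where "0 \<le> C" "0 < u0" "u0 \<le> 1/2" "0 < x0"
    "\<And>\<epsilon> u. 0 < \<epsilon> \<Longrightarrow> \<epsilon> \<le> u0 \<Longrightarrow> 0 \<le> u \<Longrightarrow> u \<le> u0 \<Longrightarrow>
      \<exists>d. u * (1 + kappa (u + \<epsilon>)) = d * measure \<nu> {x0..1} \<and>
        (\<forall>x\<in>{0<..<1}.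
          (1 - u) * (C * ((1 - x) * u + psi ((1 - x) * u + \<epsilon>)) - C * (u + psi (u + \<epsilon>)))
          + u * (C * ((1 - x) * u + x + psi ((1 - x) * u + x + \<epsilon>)) - C * (u + psi (u + \<epsilon>)))
          \<le> - d * indicator {x0..1} x)"
proof -
  obtain x0 where x0: "0 < x0" "x0 \<le> 1" and pos: "0 < measure \<nu> {x0..1}"
    using measure_tail_pos[OF nz] by metis
  obtain P where P: "0 \<le> P" "\<And>s. 0 < s \<Longrightarrow> s \<le> 2 \<Longrightarrow> psi s \<le> P" using psi_bounded by blast
  \<comment> \<open>\<open>R\<close> is chosen so that
    \<open>v * R \<le> kappa (u + \<epsilon>)\<close> gives \<open>4 * (1 + P) \<le> x0 * g\<close>,
    and \<open>u0\<close> so that \<open>u + \<epsilon> \<le> x0 / exp R\<close>, which makes that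
    bound available. \<open>C\<close> normalises the resulting loss \<open>u * g * x0 / 4\<close> to
    \<open>u * g / v\<close>, whose integral over the tail is \<open>u * g\<close>.\<close>
  define v where "v = measure \<nu> {x0..1}"
  define C where "C = 4 / (x0 * v)"
  define R where "R = 4 * (1 + P) / (x0 * v)"
  define u0 where "u0 = min (1/2) (x0 / exp R / 2)"
  have v: "0 < v" using pos by (simp add: v_def)
  have u0: "0 < u0" "u0 \<le> 1/2" using x0 by (auto simp: u0_def)
  have C: "0 < C" using x0 v by (simp add: C_def)
  show thesis
  proof (rule that[of C u0 x0])
    fix \<epsilon> u :: real assume e: "0 < \<epsilon>" "\<epsilon> \<le> u0" and u: "0 \<le> u" "u \<le> u0"
    define g where "g = 1 + kappa (u + \<epsilon>)"
    have s: "0 < u + \<epsilon>" "u + \<epsilon> \<le> 1" using e u u0 by auto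
    have "exp R \<le> x0 / (u + \<epsilon>)"
    proof -
      have "u0 \<le> x0 / exp R / 2" by (simp add: u0_def)
      then have "u + \<epsilon> \<le> x0 / exp R" using e u by simp
      then show ?thesis using s by (simp add: field_simps)
    qed
    then have "exp R \<le> 1 + x0 / (u + \<epsilon>)" by simp
    then have "R \<le> ln (1 + x0 / (u + \<epsilon>))"
      using x0 s by (subst ln_ge_iff) (auto simp: add_pos_pos)
    then have "v * R \<le> v * ln (1 + x0 / (u + \<epsilon>))" using v by simp
    also have "\<dots> \<le> kappa (u + \<epsilon>)" using kappa_lower[OF x0(1) s(1)] by (simp add: v_def)
    finally have "x0 * (v * R) \<le> x0 * kappa (u + \<epsilon>)" using x0 by simp
    moreover have "x0 * (v * R) = 4 * (1 + P)" using x0 v by (simp add: R_def)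
    moreover have "x0 * g = x0 + x0 * kappa (u + \<epsilon>)" by (simp add: g_def distrib_left)
    ultimately have g: "4 * (1 + P) \<le> x0 * g" using x0(1) by linarith
    have g0: "0 \<le> g" using kappa_nonneg[OF s(1)] by (simp add: g_def)
    \<comment> \<open>Two bounds on the same increment: the tangent line, used for downward moves
      and for small upward ones, and boundedness of \<open>psi\<close>, which is better for large
      upward moves since \<open>g\<close> is huge.\<close>
    have inc: "(y + psi (y + \<epsilon>)) - (u + psi (u + \<epsilon>)) \<le> (y - u) * g" if "0 \<le> y" "y \<le> 1" for y
      using psi_increment[of "u + \<epsilon>" "y + \<epsilon>"] that e s u0 by (simp add: g_def algebra_simps)
    have bd: "(y + psi (y + \<epsilon>)) - (u + psi (u + \<epsilon>)) \<le> 1 + P" if "0 \<le> y" "y \<le> 1" for y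
      using P(2)[of "y + \<epsilon>"] psi_nonneg[of "u + \<epsilon>"] that e s u0 u by simp
    show "\<exists>d. u * (1 + kappa (u + \<epsilon>)) = d * measure \<nu> {x0..1} \<and>
        (\<forall>x\<in>{0<..<1}.
          (1 - u) * (C * ((1 - x) * u + psi ((1 - x) * u + \<epsilon>)) - C * (u + psi (u + \<epsilon>)))
          + u * (C * ((1 - x) * u + x + psi ((1 - x) * u + x + \<epsilon>)) - C * (u + psi (u + \<epsilon>)))
          \<le> - d * indicator {x0..1} x)"
    proof (intro exI[of _ "u * g / v"] conjI ballI)
      show "u * (1 + kappa (u + \<epsilon>)) = u * g / v * measure \<nu> {x0..1}"
        using v by (simp add: g_def v_def)
      fix x :: real assume x: "x \<in> {0<..<1}"
      define A where "A = ((1 - x) * u + psi ((1 - x) * u + \<epsilon>)) - (u + psi (u + \<epsilon>))"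
      define B where "B = ((1 - x) * u + x + psi ((1 - x) * u + x + \<epsilon>)) - (u + psi (u + \<epsilon>))"
      have r: "0 \<le> (1 - x) * u" "(1 - x) * u \<le> 1" "0 \<le> (1 - x) * u + x" "(1 - x) * u + x \<le> 1"
        using convex_01[of x u] x u u0 by auto
      have A: "A \<le> - x * u * g" using inc[OF r(1,2)] by (simp add: A_def algebra_simps)
      have B1: "B \<le> x * (1 - u) * g" using inc[OF r(3,4)] by (simp add: B_def algebra_simps)
      have B2: "B \<le> 1 + P" using bd[OF r(3,4)] by (simp add: B_def)
      have A': "(1 - u) * A \<le> (1 - u) * (- x * u * g)" using A u u0 by (intro mult_left_mono) auto
      \<comment> \<open>For \<open>x \<ge> x0\<close> the downward part loses at least
        \<open>u * g * x0 / 2\<close>, and the upward part regains at most half of it. For smaller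
        \<open>x\<close> the two tangent bounds cancel because \<open>u\<close> is a
        martingale.\<close>
      have "(1 - u) * A + u * B \<le> - (u * g * x0 / 4) * indicator {x0..1} x"
      proof (cases "x0 \<le> x")
        case True
        have "u * B \<le> u * (x0 * g / 4)" using B2 g u by (intro mult_left_mono) auto
        moreover have "(1 - u) * (- x * u * g) \<le> - (u * g * x0 / 2)"
        proof -
          have "(1/2) * x0 \<le> (1 - u) * x" using True x0 u u0 by (intro mult_mono) auto
          then have "(u * g) * ((1/2) * x0) \<le> (u * g) * ((1 - u) * x)"
            using u g0 by (intro mult_left_mono) auto
          then show ?thesis by (simp add: algebra_simps)
        qed
        ultimately show ?thesis using A' True x by (simp add: indicator_def algebra_simps)
      next
        case False
        have "u * B \<le> u * (x * (1 - u) * g)" using B1 u by (intro mult_left_mono) auto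
        then show ?thesis using A' False by (simp add: indicator_def algebra_simps)
      qed
      then have "C * ((1 - u) * A + u * B) \<le> C * (- (u * g * x0 / 4) * indicator {x0..1} x)"
        using C by (intro mult_left_mono) auto
      also have "\<dots> = - (u * g / v) * indicator {x0..1} x" using x0 v by (simp add: C_def field_simps)
      finally have *: "C * ((1 - u) * A + u * B) \<le> - (u * g / v) * indicator {x0..1} x" .
      show "(1 - u) * (C * ((1 - x) * u + psi ((1 - x) * u + \<epsilon>)) - C * (u + psi (u + \<epsilon>)))
          + u * (C * ((1 - x) * u + x + psi ((1 - x) * u + x + \<epsilon>)) - C * (u + psi (u + \<epsilon>)))
          \<le> - (u * g / v) * indicator {x0..1} x"
      proof -
        have "(1 - u) * (C * p - C * r) + u * (C * q - C * r) = C * ((1 - u) * (p - r) + u * (q - r))" for p q r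
          by (simp add: algebra_simps)
        then show ?thesis using * unfolding A_def B_def by simp
      qed
    qed
  qed (use C u0 x0 in auto)
qed

end

section \<open>Logarithmic ratios and the drift of the Lyapunov function\<close>

lemma ln_lipschitz:
  fixes s t \<epsilon> :: real
  assumes "0 < \<epsilon>" "\<epsilon> \<le> s" "\<epsilon> \<le> t"
  shows "\<bar>ln s - ln t\<bar> \<le> \<bar>s - t\<bar> / \<epsilon>"
proof -
  have *: "ln s - ln t \<le> \<bar>s - t\<bar> / \<epsilon>" if "\<epsilon> \<le> s" "\<epsilon> \<le> t" for s t
  proof -
    have "ln s - ln t \<le> (s - t) / t" using that assms(1) by (intro ln_diff_le) auto
    also have "\<dots> \<le> \<bar>s - t\<bar> / t" using that assms(1) by (intro divide_right_mono) auto
    also have "\<dots> \<le> \<bar>s - t\<bar> / \<epsilon>" using that assms(1) by (intro divide_left_mono) auto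
    finally show ?thesis .
  qed
  show ?thesis using *[of s t] *[of t s] assms by (simp add: abs_minus_commute)
qed

text \<open>One inequality for each position of the parent. In the first two, both masses are
  multiplied by \<open>1 - x\<close> or both also gain \<open>x\<close>, and either change moves the
  shifted ratio towards 1. Only a parent in \<open>U - J\<close> can raise it: the numerator gains
  at most the factor \<open>1 + x / (u + \<epsilon>)\<close>, and the denominator keeps at least the
  factor \<open>1 - x\<close>.\<close>

lemma ln_ratio_jump:
  fixes b u x \<epsilon> :: real
  assumes "0 \<le> b" "b \<le> u" "0 < x" "x < 1" "0 < \<epsilon>"
  shows "ln (((1 - x) * u + \<epsilon>) / ((1 - x) * b + \<epsilon>)) \<le> ln ((u + \<epsilon>) / (b + \<epsilon>))" (is ?A)
    and "ln (((1 - x) * u + x + \<epsilon>) / ((1 - x) * b + x + \<epsilon>)) \<le> ln ((u + \<epsilon>) / (b + \<epsilon>))" (is ?B)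
    and "ln (((1 - x) * u + x + \<epsilon>) / ((1 - x) * b + \<epsilon>))
       \<le> ln ((u + \<epsilon>) / (b + \<epsilon>)) + ln (1 / (1 - x)) + ln (1 + x / (u + \<epsilon>))" (is ?C)
proof -
  have p: "0 \<le> (1 - x) * b" "0 \<le> (1 - x) * u" "0 \<le> u" "0 \<le> x * (u - b)" "0 \<le> \<epsilon> * (x * (u - b))"
    using assms by auto
  have "((1 - x) * u + \<epsilon>) * (b + \<epsilon>) \<le> (u + \<epsilon>) * ((1 - x) * b + \<epsilon>)"
    using p(5) by (simp add: algebra_simps)
  then have "((1 - x) * u + \<epsilon>) / ((1 - x) * b + \<epsilon>) \<le> (u + \<epsilon>) / (b + \<epsilon>)"
    using assms p by (simp add: divide_le_eq le_divide_eq add_nonneg_pos mult.commute)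
  then show ?A using assms p by (intro ln_mono) (auto intro!: divide_pos_pos add_nonneg_pos)
  have "((1 - x) * u + x + \<epsilon>) * (b + \<epsilon>) \<le> (u + \<epsilon>) * ((1 - x) * b + x + \<epsilon>)"
    using p(4,5) by (simp add: algebra_simps)
  moreover have "0 < (1 - x) * b + x + \<epsilon>" "0 < b + \<epsilon>" "0 < (1 - x) * u + x + \<epsilon>" using p assms by linarith+
  ultimately have "((1 - x) * u + x + \<epsilon>) / ((1 - x) * b + x + \<epsilon>) \<le> (u + \<epsilon>) / (b + \<epsilon>)"
    by (simp add: divide_le_eq le_divide_eq mult.commute)
  then show ?B using \<open>0 < (1 - x) * b + x + \<epsilon>\<close> \<open>0 < (1 - x) * u + x + \<epsilon>\<close>
    by (intro ln_mono) auto
  have 1: "ln ((1 - x) * u + x + \<epsilon>) \<le> ln ((u + \<epsilon>) * (1 + x / (u + \<epsilon>)))"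
  proof (rule ln_mono)
    have "(u + \<epsilon>) * (1 + x / (u + \<epsilon>)) = u + \<epsilon> + x" using assms p by (simp add: field_simps add_nonneg_eq_0_iff)
    moreover have "0 \<le> x * u" using p assms by simp
    ultimately show "(1 - x) * u + x + \<epsilon> \<le> (u + \<epsilon>) * (1 + x / (u + \<epsilon>))" by (simp add: algebra_simps)
  qed (use \<open>0 < (1 - x) * u + x + \<epsilon>\<close> in auto)
  have 2: "ln ((1 - x) * (b + \<epsilon>)) \<le> ln ((1 - x) * b + \<epsilon>)"
  proof (rule ln_mono)
    show "(1 - x) * (b + \<epsilon>) \<le> (1 - x) * b + \<epsilon>" using assms by (simp add: algebra_simps)
    show "0 < (1 - x) * (b + \<epsilon>)" using assms by (intro mult_pos_pos) auto
  qed
  have 3: "0 < u + \<epsilon>" "0 < b + \<epsilon>" "0 < 1 - x" "0 < 1 + x / (u + \<epsilon>)" "0 < (1 - x) * b + \<epsilon>"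
    using assms p by (auto intro!: add_pos_nonneg add_nonneg_pos)
  have "ln (((1 - x) * u + x + \<epsilon>) / ((1 - x) * b + \<epsilon>)) = ln ((1 - x) * u + x + \<epsilon>) - ln ((1 - x) * b + \<epsilon>)"
    using 3 \<open>0 < (1 - x) * u + x + \<epsilon>\<close> by (simp add: ln_div)
  also have "\<dots> \<le> (ln (u + \<epsilon>) + ln (1 + x / (u + \<epsilon>))) - (ln (1 - x) + ln (b + \<epsilon>))"
    using 1 2 3 by (simp add: ln_mult)
  also have "\<dots> = ln ((u + \<epsilon>) / (b + \<epsilon>)) + ln (1 / (1 - x)) + ln (1 + x / (u + \<epsilon>))"
    using 3 by (simp add: ln_div)
  finally show ?C .
qed

context jump_measure begin

lemma space_nu: "space \<nu> = {0..1}"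
  using sets_eq_imp_space_eq[OF sets_nu] by (simp add: space_restrict_space)

text \<open>An event of size \<open>x\<close> moves each of the two masses by at most
  \<open>x\<close>, so the expected change of \<open>F\<close> is at most
  \<open>2 * L * x\<close>.\<close>

lemma integrable_gen:
  assumes F: "lip01 L F" and bu: "0 \<le> b" "b \<le> u" "u \<le> 1"
  shows "integrable \<nu> (\<lambda>x. two_type_mean F b u x - F b u)"
proof (rule Bochner_Integration.integrable_bound)
  show "integrable \<nu> (\<lambda>x. 2 * L * x)" using integrable_id by simp
  have L: "0 \<le> L" using F by (simp add: lip01_def)
  have r: "(1 - x) * b \<in> {0..1}" "(1 - x) * b + x \<in> {0..1}" "(1 - x) * u \<in> {0..1}" "(1 - x) * u + x \<in> {0..1}"
    if "0 \<le> x" "x \<le> 1" for x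
    using convex_01[OF that] bu by auto
  have meas: "(\<lambda>x. f x) \<in> borel_measurable \<nu>" if "f \<in> borel_measurable borel" for f :: "real \<Rightarrow> real"
    using that by (rule borel_measurable_nu)
  have [measurable]: "(\<lambda>x. F ((1 - x) * b) ((1 - x) * u)) \<in> borel_measurable \<nu>"
    "(\<lambda>x. F ((1 - x) * b + x) ((1 - x) * u + x)) \<in> borel_measurable \<nu>"
    "(\<lambda>x. F ((1 - x) * b) ((1 - x) * u + x)) \<in> borel_measurable \<nu>"
    by (rule lip01_measurable[OF F]; (rule meas, measurable)?; use r space_nu in auto)+
  show "(\<lambda>x. two_type_mean F b u x - F b u) \<in> borel_measurable \<nu>"
    unfolding two_type_mean_def by measurable
  show "AE x in \<nu>. norm (two_type_mean F b u x - F b u) \<le> norm (2 * L * x)"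
    using AE_nu
  proof eventually_elim
    fix x :: real assume x: "0 < x \<and> x < 1"
    have d: "\<bar>(1 - x) * p - p\<bar> \<le> x" "\<bar>(1 - x) * p + x - p\<bar> \<le> x" if "0 \<le> p" "p \<le> 1" for p
    proof -
      have "0 \<le> x * p" "x * p \<le> x * 1" using that x by (auto intro: mult_left_mono)
      then show "\<bar>(1 - x) * p - p\<bar> \<le> x" "\<bar>(1 - x) * p + x - p\<bar> \<le> x" by (auto simp: algebra_simps abs_le_iff)
    qed
    have D: "\<bar>F p q - F b u\<bar> \<le> 2 * L * x"
      if "p \<in> {0..1}" "q \<in> {0..1}" "\<bar>p - b\<bar> \<le> x" "\<bar>q - u\<bar> \<le> x" for p q
    proof -
      have "\<bar>F p q - F b u\<bar> \<le> L * (\<bar>p - b\<bar> + \<bar>q - u\<bar>)" using that bu by (intro lip01D[OF F]) auto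
      also have "\<dots> \<le> L * (2 * x)" using that L by (intro mult_left_mono) auto
      finally show ?thesis by simp
    qed
    define A where "A = F ((1 - x) * b) ((1 - x) * u) - F b u"
    define B where "B = F ((1 - x) * b + x) ((1 - x) * u + x) - F b u"
    define D' where "D' = F ((1 - x) * b) ((1 - x) * u + x) - F b u"
    have "\<bar>A\<bar> \<le> 2 * L * x" "\<bar>B\<bar> \<le> 2 * L * x" "\<bar>D'\<bar> \<le> 2 * L * x"
      unfolding A_def B_def D'_def using r[of x] x d[of b] d[of u] bu by (auto intro!: D)
    then have "\<bar>(1 - u) * A\<bar> \<le> (1 - u) * (2 * L * x)" "\<bar>b * B\<bar> \<le> b * (2 * L * x)" "\<bar>(u - b) * D'\<bar> \<le> (u - b) * (2 * L * x)"
      using bu by (auto simp: abs_mult intro!: mult_left_mono)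
    then have "\<bar>(1 - u) * A + b * B + (u - b) * D'\<bar> \<le> (1 - u) * (2 * L * x) + b * (2 * L * x) + (u - b) * (2 * L * x)"
      by linarith
    also have "\<dots> = 2 * L * x" by (simp add: algebra_simps)
    finally have "\<bar>(1 - u) * A + b * B + (u - b) * D'\<bar> \<le> 2 * L * x" .
    then show "norm (two_type_mean F b u x - F b u) \<le> norm (2 * L * x)"
      unfolding A_def B_def D'_def two_type_mean_def using x L by (simp add: algebra_simps)
  qed
qed

definition Lyap :: "real \<Rightarrow> real \<Rightarrow> real \<Rightarrow> real \<Rightarrow> real \<Rightarrow> real \<Rightarrow> real" where
  "Lyap C u0 m \<epsilon> b u =
     min 1 (ln ((u + \<epsilon>) / (b + \<epsilon>)) / m + (beta m + 1 / m) * (C * (u + psi (u + \<epsilon>))) + u / u0)"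

lemma lip01_Lyap:
  assumes C: "0 \<le> C" and u0: "0 < u0" and m: "1 \<le> m" and \<epsilon>: "0 < \<epsilon>" "\<epsilon> \<le> 1"
  shows "\<exists>L. lip01 L (Lyap C u0 m \<epsilon>)"
proof -
  define c where "c = (beta m + 1 / m) * C"
  have c: "0 \<le> c" using beta_nonneg[OF m] C m by (simp add: c_def)
  define L where "L = 1 / \<epsilon> + c * (1 + kappa \<epsilon>) + 1 / u0"
  have k: "0 \<le> kappa \<epsilon>" using kappa_nonneg \<epsilon> by simp
  have "\<bar>Lyap C u0 m \<epsilon> b u - Lyap C u0 m \<epsilon> b' u'\<bar> \<le> L * (\<bar>b - b'\<bar> + \<bar>u - u'\<bar>)"
    if r: "b \<in> {0..1}" "u \<in> {0..1}" "b' \<in> {0..1}" "u' \<in> {0..1}" for b u b' u'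
  proof -
    define l where "l = (\<lambda>b u. ln ((u + \<epsilon>) / (b + \<epsilon>)) / m)"
    define P where "P = (\<lambda>u. u + psi (u + \<epsilon>))"
    have l: "\<bar>l b u - l b' u'\<bar> \<le> 1 / \<epsilon> * (\<bar>b - b'\<bar> + \<bar>u - u'\<bar>)"
    proof -
      have "l b u - l b' u' = ((ln (u + \<epsilon>) - ln (u' + \<epsilon>)) - (ln (b + \<epsilon>) - ln (b' + \<epsilon>))) / m"
        using r \<epsilon> m unfolding l_def by (subst (1 2) ln_div) (auto simp: diff_divide_distrib)
      then have "\<bar>l b u - l b' u'\<bar> = \<bar>(ln (u + \<epsilon>) - ln (u' + \<epsilon>)) - (ln (b + \<epsilon>) - ln (b' + \<epsilon>))\<bar> / m"
        using m by simp
      also have "\<dots> \<le> \<bar>(ln (u + \<epsilon>) - ln (u' + \<epsilon>)) - (ln (b + \<epsilon>) - ln (b' + \<epsilon>))\<bar> / 1"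
        using m by (intro divide_left_mono) auto
      also have "\<dots> \<le> \<bar>u - u'\<bar> / \<epsilon> + \<bar>b - b'\<bar> / \<epsilon>"
        using ln_lipschitz[of \<epsilon> "u + \<epsilon>" "u' + \<epsilon>"] ln_lipschitz[of \<epsilon> "b + \<epsilon>" "b' + \<epsilon>"] r \<epsilon> by simp
      finally show ?thesis by (simp add: algebra_simps add_divide_distrib)
    qed
    have P: "\<bar>P u - P u'\<bar> \<le> (1 + kappa \<epsilon>) * \<bar>u - u'\<bar>"
      using psi_lipschitz[of \<epsilon> "u + \<epsilon>" "u' + \<epsilon>"] r \<epsilon> by (simp add: P_def algebra_simps)
    have "\<bar>Lyap C u0 m \<epsilon> b u - Lyap C u0 m \<epsilon> b' u'\<bar>
       \<le> \<bar>(l b u + c * P u + u / u0) - (l b' u' + c * P u' + u' / u0)\<bar>"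
      unfolding Lyap_def l_def P_def c_def mult.assoc by linarith
    also have "\<dots> = \<bar>(l b u - l b' u') + c * (P u - P u') + (u - u') / u0\<bar>"
      by (simp add: algebra_simps diff_divide_distrib)
    also have "\<dots> \<le> \<bar>l b u - l b' u'\<bar> + c * \<bar>P u - P u'\<bar> + \<bar>u - u'\<bar> / u0"
      using c u0 abs_mult[of c "P u - P u'"] abs_divide[of "u - u'" u0] by linarith
    also have "\<dots> \<le> 1 / \<epsilon> * (\<bar>b - b'\<bar> + \<bar>u - u'\<bar>) + c * ((1 + kappa \<epsilon>) * \<bar>u - u'\<bar>) + \<bar>u - u'\<bar> / u0"
      using l P c by (intro add_mono mult_left_mono) auto
    also have "\<dots> \<le> 1 / \<epsilon> * (\<bar>b - b'\<bar> + \<bar>u - u'\<bar>) + c * (1 + kappa \<epsilon>) * (\<bar>b - b'\<bar> + \<bar>u - u'\<bar>) + 1 / u0 * (\<bar>b - b'\<bar> + \<bar>u - u'\<bar>)"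
    proof -
      have "c * ((1 + kappa \<epsilon>) * \<bar>u - u'\<bar>) \<le> c * ((1 + kappa \<epsilon>) * (\<bar>b - b'\<bar> + \<bar>u - u'\<bar>))"
        using c k by (intro mult_left_mono) auto
      moreover have "\<bar>u - u'\<bar> / u0 \<le> (\<bar>b - b'\<bar> + \<bar>u - u'\<bar>) / u0" using u0 by (intro divide_right_mono) auto
      ultimately show ?thesis by simp
    qed
    finally show ?thesis by (simp add: L_def algebra_simps)
  qed
  moreover have "0 \<le> L" using c k u0 \<epsilon> by (simp add: L_def)
  ultimately show ?thesis unfolding lip01_def by blast
qed

text \<open>\<open>B\<close> may change sign, since only its integral counts. This lets the loss at
  sizes of at least \<open>x0\<close> pay for the logarithmic gain at all sizes.\<close>

lemma two_type_gen_le: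
  assumes F: "lip01 L F" and bu: "0 \<le> b" "b \<le> u" "u \<le> 1"
    and B: "integrable \<nu> B" "(\<integral>x. B x \<partial>\<nu>) \<le> \<delta>"
    and le: "\<And>x. 0 < x \<Longrightarrow> x < 1 \<Longrightarrow> two_type_mean F b u x \<le> F b u + B x"
  shows "two_type_gen \<nu> F b u \<le> \<delta>"
proof -
  have "two_type_gen \<nu> F b u \<le> (\<integral>x. B x \<partial>\<nu>)"
    unfolding two_type_gen_def
  proof (rule integral_mono_AE[OF integrable_gen[OF F bu] B(1)])
    show "AE x in \<nu>. two_type_mean F b u x - F b u \<le> B x"
      using AE_nu by eventually_elim (use le in \<open>simp add: algebra_simps\<close>)
  qed
  then show ?thesis using B(2) by simp
qed

text \<open>Where the cutoff is active the function has its maximal value and no event can raise it.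
  Elsewhere the terms are nonnegative with sum below 1, so \<open>u \<le> u0\<close>, which is the
  range in which \<open>gap\<close> applies.\<close>

lemma two_type_gen_Lyap_aux:
  assumes C: "0 \<le> C" and u0: "0 < u0" "u0 \<le> 1" and m: "1 \<le> m" and \<epsilon>: "0 < \<epsilon>" "\<epsilon> \<le> u0" and x0: "0 < x0"
    and bu: "0 \<le> b" "b \<le> u" "u \<le> 1"
    and gap: "0 \<le> u \<Longrightarrow> u \<le> u0 \<Longrightarrow>
      \<exists>d. u * (1 + kappa (u + \<epsilon>)) = d * measure \<nu> {x0..1} \<and>
        (\<forall>x\<in>{0<..<1}.
          (1 - u) * (C * ((1 - x) * u + psi ((1 - x) * u + \<epsilon>)) - C * (u + psi (u + \<epsilon>)))
          + u * (C * ((1 - x) * u + x + psi ((1 - x) * u + x + \<epsilon>)) - C * (u + psi (u + \<epsilon>)))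
          \<le> - d * indicator {x0..1} x)"
  shows "two_type_gen \<nu> (Lyap C u0 m \<epsilon>) b u \<le> 0"
proof -
  define F where "F = Lyap C u0 m \<epsilon>"
  obtain L where L: "lip01 L F" using lip01_Lyap[of C u0 m \<epsilon>] assms unfolding F_def by auto
  define c where "c = beta m + 1 / m"
  have c: "0 \<le> c" using beta_nonneg[OF m] m by (simp add: c_def)
  define l where "l = (\<lambda>b u. ln ((u + \<epsilon>) / (b + \<epsilon>)) / m)"
  define G where "G = (\<lambda>u. C * (u + psi (u + \<epsilon>)))"
  have F: "F b u = min 1 (l b u + c * G u + u / u0)" for b u
    by (simp add: F_def Lyap_def c_def G_def l_def)
  have l0: "0 \<le> l b u" if "0 \<le> b" "b \<le> u" for b u
    using that \<epsilon> m by (auto simp: l_def field_simps intro!: divide_nonneg_nonneg ln_ge_zero)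
  have G0: "0 \<le> G u" if "0 \<le> u" "u \<le> 1" for u
    using that \<epsilon> u0 C psi_nonneg[of "u + \<epsilon>"] by (simp add: G_def)
  consider "1 \<le> l b u + c * G u + u / u0" | "l b u + c * G u + u / u0 < 1" by linarith
  then have "two_type_gen \<nu> F b u \<le> 0"
  proof cases
    case 1
    show ?thesis
    proof (rule two_type_gen_le[OF L bu, where B="\<lambda>_. 0"])
      fix x :: real assume "0 < x" "x < 1"
      have F1: "F p q \<le> 1" for p q by (simp add: F)
      have "two_type_mean F b u x \<le> (1 - u) * 1 + b * 1 + (u - b) * 1"
        unfolding two_type_mean_def by (intro add_mono; rule mult_left_mono; use bu F1 in simp)
      moreover have "F b u = 1" using 1 by (simp add: F)
      ultimately show "two_type_mean F b u x \<le> F b u + 0" by simp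
    qed simp_all
  next
    case 2
    have "u / u0 \<le> 1" using 2 l0[OF bu(1,2)] c G0[of u] bu mult_nonneg_nonneg[of c "G u"] by linarith
    then have uu: "0 \<le> u" "u \<le> u0" using bu u0 by (auto simp: field_simps)
    from gap[OF uu] obtain d where d: "u * (1 + kappa (u + \<epsilon>)) = d * measure \<nu> {x0..1}"
      "\<forall>x\<in>{0<..<1}. (1 - u) * (G ((1 - x) * u) - G u) + u * (G ((1 - x) * u + x) - G u) \<le> - d * indicator {x0..1} x"
      unfolding G_def by blast
    \<comment> \<open>The increase of the logarithmic term when the parent is in
      \<open>U - J\<close>, with the cutoff at 1 already applied to the part that is singular at
      \<open>x = 1\<close>.\<close>
    define \<alpha> where "\<alpha> = (\<lambda>x. min 1 (ln (1 / (1 - x)) / m) + ln (1 + x / (u + \<epsilon>)) / m)"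
    have s: "0 < u + \<epsilon>" using uu \<epsilon> by simp
    have i: "integrable \<nu> (indicat_real {x0..1})"
      using x0 by (intro integrable_bound_id[where C="1/x0"]) (auto simp: field_simps indicator_def)
    have a: "integrable \<nu> (\<lambda>x. min 1 (ln (1 / (1 - x)) / m))" "integrable \<nu> (\<lambda>x. ln (1 + x / (u + \<epsilon>)) / m)"
      using integrable_beta[OF m] integrable_kappa[OF s] by auto
    show ?thesis
    proof (rule two_type_gen_le[OF L bu, where B="\<lambda>x. u * \<alpha> x - c * (d * indicator {x0..1} x)"])
      show "integrable \<nu> (\<lambda>x. u * \<alpha> x - c * (d * indicator {x0..1} x))"
        unfolding \<alpha>_def using a i by (intro Bochner_Integration.integrable_diff integrable_mult_right Bochner_Integration.integrable_add) auto
      have "(\<integral>x. u * \<alpha> x - c * (d * indicator {x0..1} x) \<partial>\<nu>) = u * (beta m + kappa (u + \<epsilon>) / m) - c * (d * measure \<nu> {x0..1})"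
        unfolding \<alpha>_def using a i sets_tail[of x0] x0 by (simp add: beta_def kappa_def)
      also have "\<dots> = u * (beta m + kappa (u + \<epsilon>) / m - c * (1 + kappa (u + \<epsilon>)))"
        unfolding d(1)[symmetric] by (simp add: algebra_simps)
      also have "\<dots> \<le> 0"
      proof (rule mult_nonneg_nonpos[OF uu(1)])
        \<comment> \<open>This is exactly the amount by which
          \<open>c * (1 + kappa (u + \<epsilon>))\<close> exceeds
          \<open>beta m + kappa (u + \<epsilon>) / m\<close>.\<close>
        have "0 \<le> beta m * kappa (u + \<epsilon>) + 1 / m" using beta_nonneg[OF m] kappa_nonneg[OF s] m by simp
        then show "beta m + kappa (u + \<epsilon>) / m - c * (1 + kappa (u + \<epsilon>)) \<le> 0"
          unfolding c_def by (simp add: distrib_left distrib_right)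
      qed
      finally show "(\<integral>x. u * \<alpha> x - c * (d * indicator {x0..1} x) \<partial>\<nu>) \<le> 0" .
    next
      fix x :: real assume x: "0 < x" "x < 1"
      define u' where "u' = (1 - x) * u + x"
      define q where "q = (1 - x) * u"
      have r: "0 \<le> q" "q \<le> 1" "0 \<le> u'" "u' \<le> 1"
        using convex_01[of x u] x bu uu by (auto simp: u'_def q_def)
      have lnr: "l ((1 - x) * b) q \<le> l b u" "l ((1 - x) * b + x) u' \<le> l b u"
        using ln_ratio_jump(1,2)[OF bu(1,2) x \<epsilon>(1)] m by (auto simp: l_def q_def u'_def divide_right_mono)
      have lnr3: "l ((1 - x) * b) u' \<le> l b u + ln (1 / (1 - x)) / m + ln (1 + x / (u + \<epsilon>)) / m"
        using divide_right_mono[OF ln_ratio_jump(3)[OF bu(1,2) x \<epsilon>(1)], of m] m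
        by (simp add: l_def u'_def add_divide_distrib)
      have J1: "F ((1 - x) * b) q \<le> l b u + c * G q + q / u0" using lnr(1) by (simp add: F min_def)
      have J2: "F ((1 - x) * b + x) u' \<le> l b u + c * G u' + u' / u0" using lnr(2) by (simp add: F min_def)
      \<comment> \<open>The whole sum is cut off at 1 and its other terms are nonnegative, so the
        cutoff may be moved to \<open>ln (1 / (1 - x)) / m\<close> alone.\<close>
      have J3: "F ((1 - x) * b) u' \<le> l b u + \<alpha> x + c * G u' + u' / u0"
      proof -
        have "0 \<le> l b u" "0 \<le> c * G u'" "0 \<le> u' / u0" "0 \<le> ln (1 + x / (u + \<epsilon>)) / m"
          using l0[OF bu(1,2)] c G0[of u'] r u0 x s m by auto
        then show ?thesis using lnr3 by (simp add: F \<alpha>_def min_def) 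
      qed
      have \<alpha>0: "0 \<le> \<alpha> x" using min_ln_le(2)[OF x m] x s m by (simp add: \<alpha>_def)
      have "two_type_mean F b u x \<le> (1 - u) * (l b u + c * G q + q / u0) + b * (l b u + c * G u' + u' / u0)
          + (u - b) * (l b u + \<alpha> x + c * G u' + u' / u0)"
        unfolding two_type_mean_def unfolding u'_def[symmetric] unfolding q_def[symmetric]
        using J1 J2 J3 bu by (intro add_mono mult_left_mono) auto
      also have "\<dots> = l b u + c * G u + u / u0 + (u - b) * \<alpha> x
          + c * ((1 - u) * (G q - G u) + u * (G u' - G u)) + ((1 - u) * q + u * u' - u) / u0"
        by (simp add: algebra_simps add_divide_distrib diff_divide_distrib)
      \<comment> \<open>The expected mass of \<open>U\<close> after an event is \<open>u\<close>, so
        the linear term contributes no drift.\<close>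
      also have "(1 - u) * q + u * u' - u = 0" by (simp add: q_def u'_def algebra_simps)
      also have "l b u + c * G u + u / u0 = F b u" using 2 by (simp add: F)
      also have "F b u + (u - b) * \<alpha> x + c * ((1 - u) * (G q - G u) + u * (G u' - G u)) + 0 / u0
        \<le> F b u + u * \<alpha> x + c * (- d * indicator {x0..1} x)"
      proof -
        have "c * ((1 - u) * (G q - G u) + u * (G u' - G u)) \<le> c * (- d * indicator {x0..1} x)"
          using d(2)[rule_format, of x] x c unfolding q_def u'_def by (intro mult_left_mono) auto
        moreover have "(u - b) * \<alpha> x \<le> u * \<alpha> x" using \<alpha>0 bu by (intro mult_right_mono) auto
        ultimately show ?thesis by simp
      qed
      finally show "two_type_mean F b u x \<le> F b u + (u * \<alpha> x - c * (d * indicator {x0..1} x))"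
        by simp
    qed
  qed
  then show ?thesis by (simp add: F_def)
qed

lemma two_type_gen_Lyap:
  obtains C u0 where "0 \<le> C" "0 < u0" "u0 \<le> 1"
    "\<And>m \<epsilon> b u. 1 \<le> m \<Longrightarrow> 0 < \<epsilon> \<Longrightarrow> \<epsilon> \<le> u0 \<Longrightarrow> 0 \<le> b \<Longrightarrow> b \<le> u \<Longrightarrow> u \<le> 1 \<Longrightarrow>
       two_type_gen \<nu> (Lyap C u0 m \<epsilon>) b u \<le> 0"
proof (cases "emeasure \<nu> (space \<nu>) = 0")
  \<comment> \<open>Without jumps there is no tail of positive mass to produce a gap, but every
    generator vanishes.\<close>
  case True
  then have null: "AE x in \<nu>. P x" for P
    by (intro AE_I'[of "space \<nu>"]) (auto simp: null_sets_def)
  have "two_type_gen \<nu> F b u = 0" for F b u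
    unfolding two_type_gen_def by (rule integral_eq_zero_AE) (rule null)
  then show ?thesis by (intro that[of 0 1]) auto
next
  case False
  show ?thesis
  proof (rule concavity_gap[OF False], goal_cases)
    case (1 C u0 x0)
    then show ?thesis
      by (intro that[of C u0] two_type_gen_Lyap_aux[of C u0 _ _ x0]) auto
  qed
qed

end
subsection \<open>Measurability of powers and of paths\<close>

lemma M1_measurable:
  "f \<in> borel_measurable (subprob_algebra N) \<Longrightarrow> f \<in> borel_measurable (prob_algebra N)"
  unfolding prob_algebra_def by (rule measurable_restrict_space1)

lemma M1D:
  assumes "\<mu> \<in> space M1"
  shows "prob_space \<mu>" "sets \<mu> = sets borel01" "space \<mu> = {0..1}"
proof -
  show "prob_space \<mu>" and s: "sets \<mu> = sets borel01" using assms by (auto simp: space_prob_algebra)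
  show "space \<mu> = {0..1}" using sets_eq_imp_space_eq[OF s] by (simp add: space_restrict_space)
qed

text \<open>It suffices to look at rectangles, on which the power is a finite product of
  evaluations.\<close>

lemma measurable_power_M1:
  "(\<lambda>\<mu>. \<Pi>\<^sub>M i\<in>{1..n}. \<mu>) \<in> M1 \<rightarrow>\<^sub>M prob_algebra (\<Pi>\<^sub>M i\<in>{1..n::nat}. borel01)"
proof (rule measurable_prob_algebra_generated[OF sets_PiM Int_stable_prod_algebra prod_algebra_sets_into_space])
  fix \<mu> assume \<mu>: "\<mu> \<in> space M1"
  show "prob_space (\<Pi>\<^sub>M i\<in>{1..n}. \<mu>)" using M1D[OF \<mu>] by (intro prob_space_PiM) auto
  show "sets (\<Pi>\<^sub>M i\<in>{1..n}. \<mu>) = sets (\<Pi>\<^sub>M i\<in>{1..n}. borel01)"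
    using M1D[OF \<mu>] by (intro sets_PiM_cong) auto
next
  fix A assume "A \<in> prod_algebra {1..n} (\<lambda>_. borel01)"
  then obtain E where A: "A = Pi\<^sub>E {1..n} E" and E: "E \<in> (\<Pi> i\<in>{1..n}. sets borel01)"
    by (rule prod_algebraE_all)
  have "emeasure (\<Pi>\<^sub>M i\<in>{1..n}. \<mu>) A = (\<Prod>i\<in>{1..n}. emeasure \<mu> (E i))" if "\<mu> \<in> space M1" for \<mu>
  proof -
    interpret prob_space \<mu> by (rule M1D[OF that])
    interpret product_sigma_finite "\<lambda>_::nat. \<mu>" by unfold_locales
    show ?thesis unfolding A using E M1D[OF that] by (intro emeasure_PiM) auto
  qed
  moreover have "(\<lambda>\<mu>. \<Prod>i\<in>{1..n}. emeasure \<mu> (E i)) \<in> borel_measurable M1"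
    using E by (intro borel_measurable_prod_ennreal M1_measurable measurable_emeasure_subprob_algebra) auto
  ultimately show "(\<lambda>\<mu>. emeasure (\<Pi>\<^sub>M i\<in>{1..n}. \<mu>) A) \<in> borel_measurable M1"
    by (simp cong: measurable_cong)
qed

lemma measurable_integral_power:
  fixes h :: "(nat \<Rightarrow> real) \<Rightarrow> real"
  assumes "h \<in> borel_measurable (\<Pi>\<^sub>M i\<in>{1..n::nat}. borel01)"
  shows "(\<lambda>\<mu>. \<integral>x. h x \<partial>(\<Pi>\<^sub>M i\<in>{1..n}. \<mu>)) \<in> borel_measurable M1"
  by (rule measurable_compose[OF measurable_power_M1 M1_measurable[OF integral_measurable_subprob_algebra[OF assms]]])

text \<open>The function is the pointwise limit of step functions that sample it on a grid slightly
  to the right of the current time. Freezing it at negative times makes it total on the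
  line.\<close>

lemma measurable_right_continuous:
  fixes g :: "real \<Rightarrow> real"
  assumes "\<And>s. 0 \<le> s \<Longrightarrow> (g \<longlongrightarrow> g s) (at_right s)"
  shows "(\<lambda>s. g (max 0 s)) \<in> borel_measurable borel"
proof -
  \<comment> \<open>Adding 1 after rounding down keeps the grid point strictly to the right of
    \<open>s\<close>, also when \<open>s\<close> lies on the grid; the right limit excludes
    \<open>s\<close> itself.\<close>
  define a where "a = (\<lambda>n s. (of_int \<lfloor>max 0 s * real (Suc n)\<rfloor> + 1) / real (Suc n))"
  have a: "max 0 s < a n s" "a n s \<le> max 0 s + 1 / real (Suc n)" for n s
  proof -
    define y where "y = max 0 s * real (Suc n)"
    have y: "y < of_int \<lfloor>y\<rfloor> + 1" "of_int \<lfloor>y\<rfloor> + 1 \<le> y + 1" by linarith+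
    have "a n s = (of_int \<lfloor>y\<rfloor> + 1) / real (Suc n)" by (simp add: a_def y_def)
    moreover have "max 0 s = y / real (Suc n)" by (simp add: y_def)
    ultimately show "max 0 s < a n s" "a n s \<le> max 0 s + 1 / real (Suc n)"
      using y divide_strict_right_mono[OF y(1), of "real (Suc n)"] divide_right_mono[OF y(2), of "real (Suc n)"]
      by (simp_all add: add_divide_distrib)
  qed
  show ?thesis
  proof (rule borel_measurable_LIMSEQ_real)
    fix s :: real
    have "(\<lambda>n. a n s) \<longlonglongrightarrow> max 0 s"
    proof (rule tendsto_sandwich)
      show "\<forall>\<^sub>F n in sequentially. max 0 s \<le> a n s" using a(1) by (intro always_eventually allI less_imp_le)
      show "\<forall>\<^sub>F n in sequentially. a n s \<le> max 0 s + 1 / real (Suc n)" using a(2) by simp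
      have "(\<lambda>n. max 0 s + 1 / real (Suc n)) \<longlonglongrightarrow> max 0 s + 0"
        by (intro tendsto_add tendsto_const LIMSEQ_Suc[OF lim_const_over_n])
      then show "(\<lambda>n. max 0 s + 1 / real (Suc n)) \<longlonglongrightarrow> max 0 s" by simp
    qed simp
    then have *: "filterlim (\<lambda>n. a n s) (at_right (max 0 s)) sequentially"
    proof (unfold filterlim_at, intro conjI always_eventually allI)
      show "a n s \<in> {max 0 s<..}" for n using a(1)[of s n] by (simp only: greaterThan_iff)
      show "a n s \<noteq> max 0 s" for n by (rule less_imp_neq[symmetric]) (rule a(1))
    qed
    have "(g \<longlongrightarrow> g (max 0 s)) (at_right (max 0 s))" by (rule assms) simp
    from filterlim_compose[OF this *] show "(\<lambda>n. g (a n s)) \<longlonglongrightarrow> g (max 0 s)" .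
  next
    fix n
    have "(\<lambda>s. max 0 s * real (Suc n)) \<in> borel \<rightarrow>\<^sub>M borel" by measurable
    then have "(\<lambda>s. \<lfloor>max 0 s * real (Suc n)\<rfloor>) \<in> borel \<rightarrow>\<^sub>M count_space UNIV"
      by (rule measurable_compose[OF _ measurable_real_floor])
    then have "(\<lambda>s. (\<lambda>k. g ((of_int k + 1) / real (Suc n))) \<lfloor>max 0 s * real (Suc n)\<rfloor>) \<in> borel_measurable borel"
      by (rule measurable_compose) simp
    then show "(\<lambda>s. g (a n s)) \<in> borel_measurable borel"
      by (simp add: a_def)
  qed
qed

text \<open>Continuous functions that decrease to the indicator of a nonempty closed
  \<open>J\<close>. For empty \<open>J\<close> the distance is 0 by convention and the function is
  constantly 1, so nonemptiness is assumed wherever the limit is taken.\<close>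

definition bump :: "real set \<Rightarrow> nat \<Rightarrow> real \<Rightarrow> real" where
  "bump J n x = max 0 (1 - real n * infdist x J)"

lemma bump_bounds: "0 \<le> bump J n x" "bump J n x \<le> 1"
  using infdist_nonneg[of x J] by (auto simp: bump_def)

lemma bump_continuous: "continuous_on S (bump J n)"
  unfolding bump_def by (intro continuous_intros)

lemma bump_measurable [measurable]: "bump J n \<in> borel_measurable borel"
  using bump_continuous by (rule borel_measurable_continuous_onI)

lemma bump_tendsto:
  assumes "closed J" "J \<noteq> {}"
  shows "(\<lambda>n. bump J n x) \<longlonglongrightarrow> indicator J x"
proof (cases "x \<in> J")
  case True
  then show ?thesis by (simp add: bump_def)
next
  case False
  then have pos: "0 < infdist x J"
    using assms in_closed_iff_infdist_zero[of J x] infdist_nonneg[of x J] by (simp add: less_le)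
  have "\<forall>\<^sub>F n in sequentially. bump J n x = 0"
  proof -
    obtain N where N: "1 < real N * infdist x J" using reals_Archimedean3[OF pos] by blast
    have "bump J n x = 0" if "N \<le> n" for n
    proof -
      have "real N * infdist x J \<le> real n * infdist x J" using that pos by (intro mult_right_mono) auto
      then show ?thesis using N by (simp add: bump_def)
    qed
    then show ?thesis using eventually_sequentially by blast
  qed
  then show ?thesis using False by (simp add: tendsto_eventually)
qed

text \<open>Closed sets form an intersection-stable generator, and their masses are limits of
  integrals of continuous functions.\<close>

lemma sets_borel01_closed: "sets borel01 = sigma_sets {0..1} {C. closed C \<and> C \<subseteq> {0..1}}"
proof
  have "sets borel01 = (\<inter>) {0..1} ` sigma_sets UNIV {S::real set. closed S}"
    by (simp add: sets_restrict_space borel_eq_closed)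
  also have "\<dots> = sigma_sets {0..1} ((\<inter>) {0..1} ` {S::real set. closed S})"
    by (rule sigma_sets_Int) (auto intro: sigma_sets.Basic)
  also have "\<dots> \<subseteq> sigma_sets {0..1} {C. closed C \<and> C \<subseteq> {0..1}}"
    by (rule sigma_sets_mono) (auto intro: sigma_sets.Basic)
  finally show "sets borel01 \<subseteq> sigma_sets {0..1} {C. closed C \<and> C \<subseteq> {0..1}}" .
  have "C \<in> sets borel01" if "closed C" "C \<subseteq> {0..1}" for C :: "real set"
    using that by (subst sets_restrict_space_iff) auto
  then show "sigma_sets {0..1} {C. closed C \<and> C \<subseteq> {0..1}} \<subseteq> sets borel01"
    using sets.sigma_sets_subset[of "{C. closed C \<and> C \<subseteq> {0..1}}" borel01]
    by (auto simp: space_restrict_space)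
qed

lemma M1_measurable_ident: "f \<in> borel_measurable borel \<Longrightarrow> \<mu> \<in> space M1 \<Longrightarrow> f \<in> borel_measurable \<mu>"
  using measurable_restrict_space1[of f borel borel "{0..1}"] M1D(2)[of \<mu>] measurable_cong_sets[of \<mu> borel01 borel borel]
  by blast

lemma integral_bump_tendsto:
  assumes \<mu>: "\<mu> \<in> space M1" and J: "closed J" "J \<noteq> {}" "J \<subseteq> {0..1}"
  shows "(\<lambda>n. \<integral>x. bump J n x \<partial>\<mu>) \<longlonglongrightarrow> measure \<mu> J"
    and "(\<lambda>n. \<integral>x. \<bar>bump J n x - indicator J x\<bar> \<partial>\<mu>) \<longlonglongrightarrow> 0"
proof -
  interpret prob_space \<mu> by (rule M1D[OF \<mu>])
  have Jm: "J \<in> sets \<mu>" unfolding M1D(2)[OF \<mu>] using J by (subst sets_restrict_space_iff) auto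
  have [measurable]: "bump J n \<in> borel_measurable \<mu>" for n
    using M1_measurable_ident[OF bump_measurable \<mu>] .
  note [measurable] = Jm
  have "(\<lambda>n. \<integral>x. bump J n x \<partial>\<mu>) \<longlonglongrightarrow> (\<integral>x. indicator J x \<partial>\<mu>)"
    by (rule integral_dominated_convergence[where w="\<lambda>_. 1"])
       (use bump_bounds bump_tendsto[OF J(1,2)] in auto)
  then show "(\<lambda>n. \<integral>x. bump J n x \<partial>\<mu>) \<longlonglongrightarrow> measure \<mu> J" using Jm by simp
  have "(\<lambda>n. \<integral>x. \<bar>bump J n x - indicator J x\<bar> \<partial>\<mu>) \<longlonglongrightarrow> (\<integral>x. 0 \<partial>\<mu>)"
  proof (rule integral_dominated_convergence[where w="\<lambda>_. 1"])
    show "AE x in \<mu>. (\<lambda>n. \<bar>bump J n x - indicator J x\<bar>) \<longlonglongrightarrow> 0"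
      using bump_tendsto[OF J(1,2)] by (intro AE_I2 tendsto_rabs_zero LIM_zero)
    show "AE x in \<mu>. norm \<bar>bump J n x - indicator J x\<bar> \<le> 1" for n
    proof (rule AE_I2)
      fix x
      show "norm \<bar>bump J n x - indicator J x\<bar> \<le> 1"
        using bump_bounds(1)[of J n x] bump_bounds(2)[of J n x] by (simp add: indicator_def)
    qed
  qed auto
  then show "(\<lambda>n. \<integral>x. \<bar>bump J n x - indicator J x\<bar> \<partial>\<mu>) \<longlonglongrightarrow> 0" by simp
qed

text \<open>Weak right-continuity makes the integrals of \<open>bump\<close> right-continuous in
  time, and masses of closed sets are limits of these. This gives a meaning to the time integral of
  the generator along a path.\<close>

lemma measurable_cadlag_path:
  assumes "cadlag weak_topology r" and sp: "\<And>t. 0 \<le> t \<Longrightarrow> r t \<in> space M1"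
  shows "(\<lambda>s. r (max 0 s)) \<in> borel \<rightarrow>\<^sub>M M1"
proof (rule measurable_prob_algebra_generated[OF _ _ _ _ _])
  let ?G0 = "{C::real set. closed C \<and> C \<subseteq> {0..1}}"
  show "sets borel01 = sigma_sets {0..1} ?G0" by (rule sets_borel01_closed)
  show "Int_stable ?G0" by (auto simp: Int_stable_def)
  show "?G0 \<subseteq> Pow {0..1}" by auto
  show "prob_space (r (max 0 s))" "sets (r (max 0 s)) = sets borel01" for s
    using M1D[OF sp[of "max 0 s"]] by auto
  fix J assume "J \<in> ?G0"
  then have J: "closed J" "J \<subseteq> {0..1}" by auto
  show "(\<lambda>s. emeasure (r (max 0 s)) J) \<in> borel_measurable borel"
  proof (cases "J = {}")
    case False
    have "(\<lambda>s. measure (r (max 0 s)) J) \<in> borel_measurable borel"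
    proof (rule borel_measurable_LIMSEQ_real)
      show "(\<lambda>n. \<integral>x. bump J n x \<partial>r (max 0 s)) \<longlonglongrightarrow> measure (r (max 0 s)) J" for s
        using integral_bump_tendsto(1)[OF sp[of "max 0 s"] J(1) False J(2)] by simp
      show "(\<lambda>s. \<integral>x. bump J n x \<partial>r (max 0 s)) \<in> borel_measurable borel" for n
      proof (rule measurable_right_continuous)
        fix s :: real assume "0 \<le> s"
        then have "limitin weak_topology r (r s) (at_right s)" using assms(1) by (simp add: cadlag_def)
        then show "((\<lambda>t. \<integral>x. bump J n x \<partial>r t) \<longlongrightarrow> (\<integral>x. bump J n x \<partial>r s)) (at_right s)"
          using bump_continuous unfolding limitin_weak_topology by blast
      qed
    qed
    moreover have "emeasure (r (max 0 s)) J = ennreal (measure (r (max 0 s)) J)" for s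
      using M1D(1)[OF sp[of "max 0 s"]]
      by (simp add: finite_measure.emeasure_eq_measure prob_space.finite_measure)
    ultimately show ?thesis by simp
  qed simp
qed

subsection \<open>Sampling from a probability measure\<close>

text \<open>The inequality of arithmetic and geometric means, weighted so that a second moment of
  order \<open>1 / n\<close> becomes a first moment of order \<open>1 / sqrt n\<close>. It takes the
  place of Cauchy-Schwarz.\<close>

lemma abs_le_weighted_square:
  fixes y :: real
  assumes "0 < n"
  shows "\<bar>y\<bar> \<le> (sqrt n * y\<^sup>2 + 1 / sqrt n) / 2"
proof -
  have s: "0 < sqrt n" using assms by simp
  have "0 \<le> (sqrt n * \<bar>y\<bar> - 1)\<^sup>2 / sqrt n" using s by (intro divide_nonneg_pos) auto
  also have "(s * a - 1)\<^sup>2 / s = s * a\<^sup>2 - 2 * a + 1 / s" if "0 < s" for s a :: real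
    using that by (simp add: power2_eq_square field_simps)
  note this[OF s, of "\<bar>y\<bar>"]
  also have "sqrt n * \<bar>y\<bar>\<^sup>2 - 2 * \<bar>y\<bar> + 1 / sqrt n = sqrt n * y\<^sup>2 - 2 * \<bar>y\<bar> + 1 / sqrt n" by simp
  finally show ?thesis by simp
qed

lemma sum_Pow_card:
  fixes g :: "nat \<Rightarrow> real"
  shows "(\<Sum>K\<in>Pow {1..n}. g (card K)) = (\<Sum>k\<le>n. real (n choose k) * g k)"
proof -
  have "(\<Sum>K\<in>Pow {1..n}. g (card K)) = (\<Sum>k\<le>n. \<Sum>K | K \<in> Pow {1..n} \<and> card K = k. g (card K))"
    by (rule sum.group[symmetric]) (use card_mono[of "{1..n}"] in force)+
  also have "\<dots> = (\<Sum>k\<le>n. real (n choose k) * g k)"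
  proof (rule sum.cong)
    fix k
    have "(\<Sum>K | K \<in> Pow {1..n} \<and> card K = k. g (card K)) = real (card {K. K \<subseteq> {1..n} \<and> card K = k}) * g k"
      by simp
    then show "(\<Sum>K | K \<in> Pow {1..n} \<and> card K = k. g (card K)) = real (n choose k) * g k"
      using n_subsets[of "{1..n}" k] by simp
  qed simp
  finally show ?thesis .
qed

text \<open>The probability that an event of size \<open>x\<close> hits exactly the coordinates in \<open>K\<close>.\<close>

definition wt :: "nat \<Rightarrow> real \<Rightarrow> nat set \<Rightarrow> real" where
  "wt n x K = x ^ card K * (1 - x) ^ (n - card K)"

lemma wt_nonneg: "0 \<le> x \<Longrightarrow> x \<le> 1 \<Longrightarrow> 0 \<le> wt n x K"
  by (simp add: wt_def)

text \<open>Under the weights \<open>wt\<close> the size of \<open>K\<close> is binomial; grouping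
  by size produces Bernstein polynomials, whose first two moments are known.\<close>

lemma sum_wt:
  fixes g :: "nat \<Rightarrow> real"
  shows "(\<Sum>K\<in>Pow {1..n}. wt n x K * g (card K)) = (\<Sum>k\<le>n. g k * Bernstein n k x)"
  using sum_Pow_card[of "\<lambda>k. x ^ k * (1 - x) ^ (n - k) * g k" n]
  by (simp add: wt_def Bernstein_def mult_ac)

lemma sum_wt_1: "(\<Sum>K\<in>Pow {1..n}. wt n x K) = 1"
  using sum_wt[of n x "\<lambda>_. 1"] by simp

lemma sum_wt_card: "(\<Sum>K\<in>Pow {1..n}. wt n x K * real (card K)) = real n * x"
  using sum_wt[of n x real] by simp

text \<open>The law of large numbers for the fraction of coordinates that are hit: the variance of
  the binomial size is \<open>n * x * (1 - x)\<close>, hence at most \<open>n\<close>.\<close>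

lemma sum_wt_deviation:
  assumes n: "1 \<le> n" and x: "0 \<le> x" "x \<le> 1"
  shows "(\<Sum>K\<in>Pow {1..n}. wt n x K * \<bar>real (card K) / real n - x\<bar>) \<le> 1 / sqrt (real n)"
proof -
  have "(\<Sum>K\<in>Pow {1..n}. wt n x K * (real (card K) - real n * x)\<^sup>2)
    = (\<Sum>k\<le>n. (real k - real n * x)\<^sup>2 * Bernstein n k x)"
    using sum_wt[of n x "\<lambda>k. (real k - real n * x)\<^sup>2"] .
  also have "\<dots> = (\<Sum>k\<le>n. real k * (real k - 1) * Bernstein n k x + (1 - 2 * real n * x) * (real k * Bernstein n k x)
      + (real n * x)\<^sup>2 * Bernstein n k x)"
    by (intro sum.cong refl) (simp add: power2_eq_square algebra_simps)
  also have "\<dots> = real n * (real n - 1) * x\<^sup>2 + (1 - 2 * real n * x) * (real n * x) + (real n * x)\<^sup>2"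
    by (simp add: sum.distrib sum_distrib_left[symmetric])
  also have "\<dots> = real n * (x * (1 - x))" by (simp add: power2_eq_square algebra_simps)
  finally have v: "(\<Sum>K\<in>Pow {1..n}. wt n x K * (real (card K) - real n * x)\<^sup>2) = real n * (x * (1 - x))" .
  have s: "0 < sqrt (real n)" using n by simp
  have "(\<Sum>K\<in>Pow {1..n}. wt n x K * \<bar>real (card K) / real n - x\<bar>)
    \<le> (\<Sum>K\<in>Pow {1..n}. wt n x K * ((sqrt (real n) * (real (card K) / real n - x)\<^sup>2 + 1 / sqrt (real n)) / 2))"
    using n x by (intro sum_mono mult_left_mono abs_le_weighted_square wt_nonneg) auto
  also have "\<dots> = (\<Sum>K\<in>Pow {1..n}. sqrt (real n) / (2 * (real n)\<^sup>2) * (wt n x K * (real (card K) - real n * x)\<^sup>2)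
      + 1 / (2 * sqrt (real n)) * wt n x K)"
  proof (intro sum.cong refl)
    fix K :: "nat set"
    have "real (card K) / real n - x = (real (card K) - real n * x) / real n" using n by (simp add: field_simps)
    then show "wt n x K * ((sqrt (real n) * (real (card K) / real n - x)\<^sup>2 + 1 / sqrt (real n)) / 2)
      = sqrt (real n) / (2 * (real n)\<^sup>2) * (wt n x K * (real (card K) - real n * x)\<^sup>2) + 1 / (2 * sqrt (real n)) * wt n x K"
      by (simp add: power_divide algebra_simps)
  qed
  also have "\<dots> = sqrt (real n) / (2 * (real n)\<^sup>2) * (real n * (x * (1 - x))) + 1 / (2 * sqrt (real n))"
    by (simp only: sum.distrib sum_distrib_left[symmetric] v sum_wt_1 mult_1_right)
  also have "\<dots> \<le> sqrt (real n) / (2 * (real n)\<^sup>2) * (real n * 1) + 1 / (2 * sqrt (real n))"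
    using x n by (intro add_mono mult_left_mono mult_le_one) auto
  also have "\<dots> = 1 / sqrt (real n)"
    using s by (simp add: power2_eq_square field_simps)
  finally show ?thesis .
qed

text \<open>The coordinates in \<open>K\<close> all copy the parent \<open>x (Min K)\<close>, and
  the others run bijectively through the remaining coordinates in use. A symmetric statistic thus
  sees \<open>card K\<close> copies of the parent and \<open>n - card K\<close> other
  samples.\<close>

lemma FV_R_sum:
  fixes \<phi> :: "real \<Rightarrow> real"
  assumes K: "K \<subseteq> {1..n}" "K \<noteq> {}"
  shows "(\<Sum>i\<in>{1..n}. \<phi> (FV_R n K x i))
    = real (card K) * \<phi> (x (Min K)) + (\<Sum>j\<in>{1..n - card K + 1} - {Min K}. \<phi> (x j))"
proof -
  have fin: "finite K" using K(1) finite_subset by blast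
  have "(\<Sum>i\<in>{1..n}. \<phi> (FV_R n K x i)) = (\<Sum>i\<in>{1..n}. \<phi> (x (R_index K i)))"
    by (intro sum.cong) (auto simp: FV_R_def)
  also have "\<dots> = (\<Sum>i\<in>{1..n} - K. \<phi> (x (R_index K i))) + (\<Sum>i\<in>K. \<phi> (x (R_index K i)))"
    using K by (intro sum.subset_diff) auto
  also have "(\<Sum>i\<in>K. \<phi> (x (R_index K i))) = real (card K) * \<phi> (x (Min K))"
    by (simp add: R_index_def)
  also have "(\<Sum>i\<in>{1..n} - K. \<phi> (x (R_index K i))) = (\<Sum>j\<in>R_index K ` ({1..n} - K). \<phi> (x j))"
    by (rule sum.reindex[symmetric, unfolded comp_def])
       (rule strict_mono_on_imp_inj_on[OF R_index_order_iso(1)[OF K]])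
  finally show ?thesis unfolding R_index_order_iso(2)[OF K] by simp
qed

lemma Min_card_bounds:
  assumes K: "K \<subseteq> {1..n}" "K \<noteq> {}"
  shows "Min K \<in> {1..n - card K + 1}" "card K \<le> n" "1 \<le> card K"
    "card ({1..n - card K + 1} - {Min K}) = n - card K" "{1..n - card K + 1} \<subseteq> {1..n}"
proof -
  have fin: "finite K" using K(1) finite_subset by blast
  have m: "Min K \<in> K" using fin K(2) by simp
  have "K \<subseteq> {Min K..n}" using K(1) fin by auto
  then have "card K \<le> card {Min K..n}" by (intro card_mono) auto
  moreover have "1 \<le> Min K" "Min K \<le> n" using m K(1) by auto
  ultimately show a: "Min K \<in> {1..n - card K + 1}" by auto
  show b: "card K \<le> n" using card_mono[OF _ K(1)] by simp
  show c: "1 \<le> card K" using fin K(2) by (simp add: Suc_leI card_gt_0_iff)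
  show "card ({1..n - card K + 1} - {Min K}) = n - card K" using a by simp
  show "{1..n - card K + 1} \<subseteq> {1..n}" using b c by auto
qed

lemma FV_R_index:
  assumes K: "K \<subseteq> {1..n}" "K \<noteq> {}" and i: "i \<in> {1..n}"
  shows "R_index K i \<in> {1..n}"
proof (cases "i \<in> K")
  case True
  then show ?thesis using Min_card_bounds[OF K] by (auto simp: R_index_def)
next
  case False
  then show ?thesis using R_index_order_iso(2)[OF K] Min_card_bounds(5)[OF K] i by blast
qed

lemma FV_R_measurable:
  assumes K: "K \<subseteq> {1..n}" "K \<noteq> {}"
  shows "FV_R n K \<in> (\<Pi>\<^sub>M i\<in>{1..n}. M) \<rightarrow>\<^sub>M (\<Pi>\<^sub>M i\<in>{1..n}. M)"
  unfolding FV_R_def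
  by (rule measurable_restrict) (intro measurable_component_singleton FV_R_index[OF K])

lemma two_type_mean_0: "two_type_mean F b u 0 = F b u"
  by (simp add: two_type_mean_def algebra_simps)

text \<open>Controls the replacement of the observed fraction \<open>card K / n\<close> by the size
  \<open>x\<close> of the event.\<close>

lemma two_type_mean_lipschitz:
  assumes F: "lip01 L F" and bu: "0 \<le> b" "b \<le> u" "u \<le> 1" and x: "x \<in> {0..1}" "y \<in> {0..1}"
  shows "\<bar>two_type_mean F b u x - two_type_mean F b u y\<bar> \<le> 2 * L * \<bar>x - y\<bar>"
proof -
  have L: "0 \<le> L" using F by (simp add: lip01_def)
  have r: "(1 - x) * p \<in> {0..1}" "(1 - x) * p + x \<in> {0..1}" if "x \<in> {0..1}" "p \<in> {b, u}" for p x
    using convex_01[of x p] that bu by auto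
  have d: "\<bar>(1 - x) * p - (1 - y) * p\<bar> \<le> \<bar>x - y\<bar>" "\<bar>((1 - x) * p + x) - ((1 - y) * p + y)\<bar> \<le> \<bar>x - y\<bar>"
    if p: "p \<in> {b, u}" for p
  proof -
    have p: "0 \<le> p" "p \<le> 1" using that bu by auto
    have "\<bar>(1 - x) * p - (1 - y) * p\<bar> = \<bar>x - y\<bar> * p"
    proof -
      have "(1 - x) * p - (1 - y) * p = (y - x) * p" by (simp add: algebra_simps)
      then show ?thesis using p by (simp add: abs_mult abs_minus_commute)
    qed
    then show "\<bar>(1 - x) * p - (1 - y) * p\<bar> \<le> \<bar>x - y\<bar>" using p mult_left_mono[of p 1 "\<bar>x - y\<bar>"] by simp
    have "\<bar>((1 - x) * p + x) - ((1 - y) * p + y)\<bar> = \<bar>x - y\<bar> * (1 - p)"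
    proof -
      have "((1 - x) * p + x) - ((1 - y) * p + y) = (x - y) * (1 - p)" by (simp add: algebra_simps)
      then show ?thesis using p by (simp add: abs_mult)
    qed
    then show "\<bar>((1 - x) * p + x) - ((1 - y) * p + y)\<bar> \<le> \<bar>x - y\<bar>"
      using p mult_left_mono[of "1 - p" 1 "\<bar>x - y\<bar>"] by simp
  qed
  have D: "\<bar>F p q - F p' q'\<bar> \<le> 2 * L * \<bar>x - y\<bar>"
    if "p \<in> {0..1}" "q \<in> {0..1}" "p' \<in> {0..1}" "q' \<in> {0..1}" "\<bar>p - p'\<bar> \<le> \<bar>x - y\<bar>" "\<bar>q - q'\<bar> \<le> \<bar>x - y\<bar>" for p q p' q'
  proof -
    have "\<bar>F p q - F p' q'\<bar> \<le> L * (\<bar>p - p'\<bar> + \<bar>q - q'\<bar>)" by (rule lip01D[OF F that(1-4)])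
    also have "\<dots> \<le> L * (2 * \<bar>x - y\<bar>)" using that L by (intro mult_left_mono) auto
    finally show ?thesis by simp
  qed
  define A where "A = F ((1 - x) * b) ((1 - x) * u) - F ((1 - y) * b) ((1 - y) * u)"
  define B where "B = F ((1 - x) * b + x) ((1 - x) * u + x) - F ((1 - y) * b + y) ((1 - y) * u + y)"
  define C where "C = F ((1 - x) * b) ((1 - x) * u + x) - F ((1 - y) * b) ((1 - y) * u + y)"
  have "\<bar>A\<bar> \<le> 2 * L * \<bar>x - y\<bar>" "\<bar>B\<bar> \<le> 2 * L * \<bar>x - y\<bar>" "\<bar>C\<bar> \<le> 2 * L * \<bar>x - y\<bar>"
    unfolding A_def B_def C_def by (rule D; (rule r d)?; use x in simp)+
  then have "\<bar>(1 - u) * A\<bar> \<le> (1 - u) * (2 * L * \<bar>x - y\<bar>)" "\<bar>b * B\<bar> \<le> b * (2 * L * \<bar>x - y\<bar>)"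
    "\<bar>(u - b) * C\<bar> \<le> (u - b) * (2 * L * \<bar>x - y\<bar>)"
    using bu by (auto simp only: abs_mult abs_of_nonneg diff_ge_0_iff_ge intro!: mult_left_mono)
  then have "\<bar>(1 - u) * A + b * B + (u - b) * C\<bar>
    \<le> (1 - u) * (2 * L * \<bar>x - y\<bar>) + b * (2 * L * \<bar>x - y\<bar>) + (u - b) * (2 * L * \<bar>x - y\<bar>)"
    by linarith
  also have "\<dots> = 2 * L * \<bar>x - y\<bar>" by (simp add: algebra_simps)
  finally have *: "\<bar>(1 - u) * A + b * B + (u - b) * C\<bar> \<le> 2 * L * \<bar>x - y\<bar>" .
  have "two_type_mean F b u x - two_type_mean F b u y = (1 - u) * A + b * B + (u - b) * C"
    unfolding two_type_mean_def A_def B_def C_def by (simp add: algebra_simps)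
  then show ?thesis using * by simp
qed

section \<open>Moments of independent samples\<close>

locale M1_point = prob_space \<mu> for \<mu> :: "real measure" +
  fixes n :: nat
  assumes \<mu>: "\<mu> \<in> space M1" and n: "1 \<le> n"
begin

declare One_nat_def [simp del]

abbreviation PM where "PM \<equiv> \<Pi>\<^sub>M i\<in>{1..n}. \<mu>"

sublocale prod_mu: product_prob_space "\<lambda>_::nat. \<mu>" "{1..n}" by unfold_locales

lemma prob_PM: "prob_space PM" by (rule prob_space_PiM) unfold_locales

lemmas PM_integrable = finite_measure.integrable_const_bound[OF prob_space.finite_measure[OF prob_PM]]

lemma PM_const [simp]: "integrable PM (\<lambda>_. c :: real)" "(\<integral>_. (c :: real) \<partial>PM) = c"
  using prob_PM by (simp_all add: finite_measure.integrable_const prob_space.finite_measure prob_space.prob_space)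

lemma measurable_coordinate:
  "h \<in> borel_measurable \<mu> \<Longrightarrow> i \<in> {1..n} \<Longrightarrow> (\<lambda>x. h (x i)) \<in> borel_measurable PM"
  by (rule measurable_compose[OF measurable_component_singleton])

lemma integral_coordinate:
  fixes h :: "real \<Rightarrow> real"
  assumes h: "h \<in> borel_measurable \<mu>" and i: "i \<in> {1..n}"
  shows "(\<integral>x. h (x i) \<partial>PM) = (\<integral>a. h a \<partial>\<mu>)"
proof -
  have "(\<integral>a. h a \<partial>\<mu>) = (\<integral>a. h a \<partial>distr PM \<mu> (\<lambda>x. x i))"
    using prod_mu.PiM_component[OF i] by simp
  also have "\<dots> = (\<integral>x. h (x i) \<partial>PM)"
    by (rule integral_distr[OF measurable_component_singleton[OF i] h])
  finally show ?thesis ..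
qed

text \<open>Independence: the integrand is a product over all coordinates with factors 1 except at
  \<open>i\<close> and \<open>j\<close>, and the factor at \<open>i\<close> integrates to 0.\<close>

lemma integral_product_coordinates:
  fixes h :: "real \<Rightarrow> real"
  assumes h: "integrable \<mu> h" "(\<integral>a. h a \<partial>\<mu>) = 0" and ij: "i \<in> {1..n}" "j \<in> {1..n}" "i \<noteq> j"
  shows "(\<integral>x. h (x i) * h (x j) \<partial>PM) = 0"
proof -
  define f where "f = (\<lambda>l. if l \<in> {i, j} then h else (\<lambda>_. 1))"
  have "(\<integral>x. (\<Prod>l\<in>{1..n}. f l (x l)) \<partial>PM) = (\<Prod>l\<in>{1..n}. \<integral>a. f l a \<partial>\<mu>)"
    by (rule prod_mu.product_integral_prod) (auto simp: f_def h)
  also have "\<dots> = 0"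
    using ij h(2) by (intro prod_zero bexI[of _ i]) (auto simp: f_def)
  also have "(\<lambda>x. \<Prod>l\<in>{1..n}. f l (x l)) = (\<lambda>x. h (x i) * h (x j))"
  proof
    fix x
    have "(\<Prod>l\<in>{1..n}. f l (x l)) = (\<Prod>l\<in>{i, j}. h (x l))"
      using ij by (intro prod.mono_neutral_cong_right) (auto simp: f_def)
    then show "(\<Prod>l\<in>{1..n}. f l (x l)) = h (x i) * h (x j)" using ij by simp
  qed
  finally show ?thesis .
qed

text \<open>The terms off the diagonal vanish by independence and centering; each diagonal term is
  at most 1.\<close>

lemma second_moment:
  fixes h :: "real \<Rightarrow> real"
  assumes h: "h \<in> borel_measurable \<mu>" "\<And>a. a \<in> space \<mu> \<Longrightarrow> \<bar>h a\<bar> \<le> 1" "(\<integral>a. h a \<partial>\<mu>) = 0"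
    and S: "S \<subseteq> {1..n}"
  shows "(\<integral>x. (\<Sum>j\<in>S. h (x j))\<^sup>2 \<partial>PM) \<le> real (card S)"
proof -
  have fin: "finite S" using S finite_subset by blast
  have int: "integrable \<mu> h" using h by (intro integrable_const_bound[where B=1]) auto
  have le: "\<bar>h (x i)\<bar> \<le> 1" if "x \<in> space PM" "i \<in> {1..n}" for x i
    using that h(2) by (auto simp: space_PiM PiE_iff)
  have int2: "integrable PM (\<lambda>x. h (x i) * h (x j))" if "i \<in> {1..n}" "j \<in> {1..n}" for i j
  proof (rule PM_integrable[where B=1])
    show "AE x in PM. norm (h (x i) * h (x j)) \<le> 1"
      using le that by (intro AE_I2) (auto simp: abs_mult intro!: mult_le_one)
    show "(\<lambda>x. h (x i) * h (x j)) \<in> borel_measurable PM"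
      using h(1) that by (intro borel_measurable_times measurable_coordinate)
  qed
  have "(\<integral>x. (\<Sum>j\<in>S. h (x j))\<^sup>2 \<partial>PM) = (\<integral>x. (\<Sum>i\<in>S. \<Sum>j\<in>S. h (x i) * h (x j)) \<partial>PM)"
    by (simp add: power2_eq_square sum_product)
  also have "\<dots> = (\<Sum>i\<in>S. \<Sum>j\<in>S. \<integral>x. h (x i) * h (x j) \<partial>PM)"
  proof -
    have "(\<integral>x. (\<Sum>j\<in>S. h (x i) * h (x j)) \<partial>PM) = (\<Sum>j\<in>S. \<integral>x. h (x i) * h (x j) \<partial>PM)" if "i \<in> S" for i
      by (rule Bochner_Integration.integral_sum) (use that S in \<open>intro int2; blast\<close>)
    moreover have "(\<integral>x. (\<Sum>i\<in>S. \<Sum>j\<in>S. h (x i) * h (x j)) \<partial>PM) = (\<Sum>i\<in>S. \<integral>x. (\<Sum>j\<in>S. h (x i) * h (x j)) \<partial>PM)"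
      by (intro Bochner_Integration.integral_sum Bochner_Integration.integrable_sum) (use S in \<open>intro int2; blast\<close>)
    ultimately show ?thesis by simp
  qed
  also have "\<dots> \<le> (\<Sum>i\<in>S. \<Sum>j\<in>S. if i = j then 1 else 0)"
  proof (intro sum_mono)
    fix i j assume ij: "i \<in> S" "j \<in> S"
    show "(\<integral>x. h (x i) * h (x j) \<partial>PM) \<le> (if i = j then 1 else 0)"
    proof (cases "i = j")
      case True
      have "(\<integral>x. h (x i) * h (x j) \<partial>PM) \<le> (\<integral>x. 1 \<partial>PM)"
      proof (rule integral_mono)
        fix x assume "x \<in> space PM"
        then have "\<bar>h (x i) * h (x j)\<bar> \<le> 1" using le ij S unfolding abs_mult by (intro mult_le_one) auto
        then show "h (x i) * h (x j) \<le> 1" by simp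
      next
        show "integrable PM (\<lambda>x. h (x i) * h (x j))" using ij S by (intro int2; blast)
      qed simp
      then show ?thesis using True by (simp add: prob_space.prob_space[OF prob_PM])
    next
      case False
      moreover have "i \<in> {1..n}" "j \<in> {1..n}" using ij S by blast+
      ultimately show ?thesis using integral_product_coordinates[OF int h(3)] by simp
    qed
  qed
  also have "\<dots> = real (card S)" using fin by (simp add: sum.delta)
  finally show ?thesis .
qed

lemma first_moment:
  fixes h :: "real \<Rightarrow> real"
  assumes h: "h \<in> borel_measurable \<mu>" "\<And>a. a \<in> space \<mu> \<Longrightarrow> \<bar>h a\<bar> \<le> 1" "(\<integral>a. h a \<partial>\<mu>) = 0"
    and S: "S \<subseteq> {1..n}"
  shows "(\<integral>x. \<bar>(\<Sum>j\<in>S. h (x j)) / real n\<bar> \<partial>PM) \<le> 1 / sqrt (real n)"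
proof -
  have le: "\<bar>h (x i)\<bar> \<le> 1" if "x \<in> space PM" "i \<in> {1..n}" for x i
    using that h(2) by (auto simp: space_PiM PiE_iff)
  have c: "card S \<le> n" using card_mono[OF _ S] by simp
  have bd: "\<bar>\<Sum>j\<in>S. h (x j)\<bar> \<le> real n" if "x \<in> space PM" for x
  proof -
    have "\<bar>\<Sum>j\<in>S. h (x j)\<bar> \<le> (\<Sum>j\<in>S. \<bar>h (x j)\<bar>)" by (rule sum_abs)
    also have "\<dots> \<le> (\<Sum>j\<in>S. 1)" using le[OF that] S by (intro sum_mono) auto
    finally show ?thesis using c by simp
  qed
  have m: "(\<lambda>x. \<Sum>j\<in>S. h (x j)) \<in> borel_measurable PM"
    using h(1) S by (intro borel_measurable_sum measurable_coordinate) auto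
  note [measurable] = m
  have sq: "integrable PM (\<lambda>x. (\<Sum>j\<in>S. h (x j))\<^sup>2)"
  proof (rule PM_integrable[where B="(real n)\<^sup>2"])
    show "AE x in PM. norm ((\<Sum>j\<in>S. h (x j))\<^sup>2) \<le> (real n)\<^sup>2"
      using bd by (intro AE_I2) (simp add: power2_le_iff_abs_le)
  qed measurable
  have "(\<integral>x. \<bar>(\<Sum>j\<in>S. h (x j)) / real n\<bar> \<partial>PM)
    \<le> (\<integral>x. sqrt (real n) / (2 * (real n)\<^sup>2) * (\<Sum>j\<in>S. h (x j))\<^sup>2 + 1 / (2 * sqrt (real n)) \<partial>PM)"
  proof (rule integral_mono)
    show "integrable PM (\<lambda>x. \<bar>(\<Sum>j\<in>S. h (x j)) / real n\<bar>)"
    proof (rule PM_integrable[where B=1])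
      show "AE x in PM. norm \<bar>(\<Sum>j\<in>S. h (x j)) / real n\<bar> \<le> 1"
        using bd n by (intro AE_I2) auto
    qed measurable
    show "integrable PM (\<lambda>x. sqrt (real n) / (2 * (real n)\<^sup>2) * (\<Sum>j\<in>S. h (x j))\<^sup>2 + 1 / (2 * sqrt (real n)))"
      by (intro Bochner_Integration.integrable_add integrable_mult_right sq PM_const)
    fix x
    show "\<bar>(\<Sum>j\<in>S. h (x j)) / real n\<bar>
      \<le> sqrt (real n) / (2 * (real n)\<^sup>2) * (\<Sum>j\<in>S. h (x j))\<^sup>2 + 1 / (2 * sqrt (real n))"
      using abs_le_weighted_square[of "real n" "(\<Sum>j\<in>S. h (x j)) / real n"] n
      by (simp add: power_divide add_divide_distrib mult.commute)
  qed
  also have "\<dots> = sqrt (real n) / (2 * (real n)\<^sup>2) * (\<integral>x. (\<Sum>j\<in>S. h (x j))\<^sup>2 \<partial>PM) + 1 / (2 * sqrt (real n))"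
    using sq by (simp add: prob_space.prob_space[OF prob_PM])
  also have "\<dots> \<le> sqrt (real n) / (2 * (real n)\<^sup>2) * real n + 1 / (2 * sqrt (real n))"
    using second_moment[OF h S] c by (intro add_mono mult_left_mono) auto
  also have "\<dots> = 1 / sqrt (real n)"
  proof -
    have "0 < sqrt (real n)" using n by simp
    then show ?thesis by (simp add: power2_eq_square field_simps)
  qed
  finally show ?thesis .
qed

end
text \<open>The functions \<phi> and \<psi> stand for continuous substitutes of the indicators of
  \<open>J\<close> and \<open>U\<close>, since test functions of the martingale problem must be
  continuous.\<close>

definition sample_fun :: "(real \<Rightarrow> real \<Rightarrow> real) \<Rightarrow> (real \<Rightarrow> real) \<Rightarrow> (real \<Rightarrow> real) \<Rightarrow> nat \<Rightarrow> (nat \<Rightarrow> real) \<Rightarrow> real" where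
  "sample_fun F \<phi> \<psi> n x = F ((\<Sum>i\<in>{1..n}. \<phi> (x i)) / real n) ((\<Sum>i\<in>{1..n}. \<psi> (x i)) / real n)"

lemma average_01:
  fixes \<phi> :: "real \<Rightarrow> real"
  assumes "\<And>a. 0 \<le> \<phi> a" "\<And>a. \<phi> a \<le> 1" "k \<le> n" "card S = n - k" "1 \<le> n"
  shows "(real k * \<phi> a + (\<Sum>j\<in>S. \<phi> (x j))) / real n \<in> {0..1}"
proof -
  have "0 \<le> (\<Sum>j\<in>S. \<phi> (x j))" using assms by (intro sum_nonneg) auto
  moreover have "(\<Sum>j\<in>S. \<phi> (x j)) \<le> (\<Sum>j\<in>S. 1)" using assms by (intro sum_mono) auto
  moreover have "0 \<le> real k * \<phi> a" "real k * \<phi> a \<le> real k * 1"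
    by (rule mult_nonneg_nonneg mult_left_mono; use assms in simp)+
  ultimately show ?thesis using assms by (simp add: field_simps of_nat_diff)
qed

lemma average_01':
  fixes \<phi> :: "real \<Rightarrow> real"
  assumes "\<And>a. 0 \<le> \<phi> a" "\<And>a. \<phi> a \<le> 1" "1 \<le> n"
  shows "(\<Sum>j\<in>{1..n}. \<phi> (x j)) / real n \<in> {0..1}"
  using average_01[of \<phi> 0 n "{1..n}" 0 x] assms by simp

context M1_point begin

text \<open>\<open>A\<close> is an empirical average in which the sample \<open>m\<close> is counted
  \<open>k\<close> more times, and \<open>B\<close> is its limit given that sample. The error has
  two sources: replacing \<phi> by the indicator costs \<open>e\<close>, and averaging the centered
  indicators over \<open>S\<close> costs \<open>1 / sqrt n\<close>. The index \<open>m\<close> may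
  lie in \<open>S\<close>, which occurs for \<open>k = 0\<close>.\<close>

lemma coordinate_error:
  fixes \<phi> :: "real \<Rightarrow> real"
  assumes J: "J \<in> sets \<mu>"
    and \<phi>: "\<phi> \<in> borel_measurable \<mu>" "\<And>a. 0 \<le> \<phi> a" "\<And>a. \<phi> a \<le> 1"
    and e: "(\<integral>a. \<bar>\<phi> a - indicator J a\<bar> \<partial>\<mu>) \<le> e"
    and mS: "m \<in> {1..n}" "S \<subseteq> {1..n}" "k \<le> n" "card S = n - k"
  defines "A \<equiv> \<lambda>x. (real k * \<phi> (x m) + (\<Sum>j\<in>S. \<phi> (x j))) / real n"
    and "B \<equiv> \<lambda>a. real k / real n * indicator J a + (1 - real k / real n) * measure \<mu> J"
  shows "integrable PM (\<lambda>x. \<bar>A x - B (x m)\<bar>)" "(\<integral>x. \<bar>A x - B (x m)\<bar> \<partial>PM) \<le> e + 1 / sqrt (real n)"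
    "A \<in> borel_measurable PM" "(\<lambda>x. B (x m)) \<in> borel_measurable PM"
    "\<And>x. A x \<in> {0..1}" "\<And>a. B a \<in> {0..1}"
proof -
  define y where "y = real k / real n"
  have n0: "0 < real n" using n by simp
  have y: "0 \<le> y" "y \<le> 1" using mS n0 by (auto simp: y_def)
  have b: "0 \<le> measure \<mu> J" "measure \<mu> J \<le> 1" by (auto simp: prob_le_1)
  show A01: "A x \<in> {0..1}" for x unfolding A_def using \<phi>(2,3) mS n by (intro average_01) auto
  show B01: "B a \<in> {0..1}" for a
    using convex_01[of y "measure \<mu> J"] y b unfolding B_def y_def[symmetric] by (auto simp: indicator_def add.commute)
  note [measurable] = J \<phi>(1)
  have c [measurable]: "(\<lambda>x. h (x j)) \<in> borel_measurable PM" if "h \<in> borel_measurable \<mu>" "j \<in> insert m S" for h :: "real \<Rightarrow> real" and j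
    using that mS by (intro measurable_coordinate) auto
  show mA: "A \<in> borel_measurable PM"
    unfolding A_def using \<phi>(1) by (intro borel_measurable_divide borel_measurable_add borel_measurable_times borel_measurable_sum c) auto
  have "B \<in> borel_measurable \<mu>" unfolding B_def by measurable
  then show mB: "(\<lambda>x. B (x m)) \<in> borel_measurable PM" by (rule c) simp
  show i: "integrable PM (\<lambda>x. \<bar>A x - B (x m)\<bar>)"
  proof (rule PM_integrable[where B=1])
    show "AE x in PM. norm \<bar>A x - B (x m)\<bar> \<le> 1"
    proof (rule AE_I2)
      fix x show "norm \<bar>A x - B (x m)\<bar> \<le> 1" using A01[of x] B01[of "x m"] by (auto simp: abs_le_iff)
    qed
    show "(\<lambda>x. \<bar>A x - B (x m)\<bar>) \<in> borel_measurable PM" using mA mB by measurable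
  qed
  define d where "d = (\<lambda>a. \<bar>\<phi> a - indicator J a\<bar>)"
  define h where "h = (\<lambda>a. indicator J a - measure \<mu> J)"
  have d: "d \<in> borel_measurable \<mu>" "0 \<le> d a" "d a \<le> 1" for a
    using \<phi>(2)[of a] \<phi>(3)[of a] by (auto simp: d_def indicator_def)
  have h: "h \<in> borel_measurable \<mu>" "\<bar>h a\<bar> \<le> 1" "(\<integral>a. h a \<partial>\<mu>) = 0" for a
  proof -
    show "h \<in> borel_measurable \<mu>" unfolding h_def by measurable
    show "\<bar>h a\<bar> \<le> 1" using b by (auto simp: h_def indicator_def)
    have "(\<integral>a. h a \<partial>\<mu>) = (\<integral>a. indicator J a \<partial>\<mu>) - (\<integral>a. measure \<mu> J \<partial>\<mu>)"
      unfolding h_def using J by (intro Bochner_Integration.integral_diff) (auto simp: emeasure_eq_measure)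
    then show "(\<integral>a. h a \<partial>\<mu>) = 0" using J by (simp add: prob_space)
  qed
  have di: "integrable PM (\<lambda>x. d (x j))" if "j \<in> {1..n}" for j
  proof (rule PM_integrable[where B=1])
    show "(\<lambda>x. d (x j)) \<in> borel_measurable PM" by (rule measurable_coordinate[OF d(1) that])
    show "AE x in PM. norm (d (x j)) \<le> 1"
    proof (rule AE_I2)
      fix x show "norm (d (x j)) \<le> 1" using d(2)[of "x j"] d(3)[of "x j"] by simp
    qed
  qed
  have hi: "integrable PM (\<lambda>x. \<bar>(\<Sum>j\<in>S. h (x j)) / real n\<bar>)"
  proof (rule PM_integrable[where B=1])
    show "(\<lambda>x. \<bar>(\<Sum>j\<in>S. h (x j)) / real n\<bar>) \<in> borel_measurable PM"
    proof -
      have "(\<lambda>x. \<Sum>j\<in>S. h (x j)) \<in> borel_measurable PM"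
        by (rule borel_measurable_sum) (rule c[OF h(1)], simp)
      then show ?thesis by measurable
    qed
    show "AE x in PM. norm \<bar>(\<Sum>j\<in>S. h (x j)) / real n\<bar> \<le> 1"
    proof (rule AE_I2)
      fix x
      have "\<bar>\<Sum>j\<in>S. h (x j)\<bar> \<le> (\<Sum>j\<in>S. 1)" by (rule order_trans[OF sum_abs sum_mono]) (rule h)
      then show "norm \<bar>(\<Sum>j\<in>S. h (x j)) / real n\<bar> \<le> 1" using mS n0 by simp
    qed
  qed
  define E where "E = (\<lambda>x. y * d (x m) + (\<Sum>j\<in>S. d (x j)) / real n + \<bar>(\<Sum>j\<in>S. h (x j)) / real n\<bar>)"
  have ds: "integrable PM (\<lambda>x. \<Sum>j\<in>S. d (x j))"
    by (rule Bochner_Integration.integrable_sum) (rule di, use mS in blast)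
  have s: "integrable PM (\<lambda>x. (\<Sum>j\<in>S. d (x j)) / real n)" "integrable PM (\<lambda>x. y * d (x m))"
    by (rule integrable_divide, rule ds) (rule integrable_mult_right, rule di, rule mS)
  have Ei: "integrable PM E"
    unfolding E_def by (intro Bochner_Integration.integrable_add s hi)
  have "(\<integral>x. \<bar>A x - B (x m)\<bar> \<partial>PM) \<le> (\<integral>x. E x \<partial>PM)"
  proof (rule integral_mono[OF i Ei])
    fix x
    have "real (card S) = real n - real k" using mS by (simp add: of_nat_diff)
    then have "1 - y = real (card S) / real n" using n0 by (simp add: y_def field_simps)
    then have "(1 - y) * measure \<mu> J = (\<Sum>j\<in>S. measure \<mu> J) / real n" by simp
    then have "A x - B (x m) = y * (\<phi> (x m) - indicator J (x m)) + (\<Sum>j\<in>S. \<phi> (x j) - indicator J (x j)) / real n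
        + (\<Sum>j\<in>S. h (x j)) / real n"
      unfolding A_def B_def h_def y_def[symmetric]
      by (simp add: sum_subtractf add_divide_distrib diff_divide_distrib algebra_simps y_def)
    also have "\<bar>\<dots>\<bar> \<le> \<bar>y * (\<phi> (x m) - indicator J (x m))\<bar> + \<bar>(\<Sum>j\<in>S. \<phi> (x j) - indicator J (x j)) / real n\<bar>
        + \<bar>(\<Sum>j\<in>S. h (x j)) / real n\<bar>" by linarith
    also have "\<bar>y * (\<phi> (x m) - indicator J (x m))\<bar> = y * d (x m)" using y by (simp add: d_def abs_mult)
    also have "\<bar>(\<Sum>j\<in>S. \<phi> (x j) - indicator J (x j)) / real n\<bar> \<le> (\<Sum>j\<in>S. d (x j)) / real n"
      unfolding d_def abs_divide using n0 by (auto intro!: divide_right_mono sum_abs)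
    finally show "\<bar>A x - B (x m)\<bar> \<le> E x" by (simp add: E_def)
  qed
  also have "(\<integral>x. E x \<partial>PM) = y * (\<integral>a. d a \<partial>\<mu>) + (\<Sum>j\<in>S. \<integral>a. d a \<partial>\<mu>) / real n + (\<integral>x. \<bar>(\<Sum>j\<in>S. h (x j)) / real n\<bar> \<partial>PM)"
  proof -
    have "(\<integral>x. (\<Sum>j\<in>S. d (x j)) \<partial>PM) = (\<Sum>j\<in>S. \<integral>x. d (x j) \<partial>PM)"
      by (rule Bochner_Integration.integral_sum) (rule di, use mS in blast)
    also have "\<dots> = (\<Sum>j\<in>S. \<integral>a. d a \<partial>\<mu>)"
      by (intro sum.cong refl integral_coordinate[OF d(1)]) (use mS in blast)
    finally show ?thesis
      unfolding E_def Bochner_Integration.integral_add[OF Bochner_Integration.integrable_add[OF s(2,1)] hi]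
        Bochner_Integration.integral_add[OF s(2,1)]
      by (simp only: integral_mult_right_zero integral_divide_zero integral_coordinate[OF d(1) mS(1)])
  qed
  also have "\<dots> \<le> y * e + (\<Sum>j\<in>S. e) / real n + 1 / sqrt (real n)"
    by (intro add_mono mult_left_mono divide_right_mono sum_mono e[folded d_def] y first_moment[OF h(1,2,3) mS(2)]) simp
  also have "\<dots> = e + 1 / sqrt (real n)"
    using mS n0 by (simp add: y_def of_nat_diff field_simps)
  finally show "(\<integral>x. \<bar>A x - B (x m)\<bar> \<partial>PM) \<le> e + 1 / sqrt (real n)" .
qed

end

section \<open>Comparison of the sampled generator with the two-mass generator\<close>

locale two_type_sample = M1_point +
  fixes F :: "real \<Rightarrow> real \<Rightarrow> real" and L :: real and J U :: "real set" and \<phi> \<psi> :: "real \<Rightarrow> real" and e :: real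
  assumes F: "lip01 L F" and JU: "J \<in> sets \<mu>" "U \<in> sets \<mu>" "J \<subseteq> U"
    and \<phi>: "\<phi> \<in> borel_measurable \<mu>" "\<And>a. 0 \<le> \<phi> a" "\<And>a. \<phi> a \<le> 1"
    and \<psi>: "\<psi> \<in> borel_measurable \<mu>" "\<And>a. 0 \<le> \<psi> a" "\<And>a. \<psi> a \<le> 1"
    and e: "(\<integral>a. \<bar>\<phi> a - indicator J a\<bar> \<partial>\<mu>) \<le> e" "(\<integral>a. \<bar>\<psi> a - indicator U a\<bar> \<partial>\<mu>) \<le> e"
begin

abbreviation f where "f \<equiv> sample_fun F \<phi> \<psi> n"
abbreviation b where "b \<equiv> measure \<mu> J"
abbreviation u where "u \<equiv> measure \<mu> U"

lemma L_nonneg: "0 \<le> L" using F by (simp add: lip01_def)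

lemma bu: "0 \<le> b" "b \<le> u" "u \<le> 1"
  using JU by (auto intro: finite_measure_mono prob_le_1)

text \<open>Given the parent \<open>x m\<close>, both averages are nearly deterministic; averaging
  \<open>F\<close> over the type of the parent then gives \<open>two_type_mean\<close> at the size
  \<open>k / n\<close>.\<close>

lemma sampling_error:
  assumes mS: "m \<in> {1..n}" "S \<subseteq> {1..n}" "k \<le> n" "card S = n - k"
  shows "\<bar>(\<integral>x. F ((real k * \<phi> (x m) + (\<Sum>j\<in>S. \<phi> (x j))) / real n) ((real k * \<psi> (x m) + (\<Sum>j\<in>S. \<psi> (x j))) / real n) \<partial>PM)
     - two_type_mean F b u (real k / real n)\<bar> \<le> 2 * L * (e + 1 / sqrt (real n))"
proof -
  define y where "y = real k / real n"
  define A1 where "A1 = (\<lambda>x. (real k * \<phi> (x m) + (\<Sum>j\<in>S. \<phi> (x j))) / real n)"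
  define A2 where "A2 = (\<lambda>x. (real k * \<psi> (x m) + (\<Sum>j\<in>S. \<psi> (x j))) / real n)"
  define B1 where "B1 = (\<lambda>a. real k / real n * indicator J a + (1 - real k / real n) * b)"
  define B2 where "B2 = (\<lambda>a. real k / real n * indicator U a + (1 - real k / real n) * u)"
  have c1: "integrable PM (\<lambda>x. \<bar>A1 x - B1 (x m)\<bar>)" "(\<integral>x. \<bar>A1 x - B1 (x m)\<bar> \<partial>PM) \<le> e + 1 / sqrt (real n)"
    "A1 \<in> borel_measurable PM" "(\<lambda>x. B1 (x m)) \<in> borel_measurable PM" "\<And>x. A1 x \<in> {0..1}" "\<And>a. B1 a \<in> {0..1}"
    unfolding A1_def B1_def by (rule coordinate_error[OF JU(1) \<phi> e(1) mS])+
  have c2: "integrable PM (\<lambda>x. \<bar>A2 x - B2 (x m)\<bar>)" "(\<integral>x. \<bar>A2 x - B2 (x m)\<bar> \<partial>PM) \<le> e + 1 / sqrt (real n)"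
    "A2 \<in> borel_measurable PM" "(\<lambda>x. B2 (x m)) \<in> borel_measurable PM" "\<And>x. A2 x \<in> {0..1}" "\<And>a. B2 a \<in> {0..1}"
    unfolding A2_def B2_def by (rule coordinate_error[OF JU(2) \<psi> e(2) mS])+
  obtain C where C: "\<And>p q. p \<in> {0..1} \<Longrightarrow> q \<in> {0..1} \<Longrightarrow> \<bar>F p q\<bar> \<le> C" using lip01_bounded[OF F] by blast
  note [measurable] = JU
  have iA: "integrable PM (\<lambda>x. F (A1 x) (A2 x))"
    by (rule PM_integrable[OF AE_I2[OF C[OF c1(5) c2(5), folded real_norm_def]]
        lip01_measurable[OF F c1(3) c2(3) c1(5) c2(5)]])
  have iB: "integrable PM (\<lambda>x. F (B1 (x m)) (B2 (x m)))"
    by (rule PM_integrable[OF AE_I2[OF C[OF c1(6) c2(6), folded real_norm_def]]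
        lip01_measurable[OF F c1(4) c2(4) c1(6) c2(6)]])
  have B: "B1 \<in> borel_measurable \<mu>" "B2 \<in> borel_measurable \<mu>" unfolding B1_def B2_def by measurable
  have "(\<integral>x. F (B1 (x m)) (B2 (x m)) \<partial>PM) = (\<integral>a. F (B1 a) (B2 a) \<partial>\<mu>)"
    by (rule integral_coordinate[OF lip01_measurable[OF F B c1(6) c2(6)] mS(1)])
  \<comment> \<open>The three summands are the parents outside \<open>U\<close>, in \<open>J\<close>
    and in \<open>U - J\<close>.\<close>
  also have "\<dots> = (\<integral>a. F ((1 - y) * b) ((1 - y) * u) * (1 - indicator U a) + F ((1 - y) * b + y) ((1 - y) * u + y) * indicator J a
      + F ((1 - y) * b) ((1 - y) * u + y) * (indicator U a - indicator J a) \<partial>\<mu>)"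
    using JU(3) by (intro Bochner_Integration.integral_cong refl)
      (auto simp: B1_def B2_def y_def[symmetric] indicator_def add.commute)
  also have "\<dots> = two_type_mean F b u y"
    using JU by (simp add: two_type_mean_def emeasure_eq_measure prob_space mult.commute)
  finally have eq: "(\<integral>x. F (B1 (x m)) (B2 (x m)) \<partial>PM) = two_type_mean F b u y" .
  have "\<bar>(\<integral>x. F (A1 x) (A2 x) \<partial>PM) - two_type_mean F b u y\<bar> = \<bar>\<integral>x. F (A1 x) (A2 x) - F (B1 (x m)) (B2 (x m)) \<partial>PM\<bar>"
    unfolding eq[symmetric] using iA iB by simp
  also have "\<dots> \<le> (\<integral>x. \<bar>F (A1 x) (A2 x) - F (B1 (x m)) (B2 (x m))\<bar> \<partial>PM)" by (rule integral_abs_bound)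
  also have "\<dots> \<le> (\<integral>x. L * (\<bar>A1 x - B1 (x m)\<bar> + \<bar>A2 x - B2 (x m)\<bar>) \<partial>PM)"
  proof (rule integral_mono)
    show "integrable PM (\<lambda>x. \<bar>F (A1 x) (A2 x) - F (B1 (x m)) (B2 (x m))\<bar>)"
      by (intro integrable_abs Bochner_Integration.integrable_diff iA iB)
    show "integrable PM (\<lambda>x. L * (\<bar>A1 x - B1 (x m)\<bar> + \<bar>A2 x - B2 (x m)\<bar>))"
      by (intro integrable_mult_right Bochner_Integration.integrable_add c1 c2)
    show "\<bar>F (A1 x) (A2 x) - F (B1 (x m)) (B2 (x m))\<bar> \<le> L * (\<bar>A1 x - B1 (x m)\<bar> + \<bar>A2 x - B2 (x m)\<bar>)" for x
      by (rule lip01D[OF F c1(5) c2(5) c1(6) c2(6)])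
  qed
  also have "\<dots> = L * ((\<integral>x. \<bar>A1 x - B1 (x m)\<bar> \<partial>PM) + (\<integral>x. \<bar>A2 x - B2 (x m)\<bar> \<partial>PM))"
    using c1(1) c2(1) by simp
  also have "\<dots> \<le> L * ((e + 1 / sqrt (real n)) + (e + 1 / sqrt (real n)))"
    using c1(2) c2(2) L_nonneg by (intro mult_left_mono add_mono) auto
  also have "\<dots> = 2 * L * (e + 1 / sqrt (real n))" by (simp add: algebra_simps)
  finally show ?thesis unfolding A1_def A2_def y_def .
qed

lemma sample_fun_measurable: "f \<in> borel_measurable PM"
  unfolding sample_fun_def
proof (rule lip01_measurable[OF F])
  show "(\<lambda>x. (\<Sum>i\<in>{1..n}. \<phi> (x i)) / real n) \<in> borel_measurable PM" "(\<lambda>x. (\<Sum>i\<in>{1..n}. \<psi> (x i)) / real n) \<in> borel_measurable PM"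
    by (rule borel_measurable_divide borel_measurable_sum measurable_coordinate \<phi> \<psi> borel_measurable_const | assumption)+
  show "(\<Sum>i\<in>{1..n}. \<phi> (x i)) / real n \<in> {0..1}" "(\<Sum>i\<in>{1..n}. \<psi> (x i)) / real n \<in> {0..1}" for x
    by (rule average_01'; rule \<phi> \<psi> n)+
qed

lemma sample_fun_integrable: "integrable PM f"
proof -
  obtain C where C: "\<And>p q. p \<in> {0..1} \<Longrightarrow> q \<in> {0..1} \<Longrightarrow> \<bar>F p q\<bar> \<le> C" using lip01_bounded[OF F] by blast
  show ?thesis
  proof (rule PM_integrable[OF _ sample_fun_measurable, where B=C], rule AE_I2)
    fix x
    show "norm (f x) \<le> C"
      unfolding sample_fun_def real_norm_def by (rule C; rule average_01'; rule \<phi> \<psi> n)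
  qed
qed

lemma FV_poly_error: "\<bar>FV_poly n f \<mu> - F b u\<bar> \<le> 2 * L * (e + 1 / sqrt (real n))"
  \<comment> \<open>No coordinate is hit: \<open>k = 0\<close>, all samples are in \<open>S\<close>,
    and the parent index 1 has weight 0.\<close>
  using sampling_error[of 1 "{1..n}" 0] n by (simp add: FV_poly_def sample_fun_def two_type_mean_0)

definition D where "D K = (\<integral>x. f (FV_R n K x) - f x \<partial>PM)"

lemma sample_fun_FV_R:
  assumes K: "K \<subseteq> {1..n}" "K \<noteq> {}"
  shows "f (FV_R n K x) = F ((real (card K) * \<phi> (x (Min K)) + (\<Sum>j\<in>{1..n - card K + 1} - {Min K}. \<phi> (x j))) / real n)
     ((real (card K) * \<psi> (x (Min K)) + (\<Sum>j\<in>{1..n - card K + 1} - {Min K}. \<psi> (x j))) / real n)"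
  unfolding sample_fun_def FV_R_sum[OF K] ..

lemma FV_R_integrable:
  assumes K: "K \<subseteq> {1..n}" "K \<noteq> {}"
  shows "integrable PM (\<lambda>x. f (FV_R n K x))"
proof -
  obtain C where C: "\<And>p q. p \<in> {0..1} \<Longrightarrow> q \<in> {0..1} \<Longrightarrow> \<bar>F p q\<bar> \<le> C" using lip01_bounded[OF F] by blast
  show ?thesis
  proof (rule PM_integrable[where B=C])
    show "(\<lambda>x. f (FV_R n K x)) \<in> borel_measurable PM"
      by (rule measurable_compose[OF FV_R_measurable[OF K] sample_fun_measurable])
    show "AE x in PM. norm (f (FV_R n K x)) \<le> C"
      unfolding sample_fun_FV_R[OF K] real_norm_def using Min_card_bounds[OF K] \<phi> \<psi> n
      by (intro AE_I2 C average_01) (auto simp only: \<phi> \<psi>)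
  qed
qed

text \<open>The error is counted twice, once for the function after the merger and once for the
  function before it.\<close>

lemma D_error:
  assumes K: "K \<subseteq> {1..n}" "K \<noteq> {}"
  shows "\<bar>D K - (two_type_mean F b u (real (card K) / real n) - F b u)\<bar> \<le> 4 * L * (e + 1 / sqrt (real n))"
proof -
  note mb = Min_card_bounds[OF K]
  have "\<bar>(\<integral>x. f (FV_R n K x) \<partial>PM) - two_type_mean F b u (real (card K) / real n)\<bar> \<le> 2 * L * (e + 1 / sqrt (real n))"
    unfolding sample_fun_FV_R[OF K] using mb by (intro sampling_error) auto
  moreover have "D K = (\<integral>x. f (FV_R n K x) \<partial>PM) - FV_poly n f \<mu>"
    unfolding D_def FV_poly_def using FV_R_integrable[OF K] sample_fun_integrable by simp
  ultimately show ?thesis using FV_poly_error by linarith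
qed

text \<open>In the two averages \<open>card K\<close> of the \<open>n\<close> samples are replaced,
  so each moves by at most \<open>card K / n\<close>. In contrast to the sampling error this is
  proportional to the fraction hit, which yields an integrable bound even when \<nu> is
  infinite.\<close>

lemma D_bound:
  assumes K: "K \<subseteq> {1..n}" "K \<noteq> {}"
  shows "\<bar>D K\<bar> \<le> 2 * L * (real (card K) / real n)"
proof -
  note mb = Min_card_bounds[OF K]
  let ?S = "{1..n - card K + 1} - {Min K}"
  have n0: "0 < real n" using n by simp
  have diff: "\<bar>(real (card K) * h (x (Min K)) + (\<Sum>j\<in>?S. h (x j))) / real n - (\<Sum>i\<in>{1..n}. h (x i)) / real n\<bar>
      \<le> real (card K) / real n" if "\<And>a. 0 \<le> h a" "\<And>a. h a \<le> 1" for h :: "real \<Rightarrow> real" and x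
  proof -
    have "(\<Sum>i\<in>{1..n}. h (x i)) = (\<Sum>i\<in>{1..n} - ?S. h (x i)) + (\<Sum>i\<in>?S. h (x i))"
      using mb(5) by (intro sum.subset_diff) auto
    moreover have "0 \<le> (\<Sum>i\<in>{1..n} - ?S. h (x i))" using that by (intro sum_nonneg) auto
    moreover have "(\<Sum>i\<in>{1..n} - ?S. h (x i)) \<le> real (card K)"
    proof -
      have "(\<Sum>i\<in>{1..n} - ?S. h (x i)) \<le> (\<Sum>i\<in>{1..n} - ?S. 1)" using that by (intro sum_mono) auto
      also have "\<dots> = real (n - card ?S)"
      proof -
        have "?S \<subseteq> {1..n}" using mb(5) by blast
        then have "card ({1..n} - ?S) = card {1..n} - card ?S" by (intro card_Diff_subset) auto
        then show ?thesis by simp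
      qed
      also have "\<dots> = real (card K)" using mb by simp
      finally show ?thesis .
    qed
    moreover have "0 \<le> real (card K) * h (x (Min K))" "real (card K) * h (x (Min K)) \<le> real (card K) * 1"
      by (rule mult_nonneg_nonneg mult_left_mono; use that in simp)+
    ultimately have "\<bar>(real (card K) * h (x (Min K)) + (\<Sum>j\<in>?S. h (x j))) - (\<Sum>i\<in>{1..n}. h (x i))\<bar> \<le> real (card K)"
      by linarith
    then show ?thesis using n0 by (simp add: diff_divide_distrib[symmetric] divide_right_mono)
  qed
  have "\<bar>D K\<bar> \<le> (\<integral>x. \<bar>f (FV_R n K x) - f x\<bar> \<partial>PM)" unfolding D_def by (rule integral_abs_bound)
  also have "\<dots> \<le> (\<integral>x. 2 * L * (real (card K) / real n) \<partial>PM)"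
  proof (rule integral_mono)
    show "integrable PM (\<lambda>x. \<bar>f (FV_R n K x) - f x\<bar>)"
      using FV_R_integrable[OF K] sample_fun_integrable by simp
    fix x
    have "\<bar>f (FV_R n K x) - f x\<bar> \<le> L * (real (card K) / real n + real (card K) / real n)"
      unfolding sample_fun_FV_R[OF K] unfolding sample_fun_def
    proof (rule order_trans[OF lip01D[OF F]])
      show "(\<Sum>i\<in>{1..n}. \<phi> (x i)) / real n \<in> {0..1}" "(\<Sum>i\<in>{1..n}. \<psi> (x i)) / real n \<in> {0..1}"
        by (rule average_01'; rule \<phi> \<psi> n)+
      show "(real (card K) * \<phi> (x (Min K)) + (\<Sum>j\<in>?S. \<phi> (x j))) / real n \<in> {0..1}"
        "(real (card K) * \<psi> (x (Min K)) + (\<Sum>j\<in>?S. \<psi> (x j))) / real n \<in> {0..1}"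
        by (rule average_01; rule \<phi> \<psi> n mb)+
    qed (intro mult_left_mono add_mono diff \<phi> \<psi> L_nonneg)
    also have "\<dots> = 2 * L * (real (card K) / real n)" by (simp add: algebra_simps)
    finally show "\<bar>f (FV_R n K x) - f x\<bar> \<le> 2 * L * (real (card K) / real n)" .
  qed (rule PM_const)
  finally show ?thesis by (simp only: PM_const)
qed

text \<open>The expected increment when each coordinate is hit independently with probability
  \<open>x\<close>. Hits of fewer than two coordinates are left out, as in the generator.\<close>

definition Q where "Q x = (\<Sum>K | K \<subseteq> {1..n} \<and> 2 \<le> card K. wt n x K * D K)"

text \<open>The mean fraction of coordinates hit is \<open>x\<close>, so the bounds on
  \<open>D\<close> add up to one of order \<open>x\<close> that does not depend on
  \<open>n\<close>.\<close>

lemma Q_bound: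
  assumes x: "0 \<le> x" "x \<le> 1"
  shows "\<bar>Q x\<bar> \<le> 2 * L * x"
proof -
  have n0: "0 < real n" using n by simp
  have "\<bar>Q x\<bar> \<le> (\<Sum>K | K \<subseteq> {1..n} \<and> 2 \<le> card K. \<bar>wt n x K * D K\<bar>)" unfolding Q_def by (rule sum_abs)
  also have "\<dots> \<le> (\<Sum>K | K \<subseteq> {1..n} \<and> 2 \<le> card K. wt n x K * (2 * L * (real (card K) / real n)))"
  proof (rule sum_mono)
    fix K assume "K \<in> {K. K \<subseteq> {1..n} \<and> 2 \<le> card K}"
    then have "K \<subseteq> {1..n}" "K \<noteq> {}" by auto
    then have "wt n x K * \<bar>D K\<bar> \<le> wt n x K * (2 * L * (real (card K) / real n))"
      by (intro mult_left_mono D_bound wt_nonneg x)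
    then show "\<bar>wt n x K * D K\<bar> \<le> wt n x K * (2 * L * (real (card K) / real n))"
      using wt_nonneg[OF x, of n K] by (simp only: abs_mult abs_of_nonneg)
  qed
  also have "\<dots> \<le> (\<Sum>K\<in>Pow {1..n}. wt n x K * (2 * L * (real (card K) / real n)))"
    using wt_nonneg[OF x] L_nonneg by (intro sum_mono2) auto
  also have "\<dots> = 2 * L / real n * (\<Sum>K\<in>Pow {1..n}. wt n x K * real (card K))"
    unfolding sum_distrib_left by (intro sum.cong) auto
  also have "\<dots> = 2 * L * x" using n0 unfolding sum_wt_card by simp
  finally show ?thesis .
qed

text \<open>Three errors add up: that of sampling for each \<open>K\<close>, the deviation of
  \<open>card K / n\<close> from \<open>x\<close>, and the missing sets with at most one
  element.\<close>

lemma Q_error: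
  assumes x: "0 \<le> x" "x \<le> 1"
  shows "\<bar>Q x - (two_type_mean F b u x - F b u)\<bar> \<le> 8 * L * (e + 1 / sqrt (real n))"
proof -
  define T where "T = two_type_mean F b u"
  define s where "s = 1 / sqrt (real n)"
  \<comment> \<open>Sets with at most one element get the value 0. This costs at most
    \<open>2 * L / n\<close>, because for them the fraction hit is at most
    \<open>1 / n\<close>.\<close>
  define D' where "D' = (\<lambda>K. if 2 \<le> card K then D K else 0)"
  have n0: "0 < real n" using n by simp
  have s: "1 / real n \<le> s"
    unfolding s_def using n0 n by (intro divide_left_mono) (auto simp: real_le_lsqrt power2_eq_square)
  have e0: "0 \<le> e" by (rule order_trans[OF _ e(1)]) simp
  have Q: "Q x = (\<Sum>K\<in>Pow {1..n}. wt n x K * D' K)"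
    unfolding Q_def D'_def by (intro sum.mono_neutral_cong_left) auto
  have "Q x - (T x - F b u) = (\<Sum>K\<in>Pow {1..n}. wt n x K * (D' K - (T x - F b u)))"
    unfolding right_diff_distrib sum_subtractf Q sum_distrib_right[symmetric] sum_wt_1 by simp
  also have "\<bar>\<dots>\<bar> \<le> (\<Sum>K\<in>Pow {1..n}. \<bar>wt n x K * (D' K - (T x - F b u))\<bar>)" by (rule sum_abs)
  also have "\<dots> \<le> (\<Sum>K\<in>Pow {1..n}. wt n x K * (4 * L * (e + s) + 2 * L * s) + 2 * L * (wt n x K * \<bar>real (card K) / real n - x\<bar>))"
  proof (rule sum_mono)
    fix K assume K: "K \<in> Pow {1..n}"
    define y where "y = real (card K) / real n"
    have "card K \<le> n" using K card_mono[of "{1..n}" K] by simp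
    then have y: "y \<in> {0..1}" using n0 by (simp add: y_def)
    have T: "\<bar>T y - T x\<bar> \<le> 2 * L * \<bar>y - x\<bar>"
      unfolding T_def using two_type_mean_lipschitz[OF F bu y] x by simp
    have L0: "0 \<le> L * e" "0 \<le> L * s" using L_nonneg e0 n0 by (auto simp: s_def)
    have "\<bar>D' K - (T y - F b u)\<bar> \<le> 4 * L * (e + s) + 2 * L * s"
    proof (cases "2 \<le> card K")
      case True
      then have "K \<noteq> {}" by auto
      then show ?thesis using D_error[of K] K True L0 by (simp add: D'_def T_def y_def s_def)
    next
      case False
      have "\<bar>T y - F b u\<bar> \<le> 2 * L * \<bar>y - 0\<bar>"
        using two_type_mean_lipschitz[OF F bu y, of 0] by (simp add: T_def two_type_mean_0)
      also have "\<bar>y - 0\<bar> \<le> 1 / real n" using False n0 by (simp add: y_def divide_right_mono)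
      also note s
      finally have "\<bar>T y - F b u\<bar> \<le> 2 * L * s" using L_nonneg by (simp add: mult_left_mono)
      then show ?thesis using False L0 by (simp add: D'_def abs_minus_commute algebra_simps)
    qed
    then have "\<bar>D' K - (T x - F b u)\<bar> \<le> (4 * L * (e + s) + 2 * L * s) + 2 * L * \<bar>y - x\<bar>" using T by linarith
    then have *: "wt n x K * \<bar>D' K - (T x - F b u)\<bar> \<le> wt n x K * ((4 * L * (e + s) + 2 * L * s) + 2 * L * \<bar>y - x\<bar>)"
      using wt_nonneg[OF x] by (intro mult_left_mono)
    then show "\<bar>wt n x K * (D' K - (T x - F b u))\<bar>
      \<le> wt n x K * (4 * L * (e + s) + 2 * L * s) + 2 * L * (wt n x K * \<bar>real (card K) / real n - x\<bar>)"
    proof -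
      have "w * (a + 2 * L * z) = w * a + 2 * L * (w * z)" for w a z :: real by (simp add: algebra_simps)
      then show ?thesis using * wt_nonneg[OF x, of n K] by (simp only: abs_mult abs_of_nonneg y_def)
    qed
  qed
  also have "\<dots> = (4 * L * (e + s) + 2 * L * s) + 2 * L * (\<Sum>K\<in>Pow {1..n}. wt n x K * \<bar>real (card K) / real n - x\<bar>)"
    by (simp only: sum.distrib sum_distrib_right[symmetric] sum_distrib_left[symmetric] sum_wt_1 mult_1_left)
  also have "\<dots> \<le> (4 * L * (e + s) + 2 * L * s) + 2 * L * s"
    unfolding s_def using sum_wt_deviation[OF n x] L_nonneg by (intro add_left_mono mult_left_mono) auto
  also have "\<dots> \<le> 8 * L * (e + s)"
    using mult_nonneg_nonneg[OF L_nonneg e0] by (simp add: algebra_simps)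
  finally show ?thesis by (simp add: T_def s_def)
qed

end
subsection \<open>The generator on functions of two masses\<close>

locale dust_measure =
  fixes \<Lambda> :: "real measure"
  assumes sets_Lambda: "sets \<Lambda> = sets borel01"
    and AE_Lambda: "AE x in \<Lambda>. 0 < x \<and> x < 1"
    and int_id: "integrable (nu \<Lambda>) (\<lambda>x. x)"
    and int_xln: "integrable (nu \<Lambda>) (\<lambda>x. x * ln (1 / x))"
begin

lemma borel_measurable_Lambda:
  fixes f :: "real \<Rightarrow> 'b::topological_space"
  assumes "f \<in> borel_measurable borel"
  shows "f \<in> borel_measurable \<Lambda>"
  using measurable_restrict_space1[OF assms] sets_Lambda measurable_cong_sets by blast

text \<open>The two densities differ only at 0, where one is infinite and the other 0 by convention,
  and 0 is a null set.\<close>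

lemma nu_eq_density: "nu \<Lambda> = density \<Lambda> (\<lambda>x. ennreal (1 / x\<^sup>2))"
  unfolding nu_def
proof (rule density_cong)
  show "(\<lambda>x. 1 / ennreal (x\<^sup>2)) \<in> borel_measurable \<Lambda>" "(\<lambda>x. ennreal (1 / x\<^sup>2)) \<in> borel_measurable \<Lambda>"
    by (rule borel_measurable_Lambda, measurable)+
  show "AE x in \<Lambda>. 1 / ennreal (x\<^sup>2) = ennreal (1 / x\<^sup>2)"
    using AE_Lambda
  proof eventually_elim
    fix x :: real assume "0 < x \<and> x < 1"
    then show "1 / ennreal (x\<^sup>2) = ennreal (1 / x\<^sup>2)"
      using divide_ennreal[of 1 "x\<^sup>2"] by simp
  qed
qed

sublocale jump_measure "nu \<Lambda>"
proof
  show "sets (nu \<Lambda>) = sets borel01" by (simp add: nu_def sets_Lambda)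
  show "AE x in nu \<Lambda>. 0 < x \<and> x < 1"
    unfolding nu_eq_density
    by (subst AE_density) (rule borel_measurable_Lambda, measurable, use AE_Lambda in auto)
qed (fact int_id int_xln)+

lemma integral_nu:
  fixes f :: "real \<Rightarrow> real"
  assumes "f \<in> borel_measurable borel"
  shows "(\<integral>x. f x \<partial>nu \<Lambda>) = (\<integral>x. f x / x\<^sup>2 \<partial>\<Lambda>)"
proof -
  have "(\<lambda>x::real. 1 / x\<^sup>2) \<in> borel_measurable \<Lambda>" by (rule borel_measurable_Lambda) measurable
  then show ?thesis
    unfolding nu_eq_density using assms borel_measurable_Lambda
    by (subst integral_density) (auto simp: mult.commute)
qed

text \<open>The density \<open>1 / x^2\<close> of \<nu> accounts for the exponent
  \<open>card K - 2\<close>; the truncated subtraction is exact for at least two elements.\<close>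

lemma coal_rate_eq:
  assumes "2 \<le> card K"
  shows "coal_rate \<Lambda> n (card K) = (\<integral>x. wt n x K \<partial>nu \<Lambda>)"
proof -
  have "(\<integral>x. wt n x K \<partial>nu \<Lambda>) = (\<integral>x. wt n x K / x\<^sup>2 \<partial>\<Lambda>)"
    unfolding wt_def by (rule integral_nu) measurable
  also have "\<dots> = (\<integral>x. x ^ (card K - 2) * (1 - x) ^ (n - card K) \<partial>\<Lambda>)"
  proof (rule integral_cong_AE)
    show "AE x in \<Lambda>. wt n x K / x\<^sup>2 = x ^ (card K - 2) * (1 - x) ^ (n - card K)"
      using AE_Lambda
    proof eventually_elim
      fix x :: real assume x: "0 < x \<and> x < 1"
      have "card K = card K - 2 + 2" using assms by simp
      then have "x ^ card K = x ^ (card K - 2) * x\<^sup>2" by (metis power_add)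
      then show "wt n x K / x\<^sup>2 = x ^ (card K - 2) * (1 - x) ^ (n - card K)"
        using x by (simp add: wt_def)
    qed
  qed (unfold wt_def, (rule borel_measurable_Lambda, measurable)+)
  finally show ?thesis by (simp add: coal_rate_def)
qed

lemma integrable_wt:
  assumes "2 \<le> card K"
  shows "integrable (nu \<Lambda>) (\<lambda>x. wt n x K)"
proof (rule integrable_bound_id[where C=1])
  show "(\<lambda>x. wt n x K) \<in> borel_measurable borel" unfolding wt_def by measurable
  fix x :: real assume x: "0 < x" "x < 1"
  have "x ^ card K * (1 - x) ^ (n - card K) \<le> x ^ 1 * 1"
    using x assms by (intro mult_mono power_decreasing power_le_one) auto
  then show "\<bar>wt n x K\<bar> \<le> 1 * x" using x by (simp add: wt_def)
qed

end

locale FV_sample = dust_measure \<Lambda> + two_type_sample \<mu> n F L J U \<phi> \<psi> e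
  for \<Lambda> \<mu> n F L J U \<phi> \<psi> e
begin

text \<open>Writing each rate as an integral of \<open>wt\<close> moves the sum over
  \<open>K\<close> inside the integral over sizes, where the limit in \<open>n\<close> can be taken
  size by size.\<close>

lemma FV_gen_eq: "FV_gen \<Lambda> n f \<mu> = (\<integral>x. Q x \<partial>nu \<Lambda>)"
proof -
  have "FV_gen \<Lambda> n f \<mu> = (\<Sum>K | K \<subseteq> {1..n} \<and> 2 \<le> card K. \<integral>x. wt n x K * D K \<partial>nu \<Lambda>)"
    unfolding FV_gen_def D_def[symmetric] by (intro sum.cong refl) (simp add: coal_rate_eq)
  also have "\<dots> = (\<integral>x. Q x \<partial>nu \<Lambda>)"
    unfolding Q_def by (rule Bochner_Integration.integral_sum[symmetric]) (auto intro: integrable_wt)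
  finally show ?thesis .
qed

lemma Q_measurable: "Q \<in> borel_measurable (nu \<Lambda>)"
  unfolding Q_def wt_def by (rule borel_measurable_nu) measurable

lemma FV_gen_bound: "\<bar>FV_gen \<Lambda> n f \<mu>\<bar> \<le> 2 * L * (\<integral>x. x \<partial>nu \<Lambda>)"
proof -
  have "\<bar>FV_gen \<Lambda> n f \<mu>\<bar> \<le> (\<integral>x. \<bar>Q x\<bar> \<partial>nu \<Lambda>)" unfolding FV_gen_eq by (rule integral_abs_bound)
  also have "\<dots> \<le> (\<integral>x. 2 * L * x \<partial>nu \<Lambda>)"
  proof (rule integral_mono_AE')
    show "integrable (nu \<Lambda>) (\<lambda>x. 2 * L * x)" using int_id by simp
    show "AE x in nu \<Lambda>. \<bar>Q x\<bar> \<le> 2 * L * x" using AE_nu by eventually_elim (intro Q_bound, auto)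
    show "AE x in nu \<Lambda>. 0 \<le> 2 * L * x" using AE_nu by eventually_elim (use L_nonneg in simp)
  qed
  finally show ?thesis by simp
qed

end

text \<open>The number of sampled coordinates and the sharpness of the continuous approximations of
  the indicators grow together.\<close>

definition two_type_fun :: "(real \<Rightarrow> real \<Rightarrow> real) \<Rightarrow> real set \<Rightarrow> real set \<Rightarrow> nat \<Rightarrow> (nat \<Rightarrow> real) \<Rightarrow> real" where
  "two_type_fun F J U n = sample_fun F (bump J n) (bump U n) n"

locale two_type_test = dust_measure \<Lambda>
  for \<Lambda> +
  fixes F :: "real \<Rightarrow> real \<Rightarrow> real" and L :: real and J U :: "real set"
  assumes F: "lip01 L F"
    and J: "closed J" "J \<noteq> {}" "J \<subseteq> U" and U: "closed U" "U \<subseteq> {0..1}"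
begin

abbreviation err :: "nat \<Rightarrow> real measure \<Rightarrow> real" where
  "err n \<mu> \<equiv> (\<integral>a. \<bar>bump J n a - indicator J a\<bar> \<partial>\<mu>) + (\<integral>a. \<bar>bump U n a - indicator U a\<bar> \<partial>\<mu>)"

lemma JU: "J \<subseteq> {0..1}" "U \<noteq> {}"
  using J U by auto

lemma sets_JU: "\<mu> \<in> space M1 \<Longrightarrow> J \<in> sets \<mu>" "\<mu> \<in> space M1 \<Longrightarrow> U \<in> sets \<mu>"
  using J U JU by (auto simp: M1D sets_restrict_space_iff)

lemma FV_sample_bump:
  assumes \<mu>: "\<mu> \<in> space M1" and n: "1 \<le> n"
  shows "FV_sample \<Lambda> \<mu> n F L J U (bump J n) (bump U n) (err n \<mu>)"
proof -
  interpret prob_space \<mu> by (rule M1D[OF \<mu>])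
  show ?thesis
  proof
    show "\<mu> \<in> space M1" "1 \<le> n" "lip01 L F" "J \<subseteq> U" by (fact \<mu> n F J)+
    show "J \<in> sets \<mu>" "U \<in> sets \<mu>" by (fact sets_JU[OF \<mu>])+
    show "bump J n \<in> borel_measurable \<mu>" "bump U n \<in> borel_measurable \<mu>"
      by (rule M1_measurable_ident[OF bump_measurable \<mu>])+
    show "0 \<le> bump J n a" "bump J n a \<le> 1" "0 \<le> bump U n a" "bump U n a \<le> 1" for a
      by (fact bump_bounds)+
    show "(\<integral>a. \<bar>bump J n a - indicator J a\<bar> \<partial>\<mu>) \<le> err n \<mu>" "(\<integral>a. \<bar>bump U n a - indicator U a\<bar> \<partial>\<mu>) \<le> err n \<mu>"
      by simp_all
  qed
qed

lemma err_tendsto: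
  assumes \<mu>: "\<mu> \<in> space M1"
  shows "(\<lambda>n. C * (err n \<mu> + 1 / sqrt (real n))) \<longlonglongrightarrow> 0"
proof -
  have "(\<lambda>n. 1 / sqrt (real n)) \<longlonglongrightarrow> 0"
    by (intro tendsto_divide_0[OF tendsto_const] filterlim_at_top_imp_at_infinity
        filterlim_compose[OF sqrt_at_top] filterlim_real_sequentially)
  then have "(\<lambda>n. C * ((err n \<mu>) + 1 / sqrt (real n))) \<longlonglongrightarrow> C * ((0 + 0) + 0)"
    using integral_bump_tendsto(2)[OF \<mu> J(1,2) JU(1)] integral_bump_tendsto(2)[OF \<mu> U(1) JU(2) U(2)]
    by (intro tendsto_intros)
  then show ?thesis by simp
qed

lemma FV_poly_tendsto:
  assumes \<mu>: "\<mu> \<in> space M1"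
  shows "(\<lambda>n. FV_poly n (two_type_fun F J U n) \<mu>) \<longlonglongrightarrow> F (measure \<mu> J) (measure \<mu> U)"
proof (rule LIM_zero_cancel)
  show "(\<lambda>n. FV_poly n (two_type_fun F J U n) \<mu> - F (measure \<mu> J) (measure \<mu> U)) \<longlonglongrightarrow> 0"
  proof (rule Lim_null_comparison[OF _ err_tendsto[OF \<mu>]])
    show "\<forall>\<^sub>F n in sequentially. norm (FV_poly n (two_type_fun F J U n) \<mu> - F (measure \<mu> J) (measure \<mu> U))
        \<le> 2 * L * (err n \<mu> + 1 / sqrt (real n))"
      using eventually_ge_at_top[of 1]
    proof eventually_elim
      fix n :: nat assume "1 \<le> n"
      then interpret FV_sample \<Lambda> \<mu> n F L J U "bump J n" "bump U n" "err n \<mu>"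
        by (rule FV_sample_bump[OF \<mu>])
      show "norm (FV_poly n (two_type_fun F J U n) \<mu> - F (measure \<mu> J) (measure \<mu> U))
        \<le> 2 * L * (err n \<mu> + 1 / sqrt (real n))"
        using FV_poly_error by (simp add: two_type_fun_def)
    qed
  qed
qed

text \<open>Dominated convergence over the sizes: \<open>Q_error\<close> gives the pointwise limit
  and \<open>Q_bound\<close> the dominating function \<open>2 * L * x\<close>.\<close>

lemma FV_gen_tendsto:
  assumes \<mu>: "\<mu> \<in> space M1"
  shows "(\<lambda>n. FV_gen \<Lambda> (Suc n) (two_type_fun F J U (Suc n)) \<mu>) \<longlonglongrightarrow> two_type_gen (nu \<Lambda>) F (measure \<mu> J) (measure \<mu> U)"
proof -
  define q where "q = (\<lambda>n. two_type_sample.Q \<mu> (Suc n) F (bump J (Suc n)) (bump U (Suc n)))"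
  define T where "T = (\<lambda>x. two_type_mean F (measure \<mu> J) (measure \<mu> U) x - F (measure \<mu> J) (measure \<mu> U))"
  have S: "FV_sample \<Lambda> \<mu> (Suc n) F L J U (bump J (Suc n)) (bump U (Suc n)) (err (Suc n) \<mu>)" for n
    by (rule FV_sample_bump[OF \<mu>]) simp
  have S': "two_type_sample \<mu> (Suc n) F L J U (bump J (Suc n)) (bump U (Suc n)) (err (Suc n) \<mu>)" for n
    using S[of n] by (simp add: FV_sample_def)
  have gen: "FV_gen \<Lambda> (Suc n) (two_type_fun F J U (Suc n)) \<mu> = (\<integral>x. q n x \<partial>nu \<Lambda>)" for n
    using FV_sample.FV_gen_eq[OF S] by (simp add: q_def two_type_fun_def)
  have lim: "(\<lambda>n. q n x) \<longlonglongrightarrow> T x" if x: "0 < x \<and> x < 1" for x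
  proof (rule LIM_zero_cancel)
    show "(\<lambda>n. q n x - T x) \<longlonglongrightarrow> 0"
    proof (rule Lim_null_comparison[OF _ LIMSEQ_Suc[OF err_tendsto[OF \<mu>]]])
      show "\<forall>\<^sub>F n in sequentially. norm (q n x - T x) \<le> 8 * L * (err (Suc n) \<mu> + 1 / sqrt (real (Suc n)))"
        using two_type_sample.Q_error[OF S'] x
        by (intro always_eventually allI) (simp add: T_def q_def)
    qed
  qed
  have "(\<lambda>n. \<integral>x. q n x \<partial>nu \<Lambda>) \<longlonglongrightarrow> (\<integral>x. T x \<partial>nu \<Lambda>)"
  proof (rule integral_dominated_convergence[where w="\<lambda>x. 2 * L * x"])
    show m: "q n \<in> borel_measurable (nu \<Lambda>)" for n
      unfolding q_def by (rule FV_sample.Q_measurable[OF S])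
    show "AE x in nu \<Lambda>. (\<lambda>n. q n x) \<longlonglongrightarrow> T x"
      using AE_nu by eventually_elim (rule lim)
    show "integrable (nu \<Lambda>) (\<lambda>x. 2 * L * x)" using int_id by simp
    show "AE x in nu \<Lambda>. norm (q n x) \<le> 2 * L * x" for n
      using AE_nu
      by eventually_elim (use two_type_sample.Q_bound[OF S'] in \<open>auto simp: q_def\<close>)
    show "T \<in> borel_measurable (nu \<Lambda>)"
    proof -
      interpret two_type_sample \<mu> 1 F L J U "bump J 1" "bump U 1" "err 1 \<mu>" using S'[of 0] by simp
      show ?thesis
        using integrable_gen[OF F bu] by (simp add: T_def borel_measurable_integrable)
    qed
  qed
  then show ?thesis by (simp add: gen T_def two_type_gen_def)
qed

lemma FV_gen_bounded:
  assumes \<mu>: "\<mu> \<in> space M1"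
  shows "\<bar>FV_gen \<Lambda> (Suc n) (two_type_fun F J U (Suc n)) \<mu>\<bar> \<le> 2 * L * (\<integral>x. x \<partial>nu \<Lambda>)"
  unfolding two_type_fun_def by (rule FV_sample.FV_gen_bound[OF FV_sample_bump[OF \<mu>]]) simp

lemma two_type_fun_bounded: "\<exists>C\<ge>0. \<forall>n x. \<bar>two_type_fun F J U (Suc n) x\<bar> \<le> C"
proof -
  obtain C where C: "0 \<le> C" "\<And>p q. p \<in> {0..1} \<Longrightarrow> q \<in> {0..1} \<Longrightarrow> \<bar>F p q\<bar> \<le> C" using lip01_bounded[OF F] by blast
  have "\<bar>two_type_fun F J U (Suc n) x\<bar> \<le> C" for n x
    unfolding two_type_fun_def sample_fun_def
    by (rule C(2); rule average_01'; (rule bump_bounds)?; simp)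
  then show ?thesis using C(1) by blast
qed

lemma two_type_fun_measurable: "two_type_fun F J U (Suc n) \<in> borel_measurable (\<Pi>\<^sub>M i\<in>{1..Suc n}. borel01)"
  unfolding two_type_fun_def sample_fun_def
proof (rule lip01_measurable[OF F])
  have c: "(\<lambda>x. \<Sum>i\<in>{1..Suc n}. bump V (Suc n) (x i)) \<in> borel_measurable (\<Pi>\<^sub>M i\<in>{1..Suc n}. borel01)" for V
    by (rule borel_measurable_sum, rule measurable_compose[OF measurable_component_singleton], assumption,
        rule measurable_restrict_space1[OF bump_measurable])
  show "(\<lambda>x. (\<Sum>i\<in>{1..Suc n}. bump J (Suc n) (x i)) / real (Suc n)) \<in> borel_measurable (\<Pi>\<^sub>M i\<in>{1..Suc n}. borel01)"
    "(\<lambda>x. (\<Sum>i\<in>{1..Suc n}. bump U (Suc n) (x i)) / real (Suc n)) \<in> borel_measurable (\<Pi>\<^sub>M i\<in>{1..Suc n}. borel01)"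
    by (rule borel_measurable_divide[OF c borel_measurable_const])+
qed (rule average_01'; (rule bump_bounds)?; simp)+

text \<open>This makes the sampled function admissible in the martingale problem.\<close>

lemma two_type_fun_continuous: "continuous_on ({1..Suc n} \<rightarrow>\<^sub>E {0..1}) (two_type_fun F J U (Suc n))"
proof -
  have c: "continuous_on S (\<lambda>x. (\<Sum>i\<in>{1..Suc n}. bump V (Suc n) (x i)) / real (Suc n))" for S :: "(nat \<Rightarrow> real) set" and V
  proof (intro continuous_intros continuous_on_sum)
    fix i
    have "continuous_on S (\<lambda>x::nat \<Rightarrow> real. x i)"
      by (rule continuous_on_subset[OF continuous_on_product_coordinates]) simp
    then show "continuous_on S (\<lambda>x::nat \<Rightarrow> real. bump V (Suc n) (x i))"
      by (rule continuous_on_compose2[OF bump_continuous[of UNIV]]) simp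
  qed simp
  show ?thesis
    unfolding two_type_fun_def sample_fun_def
  proof (rule lip01_continuous[OF F c c])
    show "(\<lambda>x. (\<Sum>i\<in>{1..Suc n}. bump J (Suc n) (x i)) / real (Suc n)) ` ({1..Suc n} \<rightarrow>\<^sub>E {0..1}) \<subseteq> {0..1}"
      "(\<lambda>x. (\<Sum>i\<in>{1..Suc n}. bump U (Suc n) (x i)) / real (Suc n)) ` ({1..Suc n} \<rightarrow>\<^sub>E {0..1}) \<subseteq> {0..1}"
      by (rule image_subsetI, rule average_01'; (rule bump_bounds)?; simp)+
  qed
qed

lemma FV_poly_measurable: "(\<lambda>\<mu>. FV_poly (Suc n) (two_type_fun F J U (Suc n)) \<mu>) \<in> borel_measurable M1"
  unfolding FV_poly_def by (rule measurable_integral_power[OF two_type_fun_measurable])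

lemma FV_gen_measurable: "(\<lambda>\<mu>. FV_gen \<Lambda> (Suc n) (two_type_fun F J U (Suc n)) \<mu>) \<in> borel_measurable M1"
  unfolding FV_gen_def
proof (intro borel_measurable_sum borel_measurable_times borel_measurable_const measurable_integral_power)
  fix K assume "K \<in> {K. K \<subseteq> {1..Suc n} \<and> 2 \<le> card K}"
  then have K: "K \<subseteq> {1..Suc n}" "K \<noteq> {}" by auto
  show "(\<lambda>x. two_type_fun F J U (Suc n) (FV_R (Suc n) K x) - two_type_fun F J U (Suc n) x)
      \<in> borel_measurable (\<Pi>\<^sub>M i\<in>{1..Suc n}. borel01)"
    by (rule borel_measurable_diff[OF measurable_compose[OF FV_R_measurable[OF K] two_type_fun_measurable] two_type_fun_measurable])
qed

lemma FV_poly_bounded: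
  assumes C: "\<And>x. \<bar>two_type_fun F J U (Suc n) x\<bar> \<le> C" and \<mu>: "\<mu> \<in> space M1"
  shows "\<bar>FV_poly (Suc n) (two_type_fun F J U (Suc n)) \<mu>\<bar> \<le> C"
proof -
  interpret PM: prob_space "\<Pi>\<^sub>M i\<in>{1..Suc n}. \<mu>" by (rule prob_space_PiM) (rule M1D[OF \<mu>])
  have C0: "0 \<le> C" using C[of undefined] by linarith
  have "\<bar>FV_poly (Suc n) (two_type_fun F J U (Suc n)) \<mu>\<bar> \<le> (\<integral>x. \<bar>two_type_fun F J U (Suc n) x\<bar> \<partial>(\<Pi>\<^sub>M i\<in>{1..Suc n}. \<mu>))"
    unfolding FV_poly_def by (rule integral_abs_bound)
  also have "\<dots> \<le> (\<integral>x. C \<partial>(\<Pi>\<^sub>M i\<in>{1..Suc n}. \<mu>))"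
    by (rule integral_mono_AE'[OF PM.integrable_const]) (use C C0 in auto)
  also have "(\<integral>x. C \<partial>(\<Pi>\<^sub>M i\<in>{1..Suc n}. \<mu>)) = C" using PM.prob_space by simp
  finally show ?thesis .
qed

end

section \<open>The drift inequality for Lipschitz functions of two masses\<close>

locale FV_process = dust_measure \<Lambda> for \<Lambda> +
  fixes P :: "'w measure" and \<rho> :: "real \<Rightarrow> 'w \<Rightarrow> real measure"
  assumes FV: "Fleming_Viot \<Lambda> P \<rho>"
begin

sublocale P: prob_space P using FV by (simp add: Fleming_Viot_def)

lemma rho_measurable: "0 \<le> t \<Longrightarrow> \<rho> t \<in> P \<rightarrow>\<^sub>M M1"
  using FV by (simp add: Fleming_Viot_def)

lemma rho_M1: "0 \<le> t \<Longrightarrow> \<omega> \<in> space P \<Longrightarrow> \<rho> t \<omega> \<in> space M1"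
  using measurable_space[OF rho_measurable] .

lemma path_measurable: "\<omega> \<in> space P \<Longrightarrow> (\<lambda>r. \<rho> (max 0 r) \<omega>) \<in> borel \<rightarrow>\<^sub>M M1"
  using FV rho_M1 by (intro measurable_cadlag_path) (auto simp: Fleming_Viot_def)

lemma filtration_events:
  assumes "0 \<le> s" "A \<in> sets M1"
  shows "{\<omega> \<in> space P. \<rho> s \<omega> \<in> A} \<in> sets (natural_filtration P M1 \<rho> s)"
proof -
  have "\<rho> s -` A \<inter> space P \<in> sigma_sets (space P) {\<rho> r -` A \<inter> space P | r A. 0 \<le> r \<and> r \<le> s \<and> A \<in> sets M1}"
    using assms by (intro sigma_sets.Basic) blast
  then have "\<rho> s -` A \<inter> space P \<in> sets (natural_filtration P M1 \<rho> s)"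
    unfolding natural_filtration_def by (subst sets_measure_of) auto
  moreover have "{\<omega> \<in> space P. \<rho> s \<omega> \<in> A} = \<rho> s -` A \<inter> space P" by auto
  ultimately show ?thesis by simp
qed

lemma mass_measurable:
  assumes "0 \<le> t" "A \<in> sets borel01"
  shows "(\<lambda>\<omega>. measure (\<rho> t \<omega>) A) \<in> borel_measurable P"
  by (rule measurable_compose[OF rho_measurable[OF assms(1)] M1_measurable[OF measurable_measure_subprob_algebra[OF assms(2)]]])

text \<open>The martingale identity for the sampled functions is integrated over an event
  \<open>B\<close> of the past and passed to the limit in the number of samples. Bounds uniform in
  that number on the functionals and on their generators allow dominated convergence, both in time
  and in \<omega>. The event \<open>B\<close> permits a restart at time \<open>s\<close>.\<close>

lemma drift:
  assumes F: "lip01 L F" and J: "closed J" "J \<noteq> {}" "J \<subseteq> U" and U: "closed U" "U \<subseteq> {0..1}"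
    and \<delta>: "0 \<le> \<delta>" "\<And>b u. 0 \<le> b \<Longrightarrow> b \<le> u \<Longrightarrow> u \<le> 1 \<Longrightarrow> two_type_gen (nu \<Lambda>) F b u \<le> \<delta>"
    and st: "0 \<le> s" "s \<le> t" and B: "B \<in> sets (natural_filtration P M1 \<rho> s)"
  shows "(\<integral>\<omega>. indicator B \<omega> * F (measure (\<rho> t \<omega>) J) (measure (\<rho> t \<omega>) U) \<partial>P)
    \<le> (\<integral>\<omega>. indicator B \<omega> * F (measure (\<rho> s \<omega>) J) (measure (\<rho> s \<omega>) U) \<partial>P) + \<delta> * (t - s)"
proof -
  interpret two_type_test \<Lambda> F L J U by unfold_locales (fact F J U)+
  let ?F = "\<lambda>r \<omega>. F (measure (\<rho> r \<omega>) J) (measure (\<rho> r \<omega>) U)"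
  let ?g = "\<lambda>r \<omega>. two_type_gen (nu \<Lambda>) F (measure (\<rho> (max 0 r) \<omega>) J) (measure (\<rho> (max 0 r) \<omega>) U)"
  define g where "g = (\<lambda>n. two_type_fun F J U (Suc n))"
  define G where "G = (\<lambda>n \<mu>. FV_poly (Suc n) (g n) \<mu>)"
  define A where "A = (\<lambda>n \<mu>. FV_gen \<Lambda> (Suc n) (g n) \<mu>)"
  define I where "I = (\<lambda>n t \<omega>. LBINT r:{0..t}. A n (\<rho> r \<omega>))"
  define X where "X = (\<lambda>n t \<omega>. G n (\<rho> t \<omega>) - I n t \<omega>)"
  define K where "K = 2 * L * (\<integral>x. x \<partial>nu \<Lambda>)"
  have A_le: "\<bar>A n \<mu>\<bar> \<le> K" if "\<mu> \<in> space M1" for n \<mu>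
    unfolding A_def g_def K_def by (rule FV_gen_bounded[OF that])
  obtain C where C: "0 \<le> C" "\<And>n x. \<bar>g n x\<bar> \<le> C" using two_type_fun_bounded unfolding g_def by blast
  have G_le: "\<bar>G n \<mu>\<bar> \<le> C" if "\<mu> \<in> space M1" for n \<mu>
    unfolding G_def g_def by (rule FV_poly_bounded[OF _ that]) (use C(2) g_def in auto)
  have A_lim: "(\<lambda>n. A n \<mu>) \<longlonglongrightarrow> two_type_gen (nu \<Lambda>) F (measure \<mu> J) (measure \<mu> U)" if "\<mu> \<in> space M1" for \<mu>
    unfolding A_def g_def by (rule FV_gen_tendsto[OF that])
  have G_lim: "(\<lambda>n. G n \<mu>) \<longlonglongrightarrow> F (measure \<mu> J) (measure \<mu> U)" if "\<mu> \<in> space M1" for \<mu>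
    unfolding G_def g_def by (rule LIMSEQ_Suc[OF FV_poly_tendsto[OF that]])
  have G_meas: "(\<lambda>\<omega>. G n (\<rho> r \<omega>)) \<in> borel_measurable P" if "0 \<le> r" for n r
    unfolding G_def g_def by (rule measurable_compose[OF rho_measurable[OF that] FV_poly_measurable])
  have A_meas: "(\<lambda>r. A n (\<rho> (max 0 r) \<omega>)) \<in> borel_measurable borel" if "\<omega> \<in> space P" for n \<omega>
    unfolding A_def g_def by (rule measurable_compose[OF path_measurable[OF that] FV_gen_measurable])
  have mart: "martingale P (natural_filtration P M1 \<rho>) (X n)" for n
  proof -
    have "continuous_on ({1..Suc n} \<rightarrow>\<^sub>E {0..1}) (g n)" unfolding g_def by (rule two_type_fun_continuous)
    moreover have "\<forall>n\<ge>1. \<forall>f. continuous_on ({1..n} \<rightarrow>\<^sub>E {0..1}) f \<longrightarrow>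
        martingale P (natural_filtration P M1 \<rho>)
          (\<lambda>t \<omega>. FV_poly n f (\<rho> t \<omega>) - (LBINT s:{0..t}. FV_gen \<Lambda> n f (\<rho> s \<omega>)))"
      using FV unfolding Fleming_Viot_def by (elim conjE) assumption
    ultimately show ?thesis
      unfolding X_def G_def I_def A_def by simp
  qed
  have sub: "subalgebra P (natural_filtration P M1 \<rho> s)"
    using mart[of 0] st unfolding martingale_def by blast
  then have BP: "B \<in> sets P" using B by (auto simp: subalgebra_def)
  have X_int: "integrable P (X n r)" if "0 \<le> r" for n r
    using mart[of n] that unfolding martingale_def by blast
  interpret finite_measure_subalgebra P "natural_filtration P M1 \<rho> s"
    by unfold_locales (fact sub)
  have eqX: "(\<integral>\<omega>. indicator B \<omega> * X n t \<omega> \<partial>P) = (\<integral>\<omega>. indicator B \<omega> * X n s \<omega> \<partial>P)" for n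
  proof -
    have "(\<integral>\<omega>\<in>B. X n t \<omega> \<partial>P) = (\<integral>\<omega>\<in>B. real_cond_exp P (natural_filtration P M1 \<rho> s) (X n t) \<omega> \<partial>P)"
      using X_int st B by (intro real_cond_exp_intA) auto
    also have "\<dots> = (\<integral>\<omega>\<in>B. X n s \<omega> \<partial>P)"
    proof -
      have "AE \<omega> in P. real_cond_exp P (natural_filtration P M1 \<rho> s) (X n t) \<omega> = X n s \<omega>"
        using mart[of n] st unfolding martingale_def by blast
      then show ?thesis
        unfolding set_lebesgue_integral_def
        using BP X_int[of s n] st borel_measurable_integrable
        by (intro integral_cong_AE) auto
    qed
    finally show ?thesis by (simp add: set_lebesgue_integral_def)
  qed
  \<comment> \<open>The compensator over \<open>(s, t]\<close>. Below it is written with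
    \<open>max 0 r\<close>, the form in which the path is measurable on the whole line.\<close>
  define H where "H = (\<lambda>n \<omega>. I n t \<omega> - I n s \<omega>)"
  have H_eq: "H n \<omega> = (\<integral>r. indicator {s<..t} r * A n (\<rho> (max 0 r) \<omega>) \<partial>lborel)" if \<omega>: "\<omega> \<in> space P" for n \<omega>
  proof -
    define a where "a = (\<lambda>r. A n (\<rho> (max 0 r) \<omega>))"
    have [measurable]: "a \<in> borel_measurable borel" unfolding a_def by (rule A_meas[OF \<omega>])
    have a: "\<bar>a r\<bar> \<le> K" for r unfolding a_def by (intro A_le rho_M1 \<omega>) simp
    have int: "integrable lborel (\<lambda>r. indicator {0..q} r * a r)" for q
    proof (rule Bochner_Integration.integrable_bound[where f="\<lambda>r. K * indicator {0..q} r"])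
      show "integrable lborel (\<lambda>r. K * indicator {0..q} r)"
        by (intro integrable_mult_right integrable_real_indicator) (auto simp: emeasure_lborel_Icc_eq)
      show "AE r in lborel. norm (indicator {0..q} r * a r) \<le> norm (K * indicator {0..q} r :: real)"
      proof (rule AE_I2)
        fix r show "norm (indicator {0..q} r * a r) \<le> norm (K * indicator {0..q} r :: real)"
          using a[of r] by (simp add: indicator_def)
      qed
    qed measurable
    have I: "I n q \<omega> = (\<integral>r. indicator {0..q} r * a r \<partial>lborel)" for q
      unfolding I_def set_lebesgue_integral_def a_def
      by (intro Bochner_Integration.integral_cong) (auto simp: indicator_def max_def)
    have "H n \<omega> = (\<integral>r. indicator {0..t} r * a r - indicator {0..s} r * a r \<partial>lborel)"
      unfolding H_def I using int by (simp add: Bochner_Integration.integral_diff)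
    also have "\<dots> = (\<integral>r. indicator {s<..t} r * a r \<partial>lborel)"
      using st by (intro Bochner_Integration.integral_cong) (auto simp: indicator_def)
    finally show ?thesis by (simp add: a_def)
  qed
  define T where "T = (\<lambda>\<omega>. \<integral>r. indicator {s<..t} r * ?g r \<omega> \<partial>lborel)"
  have w: "integrable lborel (\<lambda>r. c * indicator {s<..t} r :: real)" for c
    by (intro integrable_mult_right integrable_real_indicator) (use st in auto)
  have H_lim: "(\<lambda>n. H n \<omega>) \<longlonglongrightarrow> T \<omega>" and H_le: "\<bar>H n \<omega>\<bar> \<le> K * (t - s)" and T_le: "T \<omega> \<le> \<delta> * (t - s)"
    if \<omega>: "\<omega> \<in> space P" for \<omega> n
  proof -
    have \<rho>: "\<rho> (max 0 r) \<omega> \<in> space M1" for r by (rule rho_M1[OF _ \<omega>]) simp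
    have m: "(\<lambda>r. indicator {s<..t} r * A n (\<rho> (max 0 r) \<omega>)) \<in> borel_measurable lborel" for n
      using A_meas[OF \<omega>] by measurable
    have bd: "norm (indicator {s<..t} r * A n (\<rho> (max 0 r) \<omega>)) \<le> K * indicator {s<..t} r" for n r
      using A_le[OF \<rho>[of r], of n] by (simp add: indicator_def)
    have l: "(\<lambda>n. indicator {s<..t} r * A n (\<rho> (max 0 r) \<omega>)) \<longlonglongrightarrow>
        indicator {s<..t} r * ?g r \<omega>" for r
      by (intro tendsto_mult tendsto_const A_lim \<rho>)
    \<comment> \<open>Measurability in time of the limiting generator is inherited from the
      approximations.\<close>
    have mT: "(\<lambda>r. indicator {s<..t} r * ?g r \<omega>)
        \<in> borel_measurable lborel"
      by (rule borel_measurable_LIMSEQ_real[OF l m])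
    have "(\<lambda>n. \<integral>r. indicator {s<..t} r * A n (\<rho> (max 0 r) \<omega>) \<partial>lborel) \<longlonglongrightarrow> T \<omega>"
      unfolding T_def
      by (rule integral_dominated_convergence[OF mT m w[of K]]) (intro AE_I2 l bd)+
    then show "(\<lambda>n. H n \<omega>) \<longlonglongrightarrow> T \<omega>" by (simp add: H_eq[OF \<omega>])
    have "\<bar>H n \<omega>\<bar> \<le> (\<integral>r. \<bar>indicator {s<..t} r * A n (\<rho> (max 0 r) \<omega>)\<bar> \<partial>lborel)"
      unfolding H_eq[OF \<omega>] by (rule integral_abs_bound)
    also have "\<dots> \<le> (\<integral>r. K * indicator {s<..t} r \<partial>lborel)"
    proof (rule integral_mono_AE'[OF w])
      show "AE r in lborel. \<bar>indicator {s<..t} r * A n (\<rho> (max 0 r) \<omega>)\<bar> \<le> K * indicator {s<..t} r"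
        using bd by (intro AE_I2) simp
      show "AE r in lborel. 0 \<le> K * indicator {s<..t} r"
        using order_trans[OF norm_ge_zero bd] by (intro AE_I2)
    qed
    also have "\<dots> = K * (t - s)" using st by simp
    finally show "\<bar>H n \<omega>\<bar> \<le> K * (t - s)" .
    have "T \<omega> \<le> (\<integral>r. \<delta> * indicator {s<..t} r \<partial>lborel)"
      unfolding T_def
    proof (rule integral_mono_AE'[OF w])
      show "AE r in lborel. indicator {s<..t} r * ?g r \<omega>
          \<le> \<delta> * indicator {s<..t} r"
      proof (rule AE_I2)
        fix r :: real
        interpret R: prob_space "\<rho> (max 0 r) \<omega>" by (rule M1D[OF \<rho>])
        have "?g r \<omega> \<le> \<delta>"
          using J(3) sets_JU[OF \<rho>[of r]] by (intro \<delta>(2) R.finite_measure_mono) auto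
        then show "indicator {s<..t} r * ?g r \<omega>
          \<le> \<delta> * indicator {s<..t} r" by (simp add: indicator_def)
      qed
      show "AE r in lborel. 0 \<le> \<delta> * indicator {s<..t} r" using \<delta>(1) by simp
    qed
    also have "\<dots> = \<delta> * (t - s)" using st by simp
    finally show "T \<omega> \<le> \<delta> * (t - s)" .
  qed
  have G_int: "integrable P (\<lambda>\<omega>. indicator B \<omega> * G n (\<rho> r \<omega>))" if "0 \<le> r" for n r
  proof (rule P.integrable_const_bound[where B=C])
    show "AE \<omega> in P. norm (indicator B \<omega> * G n (\<rho> r \<omega>)) \<le> C"
      using G_le[OF rho_M1[OF that]] C(1) by (intro AE_I2) (simp add: indicator_def)
    show "(\<lambda>\<omega>. indicator B \<omega> * G n (\<rho> r \<omega>)) \<in> borel_measurable P"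
      using G_meas[OF that] BP by measurable
  qed
  have XB_int: "integrable P (\<lambda>\<omega>. indicator B \<omega> * X n r \<omega>)" if "0 \<le> r" for n r
    using integrable_mult_indicator[OF BP X_int[OF that, of n]] by simp
  \<comment> \<open>\<open>H\<close> is a combination of functions already known to be integrable in
    \<omega>, so no joint measurability in time and \<omega> has to be established.\<close>
  have H_X: "indicator B \<omega> * H n \<omega> = (indicator B \<omega> * G n (\<rho> t \<omega>) - indicator B \<omega> * G n (\<rho> s \<omega>))
      - (indicator B \<omega> * X n t \<omega> - indicator B \<omega> * X n s \<omega>)" for n \<omega>
    by (simp add: H_def X_def algebra_simps)
  have H_int: "integrable P (\<lambda>\<omega>. indicator B \<omega> * H n \<omega>)" for n
    unfolding H_X using G_int XB_int st by (intro Bochner_Integration.integrable_diff) auto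
  have GH: "(\<integral>\<omega>. indicator B \<omega> * G n (\<rho> t \<omega>) \<partial>P) = (\<integral>\<omega>. indicator B \<omega> * G n (\<rho> s \<omega>) \<partial>P) + (\<integral>\<omega>. indicator B \<omega> * H n \<omega> \<partial>P)" for n
    unfolding H_X using G_int XB_int st eqX[of n] by (simp add: Bochner_Integration.integral_diff)
  have F_lim: "(\<lambda>n. \<integral>\<omega>. indicator B \<omega> * G n (\<rho> r \<omega>) \<partial>P) \<longlonglongrightarrow> (\<integral>\<omega>. indicator B \<omega> * ?F r \<omega> \<partial>P)"
    if r: "0 \<le> r" for r
  proof -
    have l: "(\<lambda>n. indicator B \<omega> * G n (\<rho> r \<omega>)) \<longlonglongrightarrow> indicator B \<omega> * ?F r \<omega>"
      if "\<omega> \<in> space P" for \<omega>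
      by (intro tendsto_mult tendsto_const G_lim rho_M1 r that)
    show ?thesis
    proof (rule integral_dominated_convergence[where w="\<lambda>_. C"])
      show "(\<lambda>\<omega>. indicator B \<omega> * ?F r \<omega>) \<in> borel_measurable P"
        by (rule borel_measurable_LIMSEQ_real[OF l borel_measurable_integrable[OF G_int[OF r]]])
      show "AE \<omega> in P. (\<lambda>n. indicator B \<omega> * G n (\<rho> r \<omega>)) \<longlonglongrightarrow> indicator B \<omega> * ?F r \<omega>"
        using l by (rule AE_I2)
      show "AE \<omega> in P. norm (indicator B \<omega> * G n (\<rho> r \<omega>)) \<le> C" for n
        using G_le[OF rho_M1[OF r]] C(1) by (intro AE_I2) (simp add: indicator_def)
    qed (use G_int[OF r] in auto)
  qed
  have l: "(\<lambda>n. indicator B \<omega> * H n \<omega>) \<longlonglongrightarrow> indicator B \<omega> * T \<omega>" if "\<omega> \<in> space P" for \<omega>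
    by (intro tendsto_mult tendsto_const H_lim that)
  have T_meas: "(\<lambda>\<omega>. indicator B \<omega> * T \<omega>) \<in> borel_measurable P"
    by (rule borel_measurable_LIMSEQ_real[OF l borel_measurable_integrable[OF H_int]])
  have K0: "0 \<le> K * (t - s)"
    using H_le P.not_empty abs_ge_zero order_trans by (metis all_not_in_conv)
  have bH: "AE \<omega> in P. norm (indicator B \<omega> * H n \<omega>) \<le> K * (t - s)" for n
    using H_le K0 by (intro AE_I2) (simp add: indicator_def)
  have T_lim: "(\<lambda>n. \<integral>\<omega>. indicator B \<omega> * H n \<omega> \<partial>P) \<longlonglongrightarrow> (\<integral>\<omega>. indicator B \<omega> * T \<omega> \<partial>P)"
    by (rule integral_dominated_convergence[OF T_meas borel_measurable_integrable[OF H_int] _ AE_I2[OF l] bH])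
       simp_all
  have "(\<integral>\<omega>. indicator B \<omega> * ?F t \<omega> \<partial>P)
    = (\<integral>\<omega>. indicator B \<omega> * ?F s \<omega> \<partial>P) + (\<integral>\<omega>. indicator B \<omega> * T \<omega> \<partial>P)"
    using F_lim[of t] tendsto_add[OF F_lim[of s] T_lim] st unfolding GH by (intro LIMSEQ_unique) auto
  also have "(\<integral>\<omega>. indicator B \<omega> * T \<omega> \<partial>P) \<le> (\<integral>\<omega>. \<delta> * (t - s) \<partial>P)"
  proof (rule integral_mono_AE')
    show "AE \<omega> in P. indicator B \<omega> * T \<omega> \<le> \<delta> * (t - s)"
      using T_le \<delta>(1) st by (intro AE_I2) (simp add: indicator_def)
    show "AE \<omega> in P. 0 \<le> \<delta> * (t - s)" using \<delta>(1) st by simp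
  qed simp
  finally show ?thesis by (simp add: P.prob_space)
qed

end
subsection \<open>Absence of a second Eve\<close>

text \<open>A form of Fatou's lemma: \<open>A\<close> is the increasing union of its parts
  \<open>D n\<close> that lie in all later \<open>E k\<close>. It carries every passage to the limit
  in the event whose probability is estimated.\<close>

lemma (in prob_space) prob_le_of_eventually:
  assumes A: "A \<in> events" and E: "\<And>n. E n \<in> events"
    and ev: "\<And>\<omega>. \<omega> \<in> A \<Longrightarrow> eventually (\<lambda>n. \<omega> \<in> E n) sequentially"
    and le: "\<And>n. N \<le> n \<Longrightarrow> prob (E n) \<le> R"
  shows "prob A \<le> R"
proof -
  define D where "D = (\<lambda>n. A \<inter> (\<Inter>k\<in>{n..}. E k))"
  have D: "D n \<in> events" for n unfolding D_def using A E by (intro sets.Int sets.countable_INT') auto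
  have "incseq D" by (auto simp: incseq_def D_def)
  then have "(\<lambda>n. prob (D n)) \<longlonglongrightarrow> prob (\<Union>n. D n)"
    using D by (intro finite_Lim_measure_incseq) auto
  moreover have "(\<Union>n. D n) = A"
    using ev by (fastforce simp: D_def eventually_sequentially)
  moreover have "prob (D n) \<le> R" if "N \<le> n" for n
  proof -
    have "prob (D n) \<le> prob (E n)" using E by (intro finite_measure_mono) (auto simp: D_def)
    then show ?thesis using le[OF that] by linarith
  qed
  ultimately show ?thesis by (intro LIMSEQ_le_const2) auto
qed

context FV_process begin

text \<open>Shows that the mass of \<open>J\<close> never vanishes; the second argument is a dummy.\<close>

definition floor_fun :: "real \<Rightarrow> real \<Rightarrow> real \<Rightarrow> real \<Rightarrow> real" where
  "floor_fun m \<epsilon> b u = min 1 (ln ((1 + \<epsilon>) / (b + \<epsilon>)) / m)"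

lemma lip01_floor_fun:
  assumes m: "1 \<le> m" and \<epsilon>: "0 < \<epsilon>"
  shows "lip01 (1 / \<epsilon>) (floor_fun m \<epsilon>)"
proof -
  have "\<bar>floor_fun m \<epsilon> b u - floor_fun m \<epsilon> b' u'\<bar> \<le> 1 / \<epsilon> * (\<bar>b - b'\<bar> + \<bar>u - u'\<bar>)"
    if "b \<in> {0..1}" "b' \<in> {0..1}" for b b' u u'
  proof -
    have "\<bar>floor_fun m \<epsilon> b u - floor_fun m \<epsilon> b' u'\<bar> \<le> \<bar>ln ((1 + \<epsilon>) / (b + \<epsilon>)) / m - ln ((1 + \<epsilon>) / (b' + \<epsilon>)) / m\<bar>"
      unfolding floor_fun_def by linarith
    also have "\<dots> = \<bar>ln (b + \<epsilon>) - ln (b' + \<epsilon>)\<bar> / m"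
      using that \<epsilon> m by (subst (1 2) ln_div) (auto simp: diff_divide_distrib[symmetric] abs_minus_commute)
    also have "\<dots> \<le> \<bar>ln (b + \<epsilon>) - ln (b' + \<epsilon>)\<bar> / 1" using m by (intro divide_left_mono) auto
    also have "\<dots> \<le> \<bar>b - b'\<bar> / \<epsilon>" using ln_lipschitz[of \<epsilon> "b + \<epsilon>" "b' + \<epsilon>"] that \<epsilon> by simp
    also have "\<dots> \<le> (\<bar>b - b'\<bar> + \<bar>u - u'\<bar>) / \<epsilon>" using \<epsilon> by (intro divide_right_mono) auto
    finally show ?thesis by simp
  qed
  then show ?thesis using \<epsilon> by (simp add: lip01_def)
qed

text \<open>Whatever its parent, an event of size \<open>x\<close> leaves \<open>J\<close> at least
  the fraction \<open>1 - x\<close> of its mass, so each size raises the function by at most its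
  term in \<open>beta m\<close>.\<close>

lemma two_type_gen_floor_fun:
  assumes m: "1 \<le> m" and \<epsilon>: "0 < \<epsilon>" and bu: "0 \<le> b" "b \<le> u" "u \<le> 1"
  shows "two_type_gen (nu \<Lambda>) (floor_fun m \<epsilon>) b u \<le> beta m"
proof (rule two_type_gen_le[OF lip01_floor_fun[OF m \<epsilon>] bu integrable_beta[OF m]])
  show "(\<integral>x. min 1 (ln (1 / (1 - x)) / m) \<partial>nu \<Lambda>) \<le> beta m" by (simp add: beta_def)
  fix x :: real assume x: "0 < x" "x < 1"
  define \<alpha> where "\<alpha> = min 1 (ln (1 / (1 - x)) / m)"
  have \<alpha>: "0 \<le> \<alpha>" using min_ln_le(2)[OF x m] by (simp add: \<alpha>_def)
  define w where "w = ln ((1 + \<epsilon>) / (b + \<epsilon>)) / m"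
  have w: "0 \<le> w" using bu \<epsilon> m by (auto simp: w_def intro!: divide_nonneg_nonneg ln_ge_zero)
  have p: "0 < b + \<epsilon>" "0 < (1 - x) * b + \<epsilon>" "0 \<le> x * b" "0 < 1 + \<epsilon>" "0 < 1 - x"
    using bu \<epsilon> x by (auto intro!: add_nonneg_pos)
  have "ln ((1 + \<epsilon>) / ((1 - x) * b + \<epsilon>)) \<le> ln ((1 + \<epsilon>) / (b + \<epsilon>)) + ln (1 / (1 - x))"
  proof -
    have "ln ((1 - x) * (b + \<epsilon>)) \<le> ln ((1 - x) * b + \<epsilon>)"
      using p x \<epsilon> by (intro ln_mono mult_pos_pos) (auto simp: algebra_simps)
    then show ?thesis using p by (simp add: ln_div ln_mult)
  qed
  then have "ln ((1 + \<epsilon>) / ((1 - x) * b + \<epsilon>)) / m \<le> w + ln (1 / (1 - x)) / m"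
    using m by (simp add: w_def add_divide_distrib[symmetric] divide_right_mono)
  then have 1: "floor_fun m \<epsilon> ((1 - x) * b) u' \<le> floor_fun m \<epsilon> b u + \<alpha>" for u'
    using w \<alpha> unfolding floor_fun_def \<alpha>_def w_def[symmetric] by linarith
  have "(1 + \<epsilon>) / ((1 - x) * b + x + \<epsilon>) \<le> (1 + \<epsilon>) / (b + \<epsilon>)"
  proof (rule divide_left_mono)
    have "0 \<le> x * (1 - b)" using x bu by simp
    then show "b + \<epsilon> \<le> (1 - x) * b + x + \<epsilon>" by (simp add: algebra_simps)
    then show "0 < ((1 - x) * b + x + \<epsilon>) * (b + \<epsilon>)" using p by (intro mult_pos_pos) linarith+
  qed (use p in simp)
  then have "ln ((1 + \<epsilon>) / ((1 - x) * b + x + \<epsilon>)) / m \<le> w"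
    using p x m unfolding w_def by (intro divide_right_mono ln_mono divide_pos_pos) auto
  then have 2: "floor_fun m \<epsilon> ((1 - x) * b + x) u' \<le> floor_fun m \<epsilon> b u + \<alpha>" for u'
    using \<alpha> unfolding floor_fun_def w_def[symmetric] by linarith
  have "two_type_mean (floor_fun m \<epsilon>) b u x
    \<le> (1 - u) * (floor_fun m \<epsilon> b u + \<alpha>) + b * (floor_fun m \<epsilon> b u + \<alpha>) + (u - b) * (floor_fun m \<epsilon> b u + \<alpha>)"
    unfolding two_type_mean_def using 1 2 bu by (intro add_mono mult_left_mono) auto
  also have "\<dots> = floor_fun m \<epsilon> b u + \<alpha>" by (simp add: algebra_simps)
  finally show "two_type_mean (floor_fun m \<epsilon>) b u x \<le> floor_fun m \<epsilon> b u + min 1 (ln (1 / (1 - x)) / m)"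
    by (simp add: \<alpha>_def)
qed

lemma space_in_filtration: "space P \<in> sets (natural_filtration P M1 \<rho> s)"
  using sets.top[of "natural_filtration P M1 \<rho> s"] by (simp add: natural_filtration_def space_measure_of_conv)

lemma closed_sets_borel01: "closed J \<Longrightarrow> J \<subseteq> {0..1} \<Longrightarrow> J \<in> sets borel01" for J :: "real set"
  by (subst sets_restrict_space_iff) auto

text \<open>The truncated logarithm equals 1 where the mass vanishes, while its expectation at time
  \<open>t\<close> is at most \<open>ln (1 / l) / m + t * beta m\<close>, with \<open>l\<close> the
  initial mass. Both summands vanish as \<open>m\<close> tends to infinity.\<close>

lemma mass_pos:
  assumes J: "closed J" "J \<subseteq> {0..1}" and pos: "0 < measure lebesgue01 J" and t: "0 \<le> t"
  shows "AE \<omega> in P. 0 < measure (\<rho> t \<omega>) J"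
proof -
  define l where "l = measure lebesgue01 J"
  define Z where "Z = {\<omega> \<in> space P. measure (\<rho> t \<omega>) J = 0}"
  have Jn: "J \<noteq> {}" using pos by auto
  have bm: "(\<lambda>\<omega>. measure (\<rho> r \<omega>) J) \<in> borel_measurable P" if "0 \<le> r" for r
    by (rule mass_measurable[OF that closed_sets_borel01[OF J]])
  have Z: "Z \<in> P.events" unfolding Z_def using bm[OF t] by measurable
  have b01: "measure (\<rho> r \<omega>) J \<in> {0..1}" if "0 \<le> r" "\<omega> \<in> space P" for r \<omega>
  proof -
    interpret R: prob_space "\<rho> r \<omega>" by (rule M1D[OF rho_M1[OF that]])
    show ?thesis by (simp add: R.prob_le_1)
  qed
  have key: "P.prob Z \<le> ln (1 / l) / real (Suc k) + beta (real (Suc k)) * t" for k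
  proof -
    define m where "m = real (Suc k)"
    \<comment> \<open>For a vanishing mass the ratio is then \<open>exp m + 1\<close>, just enough
      to reach the cutoff value 1.\<close>
    define \<epsilon> where "\<epsilon> = exp (- m)"
    have m: "1 \<le> m" and \<epsilon>: "0 < \<epsilon>" by (auto simp: m_def \<epsilon>_def)
    let ?F = "floor_fun m \<epsilon>"
    let ?G = "\<lambda>r \<omega>. indicator (space P) \<omega> * ?F (measure (\<rho> r \<omega>) J) (measure (\<rho> r \<omega>) J)"
    have F0: "0 \<le> ?F b u" if "b \<in> {0..1}" for b u
      using that m \<epsilon> by (auto simp: floor_fun_def intro!: divide_nonneg_nonneg ln_ge_zero)
    have F1: "?F b u \<le> 1" for b u by (simp add: floor_fun_def)
    have FZ: "?F 0 u = 1" for u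
    proof -
      have "m = ln (exp m)" by simp
      also have "\<dots> \<le> ln ((1 + \<epsilon>) / (0 + \<epsilon>))"
        by (intro ln_mono) (auto simp: \<epsilon>_def exp_minus field_simps)
      finally show ?thesis using m by (simp add: floor_fun_def field_simps)
    qed
    have Fm: "(\<lambda>\<omega>. ?F (measure (\<rho> r \<omega>) J) (measure (\<rho> r \<omega>) J)) \<in> borel_measurable P" if "0 \<le> r" for r
      by (rule lip01_measurable[OF lip01_floor_fun[OF m \<epsilon>] bm[OF that] bm[OF that]]) (rule b01[OF that], assumption)+
    have "P.prob Z = (\<integral>\<omega>. indicator Z \<omega> \<partial>P)" using Z by simp
    also have "\<dots> \<le> (\<integral>\<omega>. ?G t \<omega> \<partial>P)"
    proof (rule integral_mono_AE')
      show "integrable P (\<lambda>\<omega>. ?G t \<omega>)"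
      proof (rule P.integrable_const_bound[where B=1])
        show "AE \<omega> in P. norm (?G t \<omega>) \<le> 1"
          using F0[OF b01[OF t]] F1 by (intro AE_I2) simp
      qed (use Fm[OF t] in measurable)
      show "AE \<omega> in P. indicator Z \<omega> \<le> ?G t \<omega>"
        using F0[OF b01[OF t]] by (intro AE_I2) (auto simp: indicator_def Z_def FZ)
      show "AE \<omega> in P. 0 \<le> ?G t \<omega>"
        using F0[OF b01[OF t]] by (intro AE_I2) simp
    qed
    also have "\<dots> \<le> (\<integral>\<omega>. ?G 0 \<omega> \<partial>P) + beta m * (t - 0)"
      using J Jn t two_type_gen_floor_fun[OF m \<epsilon>] beta_nonneg[OF m]
      by (intro drift[OF lip01_floor_fun[OF m \<epsilon>]] space_in_filtration) auto
    also have "(\<integral>\<omega>. ?G 0 \<omega> \<partial>P) \<le> (\<integral>\<omega>. ln (1 / l) / m \<partial>P)"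
    proof (rule integral_mono_AE')
      have l1: "l \<le> 1"
      proof -
        have "measure lebesgue01 J \<le> measure lebesgue01 {0..1}"
          using J closed_sets_borel01[of "{0..1}"]
          by (intro measure_mono_fmeasurable) (auto simp: fmeasurable_def emeasure_restrict_space sets_restrict_space_iff)
        also have "\<dots> = 1" by (simp add: measure_restrict_space)
        finally show ?thesis by (simp add: l_def)
      qed
      show "AE \<omega> in P. ?G 0 \<omega> \<le> ln (1 / l) / m"
      proof -
        have "AE \<omega> in P. \<rho> 0 \<omega> = lebesgue01" using FV by (simp add: Fleming_Viot_def)
        then show ?thesis
        proof eventually_elim
          fix \<omega> assume r: "\<rho> 0 \<omega> = lebesgue01"
          have "(1 + \<epsilon>) / (l + \<epsilon>) \<le> 1 / l"
            using \<epsilon> l1 pos by (simp add: l_def field_simps)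
          then have "ln ((1 + \<epsilon>) / (l + \<epsilon>)) \<le> ln (1 / l)"
            using \<epsilon> pos by (intro ln_mono) (auto simp: l_def intro!: divide_pos_pos add_pos_pos)
          then have "ln ((1 + \<epsilon>) / (l + \<epsilon>)) / m \<le> ln (1 / l) / m" using m by (intro divide_right_mono) auto
          moreover have "0 \<le> ln (1 / l) / m" using l1 pos m by (auto simp: l_def intro!: divide_nonneg_nonneg ln_ge_zero)
          ultimately show "?G 0 \<omega> \<le> ln (1 / l) / m"
            unfolding r l_def[symmetric] floor_fun_def by (auto simp: indicator_def)
        qed
      qed
      show "AE \<omega> in P. 0 \<le> ln (1 / l) / m" using l1 pos m by (auto simp: l_def intro!: divide_nonneg_nonneg ln_ge_zero)
    qed simp
    finally show ?thesis by (simp add: P.prob_space m_def)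
  qed
  have "(\<lambda>k. ln (1 / l) / real (Suc k) + beta (real (Suc k)) * t) \<longlonglongrightarrow> 0 + 0 * t"
    by (intro tendsto_intros beta_tendsto LIMSEQ_Suc[OF lim_const_over_n])
  then have "P.prob Z \<le> 0 + 0 * t"
    using key by (intro LIMSEQ_le_const) auto
  then have "P.prob Z = 0" using measure_nonneg[of P Z] by simp
  then have "AE \<omega> in P. \<omega> \<notin> Z" using Z by (simp add: P.prob_eq_0)
  then show ?thesis
  proof (rule AE_mp, intro AE_I2 impI)
    fix \<omega> assume "\<omega> \<in> space P" "\<omega> \<notin> Z"
    then show "0 < measure (\<rho> t \<omega>) J" using measure_nonneg[of "\<rho> t \<omega>" J] by (auto simp: Z_def less_le)
  qed
qed

text \<open>Integer times suffice, since limits along all times imply those along the integers; they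
  also make the exceptional set a countable combination of events. The parameters leave in the order
  \<eta>, the final time \<open>N\<close>, \<open>m\<close>, the starting time \<open>T\<close>,
  \<delta>.\<close>

lemma no_second_Eve:
  assumes J: "closed J" "J \<subseteq> U" and U: "closed U" "U \<subseteq> {0..1}" and pos: "0 < measure lebesgue01 J"
  shows "AE \<omega> in P. \<not> ((\<lambda>N::nat. measure (\<rho> (real N) \<omega>) U) \<longlonglongrightarrow> 0 \<and>
     (\<forall>\<^sub>F N in sequentially. 0 < measure (\<rho> (real N) \<omega>) U) \<and>
     (\<lambda>N. measure (\<rho> (real N) \<omega>) J / measure (\<rho> (real N) \<omega>) U) \<longlonglongrightarrow> 0)"
proof -
  define b where "b = (\<lambda>N \<omega>. measure (\<rho> (real N) \<omega>) J)"
  define u where "u = (\<lambda>N \<omega>. measure (\<rho> (real N) \<omega>) U)"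
  have J01: "J \<subseteq> {0..1}" "J \<noteq> {}" using J U pos by auto
  have [measurable]: "b N \<in> borel_measurable P" "u N \<in> borel_measurable P" for N
    unfolding b_def u_def using J U J01 by (auto intro!: mass_measurable closed_sets_borel01)
  have bu: "0 \<le> b N \<omega>" "b N \<omega> \<le> u N \<omega>" "u N \<omega> \<le> 1" if "\<omega> \<in> space P" for N \<omega>
  proof -
    have M: "\<rho> (real N) \<omega> \<in> space M1" using that by (intro rho_M1) auto
    interpret R: prob_space "\<rho> (real N) \<omega>" by (rule M1D[OF M])
    show "0 \<le> b N \<omega>" "u N \<omega> \<le> 1" by (simp_all add: b_def u_def R.prob_le_1)
    show "b N \<omega> \<le> u N \<omega>"
      unfolding b_def u_def using J U closed_sets_borel01[of U] M1D(2)[OF M]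
      by (intro R.finite_measure_mono) auto
  qed
  obtain C u0 where C: "0 \<le> C" and u0: "0 < u0" "u0 \<le> 1"
    and gen: "\<And>m \<epsilon> b u. 1 \<le> m \<Longrightarrow> 0 < \<epsilon> \<Longrightarrow> \<epsilon> \<le> u0 \<Longrightarrow> 0 \<le> b \<Longrightarrow> b \<le> u \<Longrightarrow> u \<le> 1 \<Longrightarrow>
       two_type_gen (nu \<Lambda>) (Lyap C u0 m \<epsilon>) b u \<le> 0"
    using two_type_gen_Lyap by metis
  obtain Q where Q: "0 \<le> Q" "\<And>s. 0 < s \<Longrightarrow> s \<le> 2 \<Longrightarrow> psi s \<le> Q" using psi_bounded by blast
  define K where "K = C * (1 + Q)"
  define c where "c = (\<lambda>m. beta m + 1 / m)"
  have c0: "0 \<le> c m" if "1 \<le> m" for m using beta_nonneg[OF that] that by (simp add: c_def)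
  \<comment> \<open>\<open>BT\<close> is the event from which the process is restarted at time
    \<open>T\<close>. \<open>CN\<close> says that at time \<open>N\<close> the ratio is so extreme
    that the Lyapunov function has reached its cutoff, once \<epsilon> is small enough.\<close>
  define BT where "BT = (\<lambda>\<delta> T. {\<omega> \<in> space P. u T \<omega> \<le> \<delta>})"
  define CN where "CN = (\<lambda>m N. {\<omega> \<in> space P. 0 < u N \<omega> \<and> b N \<omega> \<le> exp (- 2 * real (Suc m)) * u N \<omega>})"
  let ?h = "\<lambda>\<delta> T m \<omega>. indicator (BT \<delta> T) \<omega> * min 1 (ln (u T \<omega> / b T \<omega>) / m + c m * K + \<delta> / u0)"
  \<comment> \<open>A bound on the Lyapunov function at time \<open>T\<close> in which the shift is
    gone and \<open>C * (u + psi (u + \<epsilon>))\<close> is replaced by its maximal size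
    \<open>K\<close>; it involves neither \<eta> nor \<open>N\<close>.\<close>
  define R where "R = (\<lambda>\<delta> T m. \<integral>\<omega>. ?h \<delta> T (real (Suc m)) \<omega> \<partial>P)"
  have [measurable]: "BT \<delta> T \<in> P.events" "CN m N \<in> P.events" for \<delta> T m N
    unfolding BT_def CN_def by measurable
  have bpos: "AE \<omega> in P. 0 < b T \<omega>" for T
    unfolding b_def using J(1) J01(1) pos by (intro mass_pos) auto
  have step: "P.prob (BT \<delta> T \<inter> {\<omega> \<in> space P. \<eta> \<le> u N \<omega> \<and> b N \<omega> \<le> exp (- 2 * real (Suc k)) * u N \<omega>}) \<le> R \<delta> T k"
    if \<eta>: "0 < \<eta>" "\<eta> \<le> 1" and TN: "T \<le> N" and \<delta>: "0 \<le> \<delta>" for \<eta> N T \<delta> k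
  proof -
    define m where "m = real (Suc k)"
    \<comment> \<open>On the event \<open>u N\<close> is at least \<eta>, so \<epsilon> is at most
      \<open>exp (- 2 * m) * u N\<close> and the shift at most doubles the bound on
      \<open>b N\<close>. The factor \<open>u0\<close> keeps \<epsilon> in the range of the drift
      estimate.\<close>
    define \<epsilon> where "\<epsilon> = u0 * \<eta> * exp (- 2 * m)"
    have m: "1 \<le> m" by (simp add: m_def)
    have \<epsilon>: "0 < \<epsilon>" using u0 \<eta> by (simp add: \<epsilon>_def)
    have \<epsilon>1: "\<epsilon> \<le> u0" "\<epsilon> \<le> \<eta> * exp (- 2 * m)"
    proof -
      have "\<eta> * exp (- 2 * m) \<le> 1 * 1" using \<eta> m by (intro mult_mono) auto
      then have "u0 * (\<eta> * exp (- 2 * m)) \<le> u0 * 1" using u0 by (intro mult_left_mono) auto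
      then show "\<epsilon> \<le> u0" by (simp add: \<epsilon>_def mult.assoc)
      have "u0 * (\<eta> * exp (- 2 * m)) \<le> 1 * (\<eta> * exp (- 2 * m))" using u0 \<eta> by (intro mult_right_mono) auto
      then show "\<epsilon> \<le> \<eta> * exp (- 2 * m)" by (simp add: \<epsilon>_def mult.assoc)
    qed
    let ?F = "Lyap C u0 m \<epsilon>"
    let ?H = "\<lambda>N \<omega>. indicator (BT \<delta> T) \<omega> * ?F (b N \<omega>) (u N \<omega>)"
    obtain L where L: "lip01 L ?F" using lip01_Lyap[OF C u0(1) m \<epsilon>] \<epsilon>1 u0 by auto
    define A where "A = BT \<delta> T \<inter> {\<omega> \<in> space P. \<eta> \<le> u N \<omega> \<and> b N \<omega> \<le> exp (- 2 * m) * u N \<omega>}"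
    have A [measurable]: "A \<in> P.events" unfolding A_def by measurable
    have G0: "0 \<le> c m * (C * (x + psi (x + \<epsilon>)))" "c m * (C * (x + psi (x + \<epsilon>))) \<le> c m * K" if "0 \<le> x" "x \<le> 1" for x
      using that \<epsilon> \<epsilon>1 u0 C Q(2)[of "x + \<epsilon>"] psi_nonneg[of "x + \<epsilon>"] c0[OF m] unfolding K_def
      by (auto intro!: mult_left_mono mult_nonneg_nonneg)
    have l0: "0 \<le> ln ((x + \<epsilon>) / (y + \<epsilon>)) / m" if "0 \<le> y" "y \<le> x" for x y
      using that \<epsilon> m by (auto intro!: divide_nonneg_nonneg ln_ge_zero)
    have Lyap_c: "?F y x = min 1 (ln ((x + \<epsilon>) / (y + \<epsilon>)) / m + c m * (C * (x + psi (x + \<epsilon>))) + x / u0)" for x y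
      by (simp add: Lyap_def c_def)
    have F0: "0 \<le> ?F y x" if "0 \<le> y" "y \<le> x" "x \<le> 1" for x y
      using l0[of y x] G0[of x] that u0 unfolding Lyap_c by auto
    have F1: "?F y x \<le> 1" for x y by (simp add: Lyap_def)
    have FA: "?F (b N \<omega>) (u N \<omega>) = 1" if "\<omega> \<in> A" for \<omega>
    proof -
      have w: "\<omega> \<in> space P" "\<eta> \<le> u N \<omega>" "b N \<omega> \<le> exp (- 2 * m) * u N \<omega>" using that by (auto simp: A_def)
      note bu' = bu[OF w(1), of N]
      have "exp (- 2 * m) * \<eta> \<le> exp (- 2 * m) * u N \<omega>" using w(2) by (intro mult_left_mono) auto
      moreover have "\<epsilon> \<le> exp (- 2 * m) * \<eta>" using \<epsilon>1(2) by (simp only: mult.commute)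
      ultimately have d: "b N \<omega> + \<epsilon> \<le> 2 * exp (- 2 * m) * u N \<omega>" using w(3) by linarith
      \<comment> \<open>Of the factor \<open>exp (- 2 * m)\<close>, one half
        \<open>exp (- m)\<close> absorbs the 2 coming from the shift, and the other gives the ratio
        \<open>exp m\<close>, whose logarithm divided by \<open>m\<close> is 1.\<close>
      have e2: "2 \<le> exp m" using exp_ge_add_one_self[of m] m by linarith
      have "exp m * (b N \<omega> + \<epsilon>) \<le> exp m * (2 * exp (- 2 * m) * u N \<omega>)" using d by (intro mult_left_mono) auto
      also have "\<dots> = 2 * exp (- m) * u N \<omega>" by (simp flip: exp_add)
      also have "\<dots> \<le> 1 * u N \<omega>" using e2 bu' by (intro mult_right_mono) (auto simp: exp_minus field_simps)
      also have "\<dots> \<le> u N \<omega> + \<epsilon>" using \<epsilon> by simp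
      finally have "exp m \<le> (u N \<omega> + \<epsilon>) / (b N \<omega> + \<epsilon>)" using bu' \<epsilon> by (simp add: pos_le_divide_eq)
      then have "ln (exp m) \<le> ln ((u N \<omega> + \<epsilon>) / (b N \<omega> + \<epsilon>))" by (intro ln_mono) auto
      then have "1 \<le> ln ((u N \<omega> + \<epsilon>) / (b N \<omega> + \<epsilon>)) / m" using m by (simp add: pos_le_divide_eq)
      moreover have "0 \<le> u N \<omega> / u0" using bu' u0 by simp
      ultimately show ?thesis using G0[of "u N \<omega>"] bu' unfolding Lyap_c by auto
    qed
    have Fm: "(\<lambda>\<omega>. ?F (b N \<omega>) (u N \<omega>)) \<in> borel_measurable P" for N
    proof (rule lip01_measurable[OF L])
      show "b N \<in> borel_measurable P" "u N \<in> borel_measurable P" by measurable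
      show "b N \<omega> \<in> {0..1}" "u N \<omega> \<in> {0..1}" if "\<omega> \<in> space P" for \<omega>
        using bu[OF that, of N] by auto
    qed
    have Bf: "BT \<delta> T \<in> sets (natural_filtration P M1 \<rho> (real T))"
    proof -
      have "{\<mu> \<in> space M1. measure \<mu> U \<le> \<delta>} \<in> sets M1"
        using M1_measurable[OF measurable_measure_subprob_algebra[OF closed_sets_borel01[OF U]]] by measurable
      from filtration_events[OF _ this, of "real T"] have "{\<omega> \<in> space P. \<rho> (real T) \<omega> \<in> {\<mu> \<in> space M1. measure \<mu> U \<le> \<delta>}}
        \<in> sets (natural_filtration P M1 \<rho> (real T))" by simp
      also have "{\<omega> \<in> space P. \<rho> (real T) \<omega> \<in> {\<mu> \<in> space M1. measure \<mu> U \<le> \<delta>}} = BT \<delta> T"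
        using rho_M1[of "real T"] by (auto simp: BT_def u_def)
      finally show ?thesis .
    qed
    have "P.prob A = (\<integral>\<omega>. indicator A \<omega> \<partial>P)" using A by simp
    also have "\<dots> \<le> (\<integral>\<omega>. ?H N \<omega> \<partial>P)"
    proof (rule integral_mono_AE')
      show "integrable P (\<lambda>\<omega>. ?H N \<omega>)"
      proof (rule P.integrable_const_bound[where B=1])
        show "AE \<omega> in P. norm (?H N \<omega>) \<le> 1"
          using F0[OF bu] F1 by (intro AE_I2) (simp add: indicator_def)
      qed (use Fm in measurable)
      show "AE \<omega> in P. indicator A \<omega> \<le> ?H N \<omega>"
        using F0[OF bu] FA by (intro AE_I2) (auto simp: indicator_def A_def)
      show "AE \<omega> in P. 0 \<le> ?H N \<omega>"
        using F0[OF bu] by (intro AE_I2) (simp add: indicator_def)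
    qed
    also have "\<dots> \<le> (\<integral>\<omega>. ?H T \<omega> \<partial>P) + 0 * (real N - real T)"
      unfolding b_def u_def using J J01 U TN gen[OF m \<epsilon> \<epsilon>1(1)] Bf by (intro drift[OF L]) auto
    also have "(\<integral>\<omega>. ?H T \<omega> \<partial>P) \<le> R \<delta> T k"
      unfolding R_def m_def[symmetric]
    proof (rule integral_mono_AE')
      have r0: "0 \<le> ln (u T \<omega> / b T \<omega>) / m + c m * K + \<delta> / u0" if "\<omega> \<in> space P" "0 < b T \<omega>" for \<omega>
        using bu[OF that(1), of T] that m c0[OF m] C Q u0 \<delta>
        by (auto simp: K_def intro!: add_nonneg_nonneg divide_nonneg_nonneg ln_ge_zero mult_nonneg_nonneg)
      show "integrable P (\<lambda>\<omega>. ?h \<delta> T m \<omega>)"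
      proof (rule P.integrable_const_bound[where B=1])
        show "AE \<omega> in P. norm (?h \<delta> T m \<omega>) \<le> 1"
          using bpos[of T] AE_space
          by eventually_elim (use r0 in \<open>simp add: indicator_def\<close>)
      qed measurable
      show "AE \<omega> in P. 0 \<le> ?h \<delta> T m \<omega>"
        using bpos[of T] AE_space
        by eventually_elim (use r0 in \<open>simp add: indicator_def\<close>)
      show "AE \<omega> in P. ?H T \<omega>
        \<le> ?h \<delta> T m \<omega>"
        using bpos[of T] AE_space
      proof eventually_elim
        fix \<omega> assume p: "0 < b T \<omega>" and w: "\<omega> \<in> space P"
        note bu' = bu[OF w, of T]
        have "?F (b T \<omega>) (u T \<omega>) \<le> min 1 (ln (u T \<omega> / b T \<omega>) / m + c m * K + \<delta> / u0)" if "u T \<omega> \<le> \<delta>"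
        proof -
          \<comment> \<open>Shifting both masses moves the ratio towards 1. The positivity of
            \<open>b T\<close> makes the right-hand side a genuine quotient.\<close>
          have "(u T \<omega> + \<epsilon>) / (b T \<omega> + \<epsilon>) \<le> u T \<omega> / b T \<omega>"
            using p bu' \<epsilon> by (simp add: field_simps)
          then have "ln ((u T \<omega> + \<epsilon>) / (b T \<omega> + \<epsilon>)) \<le> ln (u T \<omega> / b T \<omega>)"
            using p bu' \<epsilon> by (intro ln_mono divide_pos_pos) auto
          then have "ln ((u T \<omega> + \<epsilon>) / (b T \<omega> + \<epsilon>)) / m \<le> ln (u T \<omega> / b T \<omega>) / m"
            using m by (intro divide_right_mono) auto
          moreover have "u T \<omega> / u0 \<le> \<delta> / u0" using that u0 by (intro divide_right_mono) auto
          ultimately show ?thesis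
            using G0(2)[of "u T \<omega>"] bu' unfolding Lyap_c by linarith
        qed
        then show "?H T \<omega>
          \<le> ?h \<delta> T m \<omega>"
          by (simp add: indicator_def BT_def)
      qed
    qed
    finally show ?thesis by (simp add: A_def m_def)
  qed
  \<comment> \<open>The lower bound \<eta> on \<open>u N\<close> is removed through the sequence
    \<open>1 / (k + 1)\<close>, at no cost because the bound is independent of it.\<close>
  have step2: "P.prob (BT \<delta> T \<inter> CN m N) \<le> R \<delta> T m" if "T \<le> N" "0 \<le> \<delta>" for \<delta> T m N
  proof (rule P.prob_le_of_eventually[where N=0])
    fix k :: nat
    show "BT \<delta> T \<inter> {\<omega> \<in> space P. 1 / real (Suc k) \<le> u N \<omega> \<and> b N \<omega> \<le> exp (- 2 * real (Suc m)) * u N \<omega>} \<in> P.events"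
      by measurable
    show "P.prob (BT \<delta> T \<inter> {\<omega> \<in> space P. 1 / real (Suc k) \<le> u N \<omega> \<and> b N \<omega> \<le> exp (- 2 * real (Suc m)) * u N \<omega>}) \<le> R \<delta> T m"
      by (rule step) (use that in auto)
  next
    fix \<omega> assume w: "\<omega> \<in> BT \<delta> T \<inter> CN m N"
    then have "0 < u N \<omega>" by (simp add: CN_def)
    then obtain k0 where k0: "inverse (real (Suc k0)) < u N \<omega>" using reals_Archimedean by blast
    show "\<forall>\<^sub>F k in sequentially. \<omega> \<in> BT \<delta> T \<inter> {\<omega> \<in> space P. 1 / real (Suc k) \<le> u N \<omega> \<and> b N \<omega> \<le> exp (- 2 * real (Suc m)) * u N \<omega>}"
      using eventually_ge_at_top[of k0]
    proof eventually_elim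
      fix k assume "k0 \<le> k"
      then have "1 / real (Suc k) \<le> 1 / real (Suc k0)" by (intro divide_left_mono) auto
      then show "\<omega> \<in> BT \<delta> T \<inter> {\<omega> \<in> space P. 1 / real (Suc k) \<le> u N \<omega> \<and> b N \<omega> \<le> exp (- 2 * real (Suc m)) * u N \<omega>}"
        using w k0 by (auto simp: CN_def inverse_eq_divide)
    qed
  qed measurable
  \<comment> \<open>The three limits are replaced by countably many conditions that they imply and
    that define an event.\<close>
  define E where "E = {\<omega> \<in> space P. (\<forall>m. \<exists>N0. \<forall>N\<ge>N0. 0 < u N \<omega> \<and> b N \<omega> \<le> exp (- 2 * real (Suc m)) * u N \<omega>) \<and>
     (\<forall>j. \<exists>N0. \<forall>N\<ge>N0. u N \<omega> \<le> 1 / real (Suc j))}"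
  have [measurable]: "E \<in> P.events" unfolding E_def by measurable
  have R_lim: "P.prob (E \<inter> BT \<delta> T) \<le> \<delta> / u0" if \<delta>: "0 \<le> \<delta>" for \<delta> T
  proof -
    \<comment> \<open>On \<open>E\<close> the event \<open>CN m N\<close> holds for all large
      \<open>N\<close>, which removes \<open>N\<close>. The limit in \<open>m\<close> that follows
      eliminates \<open>ln (u T / b T)\<close>, a fixed number for each \<omega>.\<close>
    have le: "P.prob (E \<inter> BT \<delta> T) \<le> R \<delta> T m" for m
    proof (rule P.prob_le_of_eventually[where N=T])
      show "BT \<delta> T \<inter> CN m N \<in> P.events" for N by measurable
      show "P.prob (BT \<delta> T \<inter> CN m N) \<le> R \<delta> T m" if "T \<le> N" for N using step2[OF that \<delta>] .
      show "\<forall>\<^sub>F N in sequentially. \<omega> \<in> BT \<delta> T \<inter> CN m N" if "\<omega> \<in> E \<inter> BT \<delta> T" for \<omega>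
        using that unfolding eventually_sequentially by (auto simp: E_def CN_def)
    qed measurable
    have "(\<lambda>m. R \<delta> T m) \<longlonglongrightarrow> (\<integral>\<omega>. indicator (BT \<delta> T) \<omega> * min 1 (0 + 0 * K + \<delta> / u0) \<partial>P)"
      unfolding R_def
    proof (rule integral_dominated_convergence[where w="\<lambda>_. 1"])
      show "AE \<omega> in P. (\<lambda>m. ?h \<delta> T (real (Suc m)) \<omega>)
        \<longlonglongrightarrow> indicator (BT \<delta> T) \<omega> * min 1 (0 + 0 * K + \<delta> / u0)"
      proof (rule AE_I2)
        fix \<omega>
        have "(\<lambda>m. c (real (Suc m))) \<longlonglongrightarrow> 0 + 0"
          unfolding c_def by (intro tendsto_add beta_tendsto LIMSEQ_Suc[OF lim_const_over_n])
        then have c: "(\<lambda>m. c (real (Suc m))) \<longlonglongrightarrow> 0" by simp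
        show "(\<lambda>m. ?h \<delta> T (real (Suc m)) \<omega>)
        \<longlonglongrightarrow> indicator (BT \<delta> T) \<omega> * min 1 (0 + 0 * K + \<delta> / u0)"
          by (intro tendsto_mult tendsto_min tendsto_add tendsto_const c LIMSEQ_Suc[OF lim_const_over_n])
      qed
      show "AE \<omega> in P. norm (?h \<delta> T (real (Suc m)) \<omega>) \<le> 1" for m
        using bpos[of T] AE_space
      proof eventually_elim
        fix \<omega> assume p: "0 < b T \<omega>" and w: "\<omega> \<in> space P"
        have "0 \<le> ln (u T \<omega> / b T \<omega>) / real (Suc m) + c (real (Suc m)) * K + \<delta> / u0"
          using bu[OF w, of T] p c0[of "real (Suc m)"] C Q u0 \<delta>
          by (auto simp: K_def intro!: add_nonneg_nonneg divide_nonneg_nonneg ln_ge_zero mult_nonneg_nonneg)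
        then show "norm (?h \<delta> T (real (Suc m)) \<omega>) \<le> 1"
          by (simp add: indicator_def)
      qed
    qed measurable
    then have "P.prob (E \<inter> BT \<delta> T) \<le> (\<integral>\<omega>. indicator (BT \<delta> T) \<omega> * min 1 (0 + 0 * K + \<delta> / u0) \<partial>P)"
      using le by (intro LIMSEQ_le_const) auto
    also have "\<dots> \<le> (\<integral>\<omega>. \<delta> / u0 \<partial>P)"
      by (rule integral_mono_AE') (use \<delta> u0 in \<open>auto simp: indicator_def\<close>)
    finally show ?thesis by (simp add: P.prob_space)
  qed
  \<comment> \<open>As \<open>u\<close> tends to 0 on \<open>E\<close>, each of its points lies in
    \<open>BT\<close> for all large \<open>T\<close>, whatever the level
    \<open>1 / (j + 1)\<close>.\<close>
  have "P.prob E \<le> 1 / real (Suc j) / u0" for j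
  proof (rule P.prob_le_of_eventually[where N=0])
    show "E \<inter> BT (1 / real (Suc j)) T \<in> P.events" for T by measurable
    show "P.prob (E \<inter> BT (1 / real (Suc j)) T) \<le> 1 / real (Suc j) / u0" for T by (rule R_lim) simp
    show "\<forall>\<^sub>F T in sequentially. \<omega> \<in> E \<inter> BT (1 / real (Suc j)) T" if "\<omega> \<in> E" for \<omega>
      using that unfolding eventually_sequentially by (auto simp: E_def BT_def)
  qed measurable
  moreover have "(\<lambda>j. 1 / real (Suc j) / u0) \<longlonglongrightarrow> 0 / u0"
    using u0 by (intro tendsto_divide tendsto_const LIMSEQ_Suc[OF lim_const_over_n]) simp
  ultimately have "P.prob E \<le> 0 / u0" by (intro LIMSEQ_le_const) auto
  then have "P.prob E = 0" using measure_nonneg[of P E] by simp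
  then have "AE \<omega> in P. \<omega> \<notin> E" by (simp add: P.prob_eq_0)
  then show ?thesis
  proof (rule AE_mp, intro AE_I2 impI notI, elim conjE)
    fix \<omega> assume w: "\<omega> \<in> space P" "\<omega> \<notin> E"
      and l1: "(\<lambda>N::nat. measure (\<rho> (real N) \<omega>) U) \<longlonglongrightarrow> 0"
      and l2: "\<forall>\<^sub>F N in sequentially. 0 < measure (\<rho> (real N) \<omega>) U"
      and l3: "(\<lambda>N. measure (\<rho> (real N) \<omega>) J / measure (\<rho> (real N) \<omega>) U) \<longlonglongrightarrow> 0"
    have "\<exists>N0. \<forall>N\<ge>N0. 0 < u N \<omega> \<and> b N \<omega> \<le> exp (- 2 * real (Suc m)) * u N \<omega>" for m
    proof -
      have "\<forall>\<^sub>F N in sequentially. measure (\<rho> (real N) \<omega>) J / measure (\<rho> (real N) \<omega>) U < exp (- 2 * real (Suc m))"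
        using order_tendstoD(2)[OF l3] by simp
      then have "\<forall>\<^sub>F N in sequentially. 0 < u N \<omega> \<and> b N \<omega> \<le> exp (- 2 * real (Suc m)) * u N \<omega>"
        using l2 by eventually_elim (simp add: b_def u_def divide_less_eq mult.commute)
      then show ?thesis by (simp add: eventually_sequentially)
    qed
    moreover have "\<exists>N0. \<forall>N\<ge>N0. u N \<omega> \<le> 1 / real (Suc j)" for j
    proof -
      have "\<forall>\<^sub>F N in sequentially. u N \<omega> < 1 / real (Suc j)"
        using order_tendstoD(2)[OF l1, of "1 / real (Suc j)"] by (simp add: u_def)
      then have "\<forall>\<^sub>F N in sequentially. u N \<omega> \<le> 1 / real (Suc j)" by eventually_elim simp
      then show ?thesis by (simp add: eventually_sequentially)
    qed
    ultimately show False using w by (auto simp: E_def)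
  qed
qed

end

section \<open>Reduction of the regimes and of the Eves to two masses\<close>

lemma AE_nu_of_AE:
  assumes "sets \<Lambda> = sets borel01" "AE x in \<Lambda>. Q x"
  shows "AE x in nu \<Lambda>. Q x"
proof -
  have "(\<lambda>x::real. 1 / ennreal (x\<^sup>2)) \<in> borel_measurable borel" by measurable
  then have "(\<lambda>x. 1 / ennreal (x\<^sup>2)) \<in> borel_measurable \<Lambda>"
    using measurable_restrict_space1 assms(1) measurable_cong_sets by blast
  then show ?thesis using assms(2) unfolding nu_def by (subst AE_density) auto
qed

text \<open>The density of \<open>nu\<close> is infinite at 0, so an atom of \<Lambda> there would
  give \<open>{0..<1}\<close> infinite mass.\<close>

lemma regime_discrete_no_atom:
  assumes "sets \<Lambda> = sets borel01" "regime_discrete \<Lambda>"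
  shows "emeasure \<Lambda> {0} = 0"
proof (rule ccontr)
  assume nz: "emeasure \<Lambda> {0} \<noteq> 0"
  have s: "{0} \<in> sets \<Lambda>" "{0..<1} \<in> sets \<Lambda>"
    using assms(1) by (auto simp: sets_restrict_space_iff)
  have "(\<lambda>x::real. 1 / ennreal (x\<^sup>2)) \<in> borel_measurable borel" by measurable
  then have m: "(\<lambda>x. 1 / ennreal (x\<^sup>2)) \<in> borel_measurable \<Lambda>"
    using measurable_restrict_space1 assms(1) measurable_cong_sets by blast
  have "emeasure (nu \<Lambda>) {0} = (\<integral>\<^sup>+x. 1 / ennreal (x\<^sup>2) * indicator {0} x \<partial>\<Lambda>)"
    unfolding nu_def by (rule emeasure_density[OF m s(1)])
  also have "\<dots> = (\<integral>\<^sup>+x. \<infinity> * indicator {0} x \<partial>\<Lambda>)"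
    by (intro nn_integral_cong) (auto simp: indicator_def divide_ennreal_def)
  also have "\<dots> = \<infinity>" using s(1) nz by (simp add: nn_integral_cmult_indicator ennreal_mult_eq_top_iff)
  finally have "emeasure (nu \<Lambda>) {0} = \<infinity>" .
  moreover have "emeasure (nu \<Lambda>) {0} \<le> emeasure (nu \<Lambda>) {0..<1}"
    using s by (intro emeasure_mono) (auto simp: nu_def)
  ultimately show False using assms(2) by (auto simp: regime_discrete_def)
qed

text \<open>In the discrete regime \<open>nu\<close> is finite on \<open>{0..<1}\<close>, and both
  \<open>x\<close> and \<open>x * ln (1 / x)\<close> are bounded by 1; in the other regime both
  integrals are finite by assumption.\<close>

lemma dust_measure_of_regime:
  assumes sets: "sets \<Lambda> = sets borel01" and one: "emeasure \<Lambda> {1} = 0"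
    and regime: "regime_discrete \<Lambda> \<or>
         (regime_infinite_dust \<Lambda> \<and> (\<integral>\<^sup>+x\<in>{0..<1}. ennreal (x * ln (1 / x)) \<partial>nu \<Lambda>) < \<infinity>)"
  shows "dust_measure \<Lambda>"
proof -
  have zero: "emeasure \<Lambda> {0} = 0"
    using regime regime_discrete_no_atom[OF sets] by (auto simp: regime_infinite_dust_def)
  have space: "space \<Lambda> = {0..1}" using sets_eq_imp_space_eq[OF sets] by (simp add: space_restrict_space)
  have "{0} \<in> null_sets \<Lambda>" "{1} \<in> null_sets \<Lambda>"
    using zero one sets by (auto simp: null_sets_def sets_restrict_space_iff)
  then have AE: "AE x in \<Lambda>. 0 < x \<and> x < 1"
    using AE_not_in[of "{0}" \<Lambda>] AE_not_in[of "{1}" \<Lambda>] AE_space[of \<Lambda>]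
    by (auto simp: space elim: eventually_elim2)
  note AEn = AE_nu_of_AE[OF sets AE]
  have meas: "f \<in> borel_measurable (nu \<Lambda>)" if "f \<in> borel_measurable borel" for f :: "real \<Rightarrow> real"
    using measurable_restrict_space1[OF that, of "{0..1}"] sets measurable_cong_sets[of "nu \<Lambda>" borel01 borel borel]
    by (simp add: nu_def)
  have int: "integrable (nu \<Lambda>) f"
    if f: "f \<in> borel_measurable borel" and b: "\<And>x. 0 < x \<Longrightarrow> x < 1 \<Longrightarrow> 0 \<le> f x"
      and fin: "(\<integral>\<^sup>+x\<in>{0..<1}. ennreal (f x) \<partial>nu \<Lambda>) < \<infinity>" for f :: "real \<Rightarrow> real"
  proof (rule integrableI_bounded[OF meas[OF f]])
    have "(\<integral>\<^sup>+x. ennreal (norm (f x)) \<partial>nu \<Lambda>) = (\<integral>\<^sup>+x\<in>{0..<1}. ennreal (f x) \<partial>nu \<Lambda>)"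
      by (rule nn_integral_cong_AE, use AEn in eventually_elim) (simp add: b)
    then show "(\<integral>\<^sup>+x. ennreal (norm (f x)) \<partial>nu \<Lambda>) < \<infinity>" using fin by simp
  qed
  have s: "{0..<1} \<in> sets (nu \<Lambda>)" using sets by (auto simp: nu_def sets_restrict_space_iff)
  have disc: "(\<integral>\<^sup>+x\<in>{0..<1}. ennreal (f x) \<partial>nu \<Lambda>) < \<infinity>"
    if "regime_discrete \<Lambda>" and b: "\<And>x. 0 < x \<Longrightarrow> x < 1 \<Longrightarrow> f x \<le> 1" for f :: "real \<Rightarrow> real"
  proof -
    have "(\<integral>\<^sup>+x\<in>{0..<1}. ennreal (f x) \<partial>nu \<Lambda>) \<le> (\<integral>\<^sup>+x. indicator {0..<1} x \<partial>nu \<Lambda>)"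
      by (rule nn_integral_mono_AE, use AEn in eventually_elim) (use b in \<open>simp add: ennreal_le_1\<close>)
    also have "\<dots> = emeasure (nu \<Lambda>) {0..<1}" using s by simp
    also have "\<dots> < \<infinity>" using that by (simp add: regime_discrete_def)
    finally show ?thesis .
  qed
  have xln: "0 \<le> x * ln (1 / x)" "x * ln (1 / x) \<le> 1" if "0 < x" "x < 1" for x :: real
  proof -
    show "0 \<le> x * ln (1 / x)" using that by (intro mult_nonneg_nonneg ln_ge_zero) auto
    have "x * ln (1 / x) \<le> x * (1 / x - 1)" using that by (intro mult_left_mono ln_le_minus_one) auto
    also have "\<dots> \<le> 1" using that by (simp add: right_diff_distrib)
    finally show "x * ln (1 / x) \<le> 1" .
  qed
  show ?thesis
  proof (rule dust_measure.intro)
    show "sets \<Lambda> = sets borel01" "AE x in \<Lambda>. 0 < x \<and> x < 1" by fact+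
    show "integrable (nu \<Lambda>) (\<lambda>x. x)"
    proof (rule int)
      show "(\<integral>\<^sup>+x\<in>{0..<1}. ennreal x \<partial>nu \<Lambda>) < \<infinity>"
        using regime disc[of "\<lambda>x. x"] by (auto simp: regime_infinite_dust_def)
    qed auto
    show "integrable (nu \<Lambda>) (\<lambda>x. x * ln (1 / x))"
    proof (rule int)
      show "(\<integral>\<^sup>+x\<in>{0..<1}. ennreal (x * ln (1 / x)) \<partial>nu \<Lambda>) < \<infinity>"
        using regime disc[of "\<lambda>x. x * ln (1 / x)"] xln(2) by blast
      show "(\<lambda>x::real. x * ln (1 / x)) \<in> borel_measurable borel" by measurable
    qed (rule xln)
  qed
qed

text \<open>With \<open>a\<close> and \<open>p\<close> the masses at \<open>e 1\<close> and
  \<open>e 2\<close>, the Eve limits are \<open>a \<rightarrow> 1\<close> and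
  \<open>p / (1 - a) \<rightarrow> 1\<close>; they conflict if the points coincide. Since
  \<open>U\<close> misses \<open>e 1\<close>, its mass is at most \<open>1 - a\<close>. Since
  \<open>J\<close> moreover misses \<open>e 2\<close>, its mass is at most \<open>1 - a - p\<close>,
  so its ratio to the mass of \<open>U\<close>, which is at least \<open>p\<close>, is at most
  \<open>(1 - a) / p - 1\<close>.\<close>

lemma Eves_imp_two_type_limits:
  assumes r: "\<And>t. 0 \<le> t \<Longrightarrow> r t \<in> space M1" and E: "Eves r e"
  shows "e 1 \<noteq> e 2"
    and "U \<in> sets borel01 \<Longrightarrow> J \<in> sets borel01 \<Longrightarrow> J \<subseteq> U \<Longrightarrow> e 1 \<notin> U \<Longrightarrow> e 2 \<in> U \<Longrightarrow> e 2 \<notin> J \<Longrightarrow>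
      (\<lambda>N::nat. measure (r (real N)) U) \<longlonglongrightarrow> 0 \<and>
      (\<forall>\<^sub>F N in sequentially. 0 < measure (r (real N)) U) \<and>
      (\<lambda>N. measure (r (real N)) J / measure (r (real N)) U) \<longlonglongrightarrow> 0"
proof -
  define a where "a = (\<lambda>N::nat. measure (r (real N)) {e 1})"
  define p where "p = (\<lambda>N::nat. measure (r (real N)) {e 2})"
  have e: "e 1 \<in> {0..1}" "e 2 \<in> {0..1}" using E by (auto simp: Eves_def)
  have r': "r (real N) \<in> space M1" for N by (rule r) simp
  note sets_r = M1D(2)[OF r']
  have sg: "{x} \<in> sets borel01" if "x \<in> {0..1}" for x :: real using that by (simp add: sets_restrict_space_iff)
  have d: "measure (r (real N)) ({0..1} - {e 1}) = 1 - a N" for N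
  proof -
    interpret R: prob_space "r (real N)" by (rule M1D[OF r'])
    show ?thesis using R.prob_compl[of "{e 1}"] sg[OF e(1)] M1D[OF r'] by (simp add: a_def)
  qed
  have nat_lim: "(\<lambda>N. f (real N)) \<longlonglongrightarrow> l" if "(f \<longlongrightarrow> l) at_top" for f :: "real \<Rightarrow> real" and l
    using filterlim_compose[OF that filterlim_real_sequentially] .
  have "((\<lambda>t. measure (r t) {e 1} / measure (r t) ({0..1} - e ` {1..<1})) \<longlongrightarrow> 1) at_top"
    using E by (simp only: Eves_def)
  from nat_lim[OF this] have a_lim: "a \<longlonglongrightarrow> 1"
  proof -
    have "measure (r (real N)) {0..1} = 1" for N
      using prob_space.prob_space[OF M1D(1)[OF r']] M1D(3)[OF r'] by metis
    then show ?thesis using \<open>(\<lambda>N. measure (r (real N)) {e 1} / measure (r (real N)) ({0..1} - e ` {1..<1})) \<longlonglongrightarrow> 1\<close>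
      by (simp add: a_def)
  qed
  have "{1..<2::nat} = {1}" by auto
  moreover have "((\<lambda>t. measure (r t) {e 2} / measure (r t) ({0..1} - e ` {1..<2})) \<longlongrightarrow> 1) at_top"
    using E by (simp add: Eves_def)
  ultimately have "((\<lambda>t. measure (r t) {e 2} / measure (r t) ({0..1} - {e 1})) \<longlongrightarrow> 1) at_top" by simp
  from nat_lim[OF this] have p_lim: "(\<lambda>N. p N / (1 - a N)) \<longlonglongrightarrow> 1"
    by (simp only: p_def d)
  have a01: "a N \<le> 1" for N
    using prob_space.prob_le_1[OF M1D(1)[OF r']] by (simp add: a_def)
  have p0: "0 \<le> p N" for N by (simp add: p_def)
  show "e 1 \<noteq> e 2"
  proof
    assume "e 1 = e 2"
    then have pa: "p = a" by (simp add: p_def a_def)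
    have "\<forall>\<^sub>F N in sequentially. 3/4 < a N" by (rule order_tendstoD(1)[OF a_lim]) simp
    moreover have "\<forall>\<^sub>F N in sequentially. 1/2 < a N / (1 - a N)"
      by (rule order_tendstoD(1)[OF p_lim[unfolded pa]]) simp
    moreover have "\<forall>\<^sub>F N in sequentially. a N / (1 - a N) < 2"
      by (rule order_tendstoD(2)[OF p_lim[unfolded pa]]) simp
    ultimately have "\<forall>\<^sub>F N in sequentially. False"
    proof eventually_elim
      fix N assume h: "3/4 < a N" "1/2 < a N / (1 - a N)" "a N / (1 - a N) < 2"
      \<comment> \<open>For \<open>a N = 1\<close> the quotient would be 0 by convention.\<close>
      have "a N \<noteq> 1" using h(2) by auto
      then have "0 < 1 - a N" using a01[of N] by simp
      then show False using h(1,3) by (simp add: divide_less_eq)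
    qed
    then show False by simp
  qed
  assume U: "U \<in> sets borel01" "e 1 \<notin> U" "e 2 \<in> U" and J: "J \<in> sets borel01" "J \<subseteq> U" "e 2 \<notin> J"
  have U01: "U \<subseteq> {0..1}" using sets.sets_into_space[OF U(1)] by (simp add: space_restrict_space)
  define b where "b = (\<lambda>N::nat. measure (r (real N)) J)"
  define u where "u = (\<lambda>N::nat. measure (r (real N)) U)"
  have ineq: "p N \<le> u N" "u N \<le> 1 - a N" "b N + p N \<le> 1 - a N" for N
  proof -
    interpret R: prob_space "r (real N)" by (rule M1D[OF r'])
    have D: "{0..1} - {e 1} \<in> R.events" using sg[OF e(1)] M1D[OF r'] by (metis sets.compl_sets sets_r)
    show "p N \<le> u N" unfolding p_def u_def using U sets_r by (intro R.finite_measure_mono) auto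
    show "u N \<le> 1 - a N"
      unfolding d[symmetric] u_def using U U01 D by (intro R.finite_measure_mono) auto
    have "b N + p N = measure (r (real N)) (J \<union> {e 2})"
      unfolding b_def p_def using J sg[OF e(2)] sets_r by (subst R.finite_measure_Union) auto
    also have "\<dots> \<le> measure (r (real N)) ({0..1} - {e 1})"
      using J U U01 D by (intro R.finite_measure_mono) auto
    finally show "b N + p N \<le> 1 - a N" by (simp only: d)
  qed
  have b0: "0 \<le> b N" for N by (simp add: b_def)
  have d_lim: "(\<lambda>N. 1 - a N) \<longlonglongrightarrow> 0" using tendsto_diff[OF tendsto_const a_lim, of 1] by simp
  have u_lim: "u \<longlonglongrightarrow> 0"
    by (rule tendsto_sandwich[OF _ _ tendsto_const d_lim]) (use ineq(2) in \<open>simp_all add: u_def\<close>)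
  have pp: "\<forall>\<^sub>F N in sequentially. 0 < p N"
  proof -
    have "\<forall>\<^sub>F N in sequentially. 1/2 < p N / (1 - a N)" by (rule order_tendstoD(1)[OF p_lim]) simp
    then show ?thesis
    proof eventually_elim
      fix N assume "1/2 < p N / (1 - a N)"
      then have "p N \<noteq> 0" by auto
      then show "0 < p N" using p0[of N] by simp
    qed
  qed
  then have up: "\<forall>\<^sub>F N in sequentially. 0 < u N"
    by eventually_elim (use ineq(1) in \<open>auto intro: less_le_trans\<close>)
  have "(\<lambda>N. inverse (p N / (1 - a N)) - 1) \<longlonglongrightarrow> inverse 1 - 1"
    by (intro tendsto_diff tendsto_inverse p_lim tendsto_const) simp
  then have l: "(\<lambda>N. (1 - a N) / p N - 1) \<longlonglongrightarrow> 0" by simp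
  have "(\<lambda>N. b N / u N) \<longlonglongrightarrow> 0"
  proof (rule tendsto_sandwich[OF _ _ tendsto_const l])
    show "\<forall>\<^sub>F N in sequentially. 0 \<le> b N / u N" using b0 by (simp add: u_def)
    show "\<forall>\<^sub>F N in sequentially. b N / u N \<le> (1 - a N) / p N - 1"
      using pp
    proof eventually_elim
      fix N assume p: "0 < p N"
      have "b N / u N \<le> b N / p N" using p b0[of N] ineq(1)[of N] by (intro divide_left_mono mult_pos_pos) auto
      also have "\<dots> \<le> (1 - a N - p N) / p N" using p ineq(3)[of N] by (intro divide_right_mono) auto
      also have "\<dots> = (1 - a N) / p N - 1" using p by (simp add: diff_divide_distrib)
      finally show "b N / u N \<le> (1 - a N) / p N - 1" .
    qed
  qed
  then show "(\<lambda>N::nat. measure (r (real N)) U) \<longlonglongrightarrow> 0 \<and>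
      (\<forall>\<^sub>F N in sequentially. 0 < measure (r (real N)) U) \<and>
      (\<lambda>N. measure (r (real N)) J / measure (r (real N)) U) \<longlonglongrightarrow> 0"
    using u_lim up by (simp add: u_def b_def)
qed

theorem theorem1p11:
  fixes \<Lambda> :: "real measure" and P :: "'w measure" and \<rho> :: "real \<Rightarrow> 'w \<Rightarrow> real measure"
  assumes "finite_measure \<Lambda>" and "sets \<Lambda> = sets (restrict_space borel {0..1})"
    and "emeasure \<Lambda> {1} = 0"
    and "regime_discrete \<Lambda> \<or>
         (regime_infinite_dust \<Lambda> \<and> (\<integral>\<^sup>+x\<in>{0..<1}. ennreal (x * ln (1 / x)) \<partial>nu \<Lambda>) < \<infinity>)"
    and "Fleming_Viot \<Lambda> P \<rho>"
  shows "AE \<omega> in P. \<not> (\<exists>e. Eves (\<lambda>t. \<rho> t \<omega>) e)"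
proof -
  interpret dust_measure \<Lambda> by (rule dust_measure_of_regime[OF assms(2-4)])
  interpret FV_process \<Lambda> P \<rho> by unfold_locales (rule assms(5))
  define bad where "bad = (\<lambda>J U \<omega>. (\<lambda>N::nat. measure (\<rho> (real N) \<omega>) U) \<longlonglongrightarrow> 0 \<and>
      (\<forall>\<^sub>F N in sequentially. 0 < measure (\<rho> (real N) \<omega>) U) \<and>
      (\<lambda>N. measure (\<rho> (real N) \<omega>) J / measure (\<rho> (real N) \<omega>) U) \<longlonglongrightarrow> 0)"
  have pos: "0 < measure lebesgue01 {p..q}" if "0 \<le> p" "p < q" "q \<le> 1" for p q :: real
  proof -
    have "measure lebesgue01 {p..q} = measure lborel {p..q}"
      using that by (subst measure_restrict_space) auto
    then show ?thesis using that by simp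
  qed
  \<comment> \<open>The Eves are random, so the exceptional sets are united over the countably many
    rational intervals \<open>J\<close>. Each comes with two choices of \<open>U\<close>, for the
    two possible orders of \<open>e 1\<close> and \<open>e 2\<close>.\<close>
  have "AE \<omega> in P. \<forall>p q::rat. 0 \<le> p \<and> p < q \<and> q \<le> 1 \<longrightarrow>
      \<not> bad {real_of_rat p..real_of_rat q} {0..real_of_rat q} \<omega> \<and>
      \<not> bad {real_of_rat p..real_of_rat q} {real_of_rat p..1} \<omega>"
  proof (subst AE_all_countable, intro allI, subst AE_all_countable, intro allI)
    fix p q :: rat
    show "AE \<omega> in P. 0 \<le> p \<and> p < q \<and> q \<le> 1 \<longrightarrow>
      \<not> bad {real_of_rat p..real_of_rat q} {0..real_of_rat q} \<omega> \<and>
      \<not> bad {real_of_rat p..real_of_rat q} {real_of_rat p..1} \<omega>"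
    proof (cases "0 \<le> p \<and> p < q \<and> q \<le> 1")
      case True
      then have r: "0 \<le> real_of_rat p" "real_of_rat p < real_of_rat q" "real_of_rat q \<le> 1"
        by (simp_all add: of_rat_less)
      have "AE \<omega> in P. \<not> bad {real_of_rat p..real_of_rat q} {0..real_of_rat q} \<omega>"
        unfolding bad_def using r by (intro no_second_Eve pos) auto
      moreover have "AE \<omega> in P. \<not> bad {real_of_rat p..real_of_rat q} {real_of_rat p..1} \<omega>"
        unfolding bad_def using r by (intro no_second_Eve pos) auto
      ultimately show ?thesis by eventually_elim simp
    next
      case False
      then show ?thesis by (intro AE_I2) blast
    qed
  qed
  then show ?thesis
    using AE_space
  proof eventually_elim
    fix \<omega> assume good: "\<forall>p q::rat. 0 \<le> p \<and> p < q \<and> q \<le> 1 \<longrightarrow>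
      \<not> bad {real_of_rat p..real_of_rat q} {0..real_of_rat q} \<omega> \<and>
      \<not> bad {real_of_rat p..real_of_rat q} {real_of_rat p..1} \<omega>" and \<omega>: "\<omega> \<in> space P"
    show "\<not> (\<exists>e. Eves (\<lambda>t. \<rho> t \<omega>) e)"
    proof (rule notI, elim exE)
      fix e assume E: "Eves (\<lambda>t. \<rho> t \<omega>) e"
      note lim = Eves_imp_two_type_limits[OF rho_M1[OF _ \<omega>] E]
      have e01: "e 1 \<in> {0..1}" "e 2 \<in> {0..1}" using E by (auto simp: Eves_def)
      have cl: "{x..y} \<in> sets borel01" if "0 \<le> x" "y \<le> 1" for x y :: real
        using that by (simp add: sets_restrict_space_iff)
      \<comment> \<open>With \<open>p < q\<close> strictly between the two points,
        \<open>{p..q}\<close> contains neither of them. Extending it to the end of the unit interval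
        on the side of \<open>e 2\<close> gives a \<open>U\<close> that contains \<open>e 2\<close>
        but not \<open>e 1\<close>.\<close>
      consider "e 2 < e 1" | "e 1 < e 2" using lim(1) by linarith
      then show False
      proof cases
        case 1
        obtain p where p: "e 2 < real_of_rat p" "real_of_rat p < e 1" using of_rat_dense[OF 1] by blast
        obtain q where q: "real_of_rat p < real_of_rat q" "real_of_rat q < e 1" using of_rat_dense[OF p(2)] by blast
        have "0 < real_of_rat p" "real_of_rat q < 1"
          using p q e01 unfolding atLeastAtMost_iff by linarith+
        then have pq: "0 \<le> p \<and> p < q \<and> q \<le> 1" using q(1) by (simp add: of_rat_less)
        have "bad {real_of_rat p..real_of_rat q} {0..real_of_rat q} \<omega>"
          unfolding bad_def using p q e01 pq by (intro lim(2) cl) auto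
        then show False using good pq by blast
      next
        case 2
        obtain p where p: "e 1 < real_of_rat p" "real_of_rat p < e 2" using of_rat_dense[OF 2] by blast
        obtain q where q: "real_of_rat p < real_of_rat q" "real_of_rat q < e 2" using of_rat_dense[OF p(2)] by blast
        have "0 < real_of_rat p" "real_of_rat q < 1"
          using p q e01 unfolding atLeastAtMost_iff by linarith+
        then have pq: "0 \<le> p \<and> p < q \<and> q \<le> 1" using q(1) by (simp add: of_rat_less)
        have "bad {real_of_rat p..real_of_rat q} {real_of_rat p..1} \<omega>"
          unfolding bad_def using p q e01 pq by (intro lim(2) cl) auto
        then show False using good pq by blast
      qed
    qed
  qed
qed

end
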